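(* Let $|\psi\rangle\in(\mathbb{C}^d)^{\otimes n}$ be a fully-entangled state such that the stabilizer of $|\psi\rangle^{\otimes 2}$ is $\mathcal{S}_{\psi^{\otimes 2}}=\{\mathbb{1},\mathrm{SWAP}\}$. Let $g_1,g_2,h_1,h_2$ be local invertible operators, $g_k=\bigotimes_{i=1}^n g_k^{(i)}$, $h_k=\bigotimes_{i=1}^n h_k^{(i)}$ with $g_k^{(i)},h_k^{(i)}\in\mathrm{GL}(d,\mathbb{C})$. If the (normalized) state $g_1|\psi\rangle\otimes g_2|\psi\rangle$ can be transformed into the (normalized) state $h_1|\psi\rangle\otimes h_2|\psi\rangle$ by an LOCC protocol with finitely many rounds (LOCC$_{\mathbb{N}}$), then the transformation is trivial, i.e. either $G_1\propto H_1$ and $G_2\propto H_2$, or $G_1\propto H_2$ and $G_2\propto H_1$, where $G_k=g_k^\dagger g_k$, $H_k=h_k^\dagger h_k$. Moreover, if $h_1=h_2$, the same conclusion holds for arbitrary LOCC transformations (not necessarily with finitely many rounds).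
   Context: A state in $(\mathbb{C}^d)^{\otimes n}$ is fully entangled if every single-party reduced density matrix has rank $d$. The two-copy state $|\psi\rangle^{\otimes 2}$ is regarded as an $n$-partite state with local dimension $d^2$, party $i$ holding the $i$-th subsystem of both copies; in the two-state LOCC setting, each party may act jointly on its two subsystems. The stabilizer $\mathcal{S}_{\psi^{\otimes 2}}$ is the set of operators $S=\bigotimes_{i=1}^n S^{(i)}$ with $S^{(i)}\in\mathrm{GL}(d^2,\mathbb{C})$ and $S|\psi\rangle^{\otimes 2}=|\psi\rangle^{\otimes 2}$. Here $\mathrm{SWAP}$ denotes $\mathrm{SWAP}^{\otimes n}$, where each party exchanges its two $d$-dimensional subsystems. The relation $G_k\propto H_l$ means equality up to a positive scalar; it is equivalent to $g_k|\psi\rangle$ and $h_l|\psi\rangle$ being equal up to normalization and local unitaries. *)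

theory Defs
  imports "Jordan_Normal_Form.DL_Rank" "Jordan_Normal_Form.Schur_Decomposition"
begin

text \<open>A state of n parties with local dimension D is a complex vector of dimension D^n.
  The basis index x encodes the tuple of local indices by its base-D digits:
  the local index of party i (0-based) is digit D i x.\<close>

definition digit :: "nat \<Rightarrow> nat \<Rightarrow> nat \<Rightarrow> nat" where
  "digit D i x = x div D ^ i mod D"

definition ltensor :: "nat \<Rightarrow> nat \<Rightarrow> (nat \<Rightarrow> complex mat) \<Rightarrow> complex mat" where
  "ltensor n D A = mat (D ^ n) (D ^ n) (\<lambda>(x, y). \<Prod>i<n. A i $$ (digit D i x, digit D i y))"

definition local_invertible :: "nat \<Rightarrow> nat \<Rightarrow> (nat \<Rightarrow> complex mat) \<Rightarrow> bool" where
  "local_invertible n D A \<longleftrightarrow> (\<forall>i<n. A i \<in> carrier_mat D D \<and> invertible_mat (A i))"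

text \<open>Single-party reduced density matrix of the (unnormalized) pure state v at party i:
  rho_i(a,b) = sum over the other parties' indices of v(..a..) * conj v(..b..).\<close>
definition rdm :: "nat \<Rightarrow> nat \<Rightarrow> nat \<Rightarrow> complex vec \<Rightarrow> complex mat" where
  "rdm n d i v = mat d d (\<lambda>(a, b).
     \<Sum>x\<in>{x. x < d ^ n \<and> digit d i x = a}. v $ x * cnj (v $ (x - a * d ^ i + b * d ^ i)))"

definition fully_entangled :: "nat \<Rightarrow> nat \<Rightarrow> complex vec \<Rightarrow> bool" where
  "fully_entangled n d v \<longleftrightarrow>
     (\<forall>i<n. vec_space.rank d (rdm n d i v) = d)"

text \<open>Party i holds local index c = a*d + b, where a is its subsystem of the first copy
  and b its subsystem of the second copy.\<close>
definition two_copy :: "nat \<Rightarrow> nat \<Rightarrow> complex vec \<Rightarrow> complex vec \<Rightarrow> complex vec" where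
  "two_copy n d v w = vec ((d ^ 2) ^ n) (\<lambda>x.
      v $ (\<Sum>i<n. (digit (d ^ 2) i x div d) * d ^ i) *
      w $ (\<Sum>i<n. (digit (d ^ 2) i x mod d) * d ^ i))"

definition swap_loc :: "nat \<Rightarrow> complex mat" where
  "swap_loc d = mat (d ^ 2) (d ^ 2) (\<lambda>(r, c). if r = (c mod d) * d + c div d then 1 else 0)"

definition SWAP_all :: "nat \<Rightarrow> nat \<Rightarrow> complex mat" where
  "SWAP_all n d = ltensor n (d ^ 2) (\<lambda>_. swap_loc d)"

definition stabilizer :: "nat \<Rightarrow> nat \<Rightarrow> complex vec \<Rightarrow> complex mat set" where
  "stabilizer n D v = {S. \<exists>A. local_invertible n D A \<and> S = ltensor n D A \<and> S *\<^sub>v v = v}"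

text \<open>A protocol tree: either stop, or party i performs a local measurement with Kraus
  operators K_j, broadcasts the outcome j and the protocol continues with the j-th subtree.\<close>
datatype proto = Leaf | Meas nat "(complex mat \<times> proto) list"

inductive wf_proto :: "nat \<Rightarrow> nat \<Rightarrow> proto \<Rightarrow> bool" for n D where
  "wf_proto n D Leaf"
| "\<lbrakk> i < n; ks \<noteq> [];
     \<And>K p. (K, p) \<in> set ks \<Longrightarrow> K \<in> carrier_mat D D \<and> wf_proto n D p;
     foldr (+) (map (\<lambda>(K, p). mat_adjoint K * K) ks) (0\<^sub>m D D) = 1\<^sub>m D \<rbrakk>
   \<Longrightarrow> wf_proto n D (Meas i ks)"

definition lift :: "nat \<Rightarrow> nat \<Rightarrow> nat \<Rightarrow> complex mat \<Rightarrow> complex mat" where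
  "lift n D i K = ltensor n D (\<lambda>j. if j = i then K else 1\<^sub>m D)"

fun kraus :: "nat \<Rightarrow> nat \<Rightarrow> proto \<Rightarrow> complex mat list" where
  "kraus n D Leaf = [1\<^sub>m (D ^ n)]"
| "kraus n D (Meas i ks) =
     concat (map (\<lambda>kp. map (\<lambda>L. L * lift n D i (fst kp)) (kraus n D (snd kp))) ks)"

definition channel :: "nat \<Rightarrow> nat \<Rightarrow> proto \<Rightarrow> complex mat \<Rightarrow> complex mat" where
  "channel n D P \<rho> = foldr (+) (map (\<lambda>K. K * \<rho> * mat_adjoint K) (kraus n D P)) (0\<^sub>m (D ^ n) (D ^ n))"

inductive proto_ext :: "proto \<Rightarrow> proto \<Rightarrow> bool" where
  "proto_ext Leaf q"
| "\<lbrakk> length ks = length ks';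
     \<And>j. j < length ks \<Longrightarrow> fst (ks ! j) = fst (ks' ! j) \<and> proto_ext (snd (ks ! j)) (snd (ks' ! j)) \<rbrakk>
   \<Longrightarrow> proto_ext (Meas i ks) (Meas i ks')"

definition vnorm :: "complex vec \<Rightarrow> real" where
  "vnorm v = sqrt (\<Sum>i<dim_vec v. (cmod (v $ i))\<^sup>2)"

definition normalize :: "complex vec \<Rightarrow> complex vec" where
  "normalize v = complex_of_real (1 / vnorm v) \<cdot>\<^sub>v v"

definition proj :: "complex vec \<Rightarrow> complex mat" where
  "proj v = mat (dim_vec v) (dim_vec v) (\<lambda>(i, j). v $ i * cnj (v $ j))"

definition LOCCN_trans :: "nat \<Rightarrow> nat \<Rightarrow> complex vec \<Rightarrow> complex vec \<Rightarrow> bool" where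
  "LOCCN_trans n D v w \<longleftrightarrow>
     (\<exists>P. wf_proto n D P \<and> channel n D P (proj (normalize v)) = proj (normalize w))"

text \<open>Arbitrary LOCC (possibly infinitely many rounds): the channel is the limit of the channels
  of a sequence of finite-round protocols, each a continuation of the previous one.\<close>
definition LOCC_channel :: "nat \<Rightarrow> nat \<Rightarrow> (complex mat \<Rightarrow> complex mat) \<Rightarrow> bool" where
  "LOCC_channel n D \<Lambda> \<longleftrightarrow>
     (\<exists>Ps :: nat \<Rightarrow> proto.
        (\<forall>r. wf_proto n D (Ps r) \<and> proto_ext (Ps r) (Ps (Suc r))) \<and>
        (\<forall>\<rho> \<in> carrier_mat (D ^ n) (D ^ n). \<Lambda> \<rho> \<in> carrier_mat (D ^ n) (D ^ n) \<and>
           (\<forall>a < D ^ n. \<forall>b < D ^ n. (\<lambda>r. channel n D (Ps r) \<rho> $$ (a, b)) \<longlonglongrightarrow> \<Lambda> \<rho> $$ (a, b))))"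

definition LOCC_trans :: "nat \<Rightarrow> nat \<Rightarrow> complex vec \<Rightarrow> complex vec \<Rightarrow> bool" where
  "LOCC_trans n D v w \<longleftrightarrow>
     (\<exists>\<Lambda>. LOCC_channel n D \<Lambda> \<and> \<Lambda> (proj (normalize v)) = proj (normalize w))"

definition prop_pos :: "complex mat \<Rightarrow> complex mat \<Rightarrow> bool" where
  "prop_pos G H \<longleftrightarrow> (\<exists>c::real. c > 0 \<and> G = complex_of_real c \<cdot>\<^sub>m H)"

end

theory Submission
  imports Defs
begin

text \<open>Write \<open>\<Psi>\<close> for two copies of the state, \<open>g = g1 \<otimes> g2\<close>, \<open>h = h1 \<otimes> h2\<close>. The output is pure, so every
  Kraus operator \<open>K\<close> of the protocol maps \<open>g \<Psi>\<close> to a multiple of \<open>h \<Psi>\<close>. Since \<open>h \<Psi>\<close> is fully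
  entangled, a nonzero multiple forces every factor of \<open>K\<close> to be invertible, and the stabilizer
  condition gives \<open>K g = c h\<close> or \<open>K g = c h SWAP\<close>. In a finite protocol a branch with \<open>K g \<Psi> = 0\<close>
  has \<open>K = 0\<close>, because the local measurement operator at which the state dies vanishes by full
  entanglement. Hence completeness of the Kraus operators reads
  \<open>G1 \<otimes> G2 = p (H1 \<otimes> H2) + q (H2 \<otimes> H1)\<close>, and comparing operator-Schmidt ranks across the two copies
  yields the claim.

  For infinitely many rounds and \<open>h1 = h2\<close>, annihilating branches can survive in the limit and one
  only gets \<open>r H \<le> G\<close>, where \<open>H = h\<^sup>\<dagger> h\<close>, \<open>G = g\<^sup>\<dagger> g\<close>, with equality of the expectation values in \<open>\<Psi>\<close>.
  Positivity turns this into \<open>G \<Psi> = r H \<Psi>\<close>, so \<open>H\<^sup>-\<^sup>1 G / r\<close> stabilizes \<open>\<Psi>\<close>; it cannot be a nontrivial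
  \<open>SWAP\<close>, on whose antisymmetric vectors \<open>G\<close> would be negative.\<close>

section \<open>Tensor products of local operators\<close>

text \<open>The branches of an infinite protocol are never followed individually.
  \<open>defect\<close> measures how far a branch vector is from the target line; it is quadratic in
  that vector, so its sum over all branches depends on the output state alone, vanishes for an exact
  pure output and tends to 0 along a converging sequence of protocols. Completeness likewise
  conserves the sums of \<open>sqn (K *\<^sub>v u)\<close> and of \<open>frob (K * M)\<close>. An
  inequality per local operator that is linear in these quantities therefore survives summation with
  constants independent of the number of branches. Compactness supplies it, with every tensor factor
  normalized separately so that the limit is again a nonzero product operator. The obstacle
  throughout is a nonzero product operator that annihilates the entangled vector. The finite case
  excludes it by descending the protocol tree; the limit case pays for it with a small multiple of
  \<open>frob\<close>. Equality of the two target operators enters where both stabilizer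
  alternatives must give the same norm on an arbitrary vector: the target then commutes with the
  swap, which preserves norms.\<close>

lemma digit_less: "D > 0 \<Longrightarrow> digit D i x < D"
  by (simp add: digit_def)

lemma digit_expand: "x < D ^ n \<Longrightarrow> (\<Sum>i<n. digit D i x * D ^ i) = x"
proof (induction n arbitrary: x)
  case 0
  then show ?case by simp
next
  case (Suc n)
  have D: "D > 0" using Suc.prems by (cases "D = 0") auto
  have top: "digit D n x = x div D ^ n"
    using Suc.prems D by (simp add: digit_def less_mult_imp_div_less)
  have "digit D i (x mod D ^ n) = digit D i x" if i: "i < n" for i
  proof -
    \<comment> \<open>\<open>D ^ i * D\<close> divides \<open>D ^ n\<close>, so reduction modulo
      \<open>D ^ n\<close> leaves digit \<open>i\<close> untouched.\<close>
    obtain k where k: "n = i + Suc k" using less_imp_Suc_add[OF i] by auto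
    have e: "D ^ n = D ^ i * (D * D ^ k)" by (simp add: k power_add)
    have "x mod D ^ n div D ^ i = (x div D ^ i) mod (D * D ^ k)"
      unfolding e by (simp add: mod_mult2_eq D)
    then show ?thesis by (simp add: digit_def mod_mod_cancel)
  qed
  then have "(\<Sum>i<n. digit D i x * D ^ i) = x mod D ^ n"
    using Suc.IH[of "x mod D ^ n"] D by simp
  then show ?case using top by (simp add: add.commute mod_div_mult_eq)
qed

lemma digit_eqI:
  assumes "x < D ^ n" "y < D ^ n" "\<And>i. i < n \<Longrightarrow> digit D i x = digit D i y"
  shows "x = y"
proof -
  have "(\<Sum>i<n. digit D i x * D ^ i) = (\<Sum>i<n. digit D i y * D ^ i)"
    using assms(3) by (intro sum.cong) auto
  then show ?thesis using digit_expand[OF assms(1)] digit_expand[OF assms(2)] by simp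
qed

lemma encode_less:
  fixes f :: "nat \<Rightarrow> nat"
  assumes "\<And>i. i < n \<Longrightarrow> f i < D"
  shows "(\<Sum>i<n. f i * D ^ i) < D ^ n"
  using assms
proof (induction n)
  case 0
  then show ?case by simp
next
  case (Suc n)
  have "(\<Sum>i<n. f i * D ^ i) < D ^ n" using Suc by simp
  moreover have "Suc (f n) * D ^ n \<le> D * D ^ n"
    using Suc.prems[of n] by (intro mult_right_mono) auto
  ultimately show ?case by simp
qed

lemma digit_encode:
  fixes f :: "nat \<Rightarrow> nat"
  assumes "\<And>i. i < n \<Longrightarrow> f i < D" "i < n"
  shows "digit D i (\<Sum>j<n. f j * D ^ j) = f i"
  using assms
proof (induction n)
  case 0
  then show ?case by simp
next
  case (Suc n)
  have D: "D > 0" using Suc.prems(1)[of n] by simp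
  have lt: "(\<Sum>j<n. f j * D ^ j) < D ^ n" using Suc.prems by (intro encode_less) auto
  show ?case
  proof (cases "i = n")
    case True
    then show ?thesis using lt D Suc.prems(1)[of n] by (simp add: digit_def)
  next
    case False
    with Suc.prems(2) have i: "i < n" by simp
    obtain k where k: "n = i + Suc k" using less_imp_Suc_add[OF i] by auto
    have "((\<Sum>j<n. f j * D ^ j) + f n * D ^ n) div D ^ i
        = (\<Sum>j<n. f j * D ^ j) div D ^ i + D * (f n * D ^ k)"
    proof -
      have "f n * D ^ n = D ^ i * (D * (f n * D ^ k))" by (simp add: k power_add)
      then show ?thesis using D by (simp only: div_mult_self2[of "D ^ i"] power_eq_0_iff) simp
    qed
    then show ?thesis using Suc.IH Suc.prems(1) i by (simp add: digit_def)
  qed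
qed

text \<open>Generalized distributivity: expanding the product of sums picks one local index per
  party, and the digits of \<open>y\<close> run through each such choice once. This turns matrix
  products of \<open>ltensor\<close> into partywise products.\<close>

lemma sum_prod_digits:
  fixes f :: "nat \<Rightarrow> nat \<Rightarrow> 'a::comm_semiring_1"
  assumes D: "D > 0"
  shows "(\<Sum>y<D ^ n. \<Prod>i<n. f i (digit D i y)) = (\<Prod>i<n. \<Sum>a<D. f i a)"
proof (induction n)
  case 0
  then show ?case by simp
next
  case (Suc n)
  \<comment> \<open>The leading digit \<open>a\<close> selects a block of \<open>D ^ n\<close>
    consecutive indices, inside which only the lower digits vary.\<close>
  have "(\<Sum>y<D ^ Suc n. \<Prod>i<Suc n. f i (digit D i y))
      = (\<Sum>a<D. \<Sum>y\<in>{a * D ^ n..<a * D ^ n + D ^ n}. \<Prod>i<Suc n. f i (digit D i y))"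
    by (subst sum.nat_group) simp
  also have "\<dots> = (\<Sum>a<D. \<Sum>y<D ^ n. (\<Prod>i<n. f i (digit D i y)) * f n a)"
  proof (rule sum.cong[OF refl])
    fix a assume a: "a \<in> {..<D}"
    have "(\<Sum>y\<in>{a * D ^ n..<a * D ^ n + D ^ n}. \<Prod>i<Suc n. f i (digit D i y))
        = (\<Sum>y<D ^ n. \<Prod>i<Suc n. f i (digit D i (y + a * D ^ n)))"
      using sum.shift_bounds_nat_ivl[of "\<lambda>y. \<Prod>i<Suc n. f i (digit D i y)" 0 "a * D ^ n" "D ^ n"]
      by (simp add: atLeast0LessThan add.commute)
    also have "\<dots> = (\<Sum>y<D ^ n. (\<Prod>i<n. f i (digit D i y)) * f n a)"
    proof (intro sum.cong refl)
      fix y assume y: "y \<in> {..<D ^ n}"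
      define c where "c i = (if i < n then digit D i y else a)" for i
      have c: "c i < D" for i using a D by (simp add: c_def digit_less)
      have "y + a * D ^ n = (\<Sum>i<Suc n. c i * D ^ i)"
        using digit_expand[of y D n] y by (simp add: c_def)
      then have "digit D i (y + a * D ^ n) = c i" if "i < Suc n" for i
        using digit_encode[of "Suc n" c D i] c that by simp
      then have "(\<Prod>i<Suc n. f i (digit D i (y + a * D ^ n))) = (\<Prod>i<Suc n. f i (c i))"
        by (intro prod.cong) auto
      then show "(\<Prod>i<Suc n. f i (digit D i (y + a * D ^ n))) = (\<Prod>i<n. f i (digit D i y)) * f n a"
        by (simp add: c_def)
    qed
    finally show "(\<Sum>y\<in>{a * D ^ n..<a * D ^ n + D ^ n}. \<Prod>i<Suc n. f i (digit D i y))
        = (\<Sum>y<D ^ n. (\<Prod>i<n. f i (digit D i y)) * f n a)" .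
  qed
  also have "\<dots> = (\<Prod>i<Suc n. \<Sum>a<D. f i a)"
    by (simp add: Suc.IH[symmetric] sum_product mult.commute sum.swap[of _ "{..<D ^ n}"])
  finally show ?case .
qed

section \<open>Entrywise products, adjoints and the algebra of \<open>ltensor\<close>\<close>

lemma index_mult_mat_sum:
  assumes "A \<in> carrier_mat m k" "B \<in> carrier_mat k l" "i < m" "j < l"
  shows "(A * B) $$ (i, j) = (\<Sum>t<k. A $$ (i, t) * B $$ (t, j))"
  using assms by (simp add: scalar_prod_def atLeast0LessThan)

lemma index_mult_mat_vec_sum:
  assumes "A \<in> carrier_mat m k" "v \<in> carrier_vec k" "i < m"
  shows "(A *\<^sub>v v) $ i = (\<Sum>t<k. A $$ (i, t) * v $ t)"
  using assms by (simp add: scalar_prod_def atLeast0LessThan)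

lemma mat_adjoint_carrier [simp]: "A \<in> carrier_mat m k \<Longrightarrow> mat_adjoint A \<in> carrier_mat k m"
  unfolding mat_adjoint_def by auto

lemma mat_adjoint_index:
  fixes A :: "complex mat"
  assumes "A \<in> carrier_mat m k" "i < k" "j < m"
  shows "mat_adjoint A $$ (i, j) = cnj (A $$ (j, i))"
  using assms unfolding mat_adjoint_def by (simp add: mat_of_rows_index)

lemma mat_adjoint_mult:
  fixes A B :: "complex mat"
  assumes "A \<in> carrier_mat m k" "B \<in> carrier_mat k l"
  shows "mat_adjoint (A * B) = mat_adjoint B * mat_adjoint A"
proof (rule eq_matI)
  have AB: "A * B \<in> carrier_mat m l" using assms by simp
  show "dim_row (mat_adjoint (A * B)) = dim_row (mat_adjoint B * mat_adjoint A)"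
    "dim_col (mat_adjoint (A * B)) = dim_col (mat_adjoint B * mat_adjoint A)"
    using mat_adjoint_carrier[OF AB] mat_adjoint_carrier[OF assms(1)] mat_adjoint_carrier[OF assms(2)] by auto
  fix i j assume "i < dim_row (mat_adjoint B * mat_adjoint A)" "j < dim_col (mat_adjoint B * mat_adjoint A)"
  then have ij: "i < l" "j < m"
    using mat_adjoint_carrier[OF assms(1)] mat_adjoint_carrier[OF assms(2)] by auto
  show "mat_adjoint (A * B) $$ (i, j) = (mat_adjoint B * mat_adjoint A) $$ (i, j)"
    using ij assms
    by (simp add: mat_adjoint_index[OF AB] index_mult_mat_sum[OF assms]
        index_mult_mat_sum[OF mat_adjoint_carrier[OF assms(2)] mat_adjoint_carrier[OF assms(1)]]
        mat_adjoint_index[OF assms(1)] mat_adjoint_index[OF assms(2)] mult.commute del: index_mult_mat)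
qed

lemma ltensor_carrier [simp]: "ltensor n D A \<in> carrier_mat (D ^ n) (D ^ n)"
  by (simp add: ltensor_def)

lemma ltensor_dim [simp]: "dim_row (ltensor n D A) = D ^ n" "dim_col (ltensor n D A) = D ^ n"
  by (simp_all add: ltensor_def)

lemma ltensor_index:
  "x < D ^ n \<Longrightarrow> y < D ^ n \<Longrightarrow>
   ltensor n D A $$ (x, y) = (\<Prod>i<n. A i $$ (digit D i x, digit D i y))"
  by (simp add: ltensor_def)

lemma ltensor_cong: "(\<And>i. i < n \<Longrightarrow> A i = B i) \<Longrightarrow> ltensor n D A = ltensor n D B"
  unfolding ltensor_def by (intro cong_mat refl) auto

lemma ltensor_mult:
  assumes D: "D > 0"
    and A: "\<And>i. i < n \<Longrightarrow> A i \<in> carrier_mat D D" and B: "\<And>i. i < n \<Longrightarrow> B i \<in> carrier_mat D D"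
  shows "ltensor n D A * ltensor n D B = ltensor n D (\<lambda>i. A i * B i)"
proof (rule eq_matI)
  fix x y assume "x < dim_row (ltensor n D (\<lambda>i. A i * B i))" "y < dim_col (ltensor n D (\<lambda>i. A i * B i))"
  then have xy: "x < D ^ n" "y < D ^ n" by auto
  have "(ltensor n D A * ltensor n D B) $$ (x, y)
      = (\<Sum>t<D ^ n. \<Prod>i<n. A i $$ (digit D i x, digit D i t) * B i $$ (digit D i t, digit D i y))"
    using xy by (simp add: index_mult_mat_sum[OF ltensor_carrier ltensor_carrier] ltensor_index
        prod.distrib del: index_mult_mat)
  also have "\<dots> = (\<Prod>i<n. \<Sum>a<D. A i $$ (digit D i x, a) * B i $$ (a, digit D i y))"
    using sum_prod_digits[OF D, where f="\<lambda>i a. A i $$ (digit D i x, a) * B i $$ (a, digit D i y)"] by simp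
  also have "\<dots> = ltensor n D (\<lambda>i. A i * B i) $$ (x, y)"
    unfolding ltensor_index[OF xy]
    by (intro prod.cong refl) (simp add: index_mult_mat_sum[OF A B] digit_less D del: index_mult_mat)
  finally show "(ltensor n D A * ltensor n D B) $$ (x, y) = ltensor n D (\<lambda>i. A i * B i) $$ (x, y)" .
qed auto

lemma ltensor_adjoint:
  assumes D: "D > 0" and A: "\<And>i. i < n \<Longrightarrow> A i \<in> carrier_mat D D"
  shows "mat_adjoint (ltensor n D A) = ltensor n D (\<lambda>i. mat_adjoint (A i))"
proof (rule eq_matI)
  fix x y assume "x < dim_row (ltensor n D (\<lambda>i. mat_adjoint (A i)))" "y < dim_col (ltensor n D (\<lambda>i. mat_adjoint (A i)))"
  then have xy: "x < D ^ n" "y < D ^ n" by auto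
  show "mat_adjoint (ltensor n D A) $$ (x, y) = ltensor n D (\<lambda>i. mat_adjoint (A i)) $$ (x, y)"
    using xy by (simp add: mat_adjoint_index[OF ltensor_carrier] ltensor_index mat_adjoint_index[OF A] digit_less D)
qed (simp_all add: carrier_matD[OF mat_adjoint_carrier[OF ltensor_carrier]])

lemma ltensor_one: "D > 0 \<Longrightarrow> ltensor n D (\<lambda>_. 1\<^sub>m D) = 1\<^sub>m (D ^ n)"
proof (rule eq_matI)
  fix x y assume D: "D > 0" and "x < dim_row (1\<^sub>m (D ^ n) :: complex mat)" "y < dim_col (1\<^sub>m (D ^ n) :: complex mat)"
  then have xy: "x < D ^ n" "y < D ^ n" by auto
  have "(\<Prod>i<n. 1\<^sub>m D $$ (digit D i x, digit D i y)) = (if x = y then 1 else 0 :: complex)"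
  proof (cases "x = y")
    case False
    then obtain i where "i < n" "digit D i x \<noteq> digit D i y" using digit_eqI[OF xy] by blast
    then show ?thesis using False D by (auto simp: digit_less intro!: bexI[of _ i])
  qed (simp add: digit_less D)
  then show "ltensor n D (\<lambda>_. 1\<^sub>m D) $$ (x, y) = (1\<^sub>m (D ^ n) :: complex mat) $$ (x, y)"
    using xy by (simp add: ltensor_index)
qed auto

text \<open>The tensor product is linear in each factor. A scalar can thus be absorbed into one
  party, which is needed because the stabilizer consists of product operators without a separate
  scalar.\<close>

lemma ltensor_update_smult:
  assumes i: "i < n" and A: "A i \<in> carrier_mat D D" and D: "D > 0"
  shows "ltensor n D (A(i := c \<cdot>\<^sub>m A i)) = c \<cdot>\<^sub>m ltensor n D A"
proof (rule eq_matI)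
  fix x y assume "x < dim_row (c \<cdot>\<^sub>m ltensor n D A)" "y < dim_col (c \<cdot>\<^sub>m ltensor n D A)"
  then have xy: "x < D ^ n" "y < D ^ n" by auto
  have "(\<Prod>j<n. (A(i := c \<cdot>\<^sub>m A i)) j $$ (digit D j x, digit D j y))
      = c * (\<Prod>j<n. A j $$ (digit D j x, digit D j y))"
    using i A D by (simp add: prod.remove[of "{..<n}" i] digit_less)
  then show "ltensor n D (A(i := c \<cdot>\<^sub>m A i)) $$ (x, y) = (c \<cdot>\<^sub>m ltensor n D A) $$ (x, y)"
    using xy by (simp add: ltensor_index)
qed auto

lemma ltensor_smult:
  assumes A: "\<And>i. i < n \<Longrightarrow> A i \<in> carrier_mat D D" and D: "D > 0"
  shows "ltensor n D (\<lambda>i. c i \<cdot>\<^sub>m A i) = (\<Prod>i<n. c i) \<cdot>\<^sub>m ltensor n D A"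
proof (rule eq_matI)
  fix x y assume "x < dim_row ((\<Prod>i<n. c i) \<cdot>\<^sub>m ltensor n D A)" "y < dim_col ((\<Prod>i<n. c i) \<cdot>\<^sub>m ltensor n D A)"
  then have xy: "x < D ^ n" "y < D ^ n" by auto
  have "(\<Prod>j<n. (c j \<cdot>\<^sub>m A j) $$ (digit D j x, digit D j y))
      = (\<Prod>j<n. c j * A j $$ (digit D j x, digit D j y))"
    using A D by (intro prod.cong refl) (simp add: digit_less carrier_matD[OF A])
  then show "ltensor n D (\<lambda>i. c i \<cdot>\<^sub>m A i) $$ (x, y) = ((\<Prod>i<n. c i) \<cdot>\<^sub>m ltensor n D A) $$ (x, y)"
    using xy by (simp add: ltensor_index prod.distrib)
qed auto

text \<open>Pick a nonzero entry in every factor; at the indices encoding these positions the tensor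
  product has their product as its entry.\<close>

lemma ltensor_nonzero:
  assumes A: "\<And>i. i < n \<Longrightarrow> A i \<in> carrier_mat D D" "\<And>i. i < n \<Longrightarrow> A i \<noteq> 0\<^sub>m D D"
  shows "ltensor n D A \<noteq> 0\<^sub>m (D ^ n) (D ^ n)"
proof -
  have "\<exists>a b. a < D \<and> b < D \<and> A i $$ (a, b) \<noteq> 0" if "i < n" for i
    using A[OF that] by (metis eq_matI carrier_matD index_zero_mat)
  then obtain a b where ab: "\<And>i. i < n \<Longrightarrow> a i < D \<and> b i < D \<and> A i $$ (a i, b i) \<noteq> 0" by metis
  let ?x = "\<Sum>i<n. a i * D ^ i" and ?y = "\<Sum>i<n. b i * D ^ i"
  have xy: "?x < D ^ n" "?y < D ^ n" using ab by (auto intro: encode_less)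
  have "ltensor n D A $$ (?x, ?y) = (\<Prod>i<n. A i $$ (a i, b i))"
    unfolding ltensor_index[OF xy] using ab by (intro prod.cong refl) (simp add: digit_encode)
  also have "\<dots> \<noteq> 0" using ab by auto
  finally show ?thesis using xy by auto
qed

lemma ltensor_zero_factor:
  assumes "i < n" "A i = 0\<^sub>m D D" "D > 0"
  shows "ltensor n D A = 0\<^sub>m (D ^ n) (D ^ n)"
  using assms by (intro eq_matI) (auto simp: ltensor_index digit_less intro!: bexI[of _ i])

section \<open>Two copies and the swap\<close>

text \<open>\<open>two_copy\<close> groups the copies party by party. \<open>hi\<close> and
  \<open>lo\<close> recover the joint indices of the first and the second copy;
  \<open>interleave\<close> inverts the pair.\<close>

definition hi :: "nat \<Rightarrow> nat \<Rightarrow> nat \<Rightarrow> nat" where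
  "hi n d x = (\<Sum>i<n. (digit (d ^ 2) i x div d) * d ^ i)"

definition lo :: "nat \<Rightarrow> nat \<Rightarrow> nat \<Rightarrow> nat" where
  "lo n d x = (\<Sum>i<n. (digit (d ^ 2) i x mod d) * d ^ i)"

definition interleave :: "nat \<Rightarrow> nat \<Rightarrow> nat \<Rightarrow> nat \<Rightarrow> nat" where
  "interleave n d a b = (\<Sum>i<n. (digit d i a * d + digit d i b) * (d ^ 2) ^ i)"

lemma square_digit_less: "a < d \<Longrightarrow> b < d \<Longrightarrow> a * d + b < d ^ 2" for a b d :: nat
proof -
  assume "a < d" "b < d"
  then have "a * d + b < Suc a * d" by simp
  also have "\<dots> \<le> d * d" using \<open>a < d\<close> by (intro mult_right_mono) auto
  finally show ?thesis by (simp add: power2_eq_square)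
qed

lemma digit_square_div: "d > 0 \<Longrightarrow> digit (d ^ 2) i x div d < d"
  using digit_less[of "d ^ 2" i x] by (simp add: power2_eq_square less_mult_imp_div_less)

lemma hi_less: "d > 0 \<Longrightarrow> hi n d x < d ^ n"
  unfolding hi_def by (intro encode_less) (simp add: digit_square_div)

lemma lo_less: "d > 0 \<Longrightarrow> lo n d x < d ^ n"
  unfolding lo_def by (intro encode_less) simp

lemma interleave_less: "d > 0 \<Longrightarrow> interleave n d a b < (d ^ 2) ^ n"
  unfolding interleave_def by (intro encode_less square_digit_less digit_less)

lemma digit_hi: "d > 0 \<Longrightarrow> i < n \<Longrightarrow> digit d i (hi n d x) = digit (d ^ 2) i x div d"
  unfolding hi_def by (rule digit_encode) (simp_all add: digit_square_div)

lemma digit_lo: "d > 0 \<Longrightarrow> i < n \<Longrightarrow> digit d i (lo n d x) = digit (d ^ 2) i x mod d"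
  unfolding lo_def by (rule digit_encode) simp_all

lemma digit_interleave:
  "d > 0 \<Longrightarrow> i < n \<Longrightarrow> digit (d ^ 2) i (interleave n d a b) = digit d i a * d + digit d i b"
  unfolding interleave_def by (rule digit_encode) (simp_all add: square_digit_less digit_less)

lemma hi_interleave: "d > 0 \<Longrightarrow> a < d ^ n \<Longrightarrow> hi n d (interleave n d a b) = a"
  by (rule digit_eqI[of _ d n]) (simp_all add: hi_less digit_hi digit_interleave digit_less)

lemma lo_interleave: "d > 0 \<Longrightarrow> b < d ^ n \<Longrightarrow> lo n d (interleave n d a b) = b"
  by (rule digit_eqI[of _ d n]) (simp_all add: lo_less digit_lo digit_interleave digit_less)

lemma interleave_hi_lo: "d > 0 \<Longrightarrow> x < (d ^ 2) ^ n \<Longrightarrow> interleave n d (hi n d x) (lo n d x) = x"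
  by (rule digit_eqI[of _ "d ^ 2" n]) (simp_all add: interleave_less digit_lo digit_interleave digit_hi)

text \<open>The change of summation index that lets a matrix product on the doubled space separate
  into one sum per copy.\<close>

lemma sum_hi_lo:
  assumes d: "d > 0"
  shows "(\<Sum>x<(d ^ 2) ^ n. f (hi n d x) (lo n d x)) = (\<Sum>a<d ^ n. \<Sum>b<d ^ n. f a b)"
  unfolding sum.cartesian_product
  by (rule sum.reindex_bij_witness[of _ "\<lambda>(a, b). interleave n d a b" "\<lambda>x. (hi n d x, lo n d x)"])
     (auto simp: d hi_less lo_less interleave_less hi_interleave lo_interleave interleave_hi_lo)

text \<open>The Kronecker product of an operator on copy one with an operator on copy two, with rows
  and columns permuted into the party-by-party order of \<open>two_copy\<close>.\<close>

definition tensor2 :: "nat \<Rightarrow> nat \<Rightarrow> complex mat \<Rightarrow> complex mat \<Rightarrow> complex mat" where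
  "tensor2 n d X Y = mat ((d ^ 2) ^ n) ((d ^ 2) ^ n)
     (\<lambda>(x, y). X $$ (hi n d x, hi n d y) * Y $$ (lo n d x, lo n d y))"

lemma tensor2_carrier [simp]: "tensor2 n d X Y \<in> carrier_mat ((d ^ 2) ^ n) ((d ^ 2) ^ n)"
  by (simp add: tensor2_def)

lemma tensor2_dim [simp]: "dim_row (tensor2 n d X Y) = (d ^ 2) ^ n" "dim_col (tensor2 n d X Y) = (d ^ 2) ^ n"
  by (simp_all add: tensor2_def)

lemma tensor2_index:
  "x < (d ^ 2) ^ n \<Longrightarrow> y < (d ^ 2) ^ n \<Longrightarrow>
   tensor2 n d X Y $$ (x, y) = X $$ (hi n d x, hi n d y) * Y $$ (lo n d x, lo n d y)"
  by (simp add: tensor2_def)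

lemma two_copy_index:
  "x < (d ^ 2) ^ n \<Longrightarrow> two_copy n d v w $ x = v $ hi n d x * w $ lo n d x"
  by (simp add: two_copy_def hi_def lo_def)

lemma two_copy_carrier [simp]: "two_copy n d v w \<in> carrier_vec ((d ^ 2) ^ n)"
  by (simp add: two_copy_def)

lemma tensor2_mult:
  assumes d: "d > 0" and X: "X \<in> carrier_mat (d ^ n) (d ^ n)" "X' \<in> carrier_mat (d ^ n) (d ^ n)"
    and Y: "Y \<in> carrier_mat (d ^ n) (d ^ n)" "Y' \<in> carrier_mat (d ^ n) (d ^ n)"
  shows "tensor2 n d X Y * tensor2 n d X' Y' = tensor2 n d (X * X') (Y * Y')"
proof (rule eq_matI)
  fix x y assume "x < dim_row (tensor2 n d (X * X') (Y * Y'))" "y < dim_col (tensor2 n d (X * X') (Y * Y'))"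
  then have xy: "x < (d ^ 2) ^ n" "y < (d ^ 2) ^ n" by auto
  let ?h = "hi n d" and ?l = "lo n d"
  have "(tensor2 n d X Y * tensor2 n d X' Y') $$ (x, y)
      = (\<Sum>t<(d ^ 2) ^ n. (\<lambda>a b. (X $$ (?h x, a) * X' $$ (a, ?h y)) * (Y $$ (?l x, b) * Y' $$ (b, ?l y))) (?h t) (?l t))"
    using xy by (simp add: index_mult_mat_sum[OF tensor2_carrier tensor2_carrier] tensor2_index
        mult_ac del: index_mult_mat)
  also have "\<dots> = (X * X') $$ (?h x, ?h y) * (Y * Y') $$ (?l x, ?l y)"
    unfolding sum_hi_lo[OF d, where f="\<lambda>a b. (X $$ (?h x, a) * X' $$ (a, ?h y)) * (Y $$ (?l x, b) * Y' $$ (b, ?l y))"]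
    by (simp add: index_mult_mat_sum[OF X] index_mult_mat_sum[OF Y] hi_less lo_less d sum_product
        del: index_mult_mat)
  finally show "(tensor2 n d X Y * tensor2 n d X' Y') $$ (x, y) = tensor2 n d (X * X') (Y * Y') $$ (x, y)"
    using xy by (simp add: tensor2_index)
qed auto

lemma tensor2_adjoint:
  assumes d: "d > 0" and X: "X \<in> carrier_mat (d ^ n) (d ^ n)" and Y: "Y \<in> carrier_mat (d ^ n) (d ^ n)"
  shows "mat_adjoint (tensor2 n d X Y) = tensor2 n d (mat_adjoint X) (mat_adjoint Y)"
  by (rule eq_matI)
     (simp_all add: mat_adjoint_index[OF tensor2_carrier] tensor2_index mat_adjoint_index[OF X]
       mat_adjoint_index[OF Y] hi_less lo_less d carrier_matD[OF mat_adjoint_carrier[OF tensor2_carrier]])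

lemma tensor2_mult_two_copy:
  assumes d: "d > 0" and X: "X \<in> carrier_mat (d ^ n) (d ^ n)" "v \<in> carrier_vec (d ^ n)"
    and Y: "Y \<in> carrier_mat (d ^ n) (d ^ n)" "w \<in> carrier_vec (d ^ n)"
  shows "tensor2 n d X Y *\<^sub>v two_copy n d v w = two_copy n d (X *\<^sub>v v) (Y *\<^sub>v w)"
proof (rule eq_vecI)
  fix x assume "x < dim_vec (two_copy n d (X *\<^sub>v v) (Y *\<^sub>v w))"
  then have x: "x < (d ^ 2) ^ n" by (simp add: two_copy_def)
  let ?h = "hi n d" and ?l = "lo n d"
  have "(tensor2 n d X Y *\<^sub>v two_copy n d v w) $ x
      = (\<Sum>t<(d ^ 2) ^ n. (\<lambda>a b. (X $$ (?h x, a) * v $ a) * (Y $$ (?l x, b) * w $ b)) (?h t) (?l t))"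
    using x by (simp add: index_mult_mat_vec_sum[OF tensor2_carrier two_copy_carrier] tensor2_index
        two_copy_index mult_ac del: index_mult_mat_vec)
  also have "\<dots> = (X *\<^sub>v v) $ ?h x * (Y *\<^sub>v w) $ ?l x"
    unfolding sum_hi_lo[OF d, where f="\<lambda>a b. (X $$ (?h x, a) * v $ a) * (Y $$ (?l x, b) * w $ b)"]
    by (simp add: index_mult_mat_vec_sum[OF X] index_mult_mat_vec_sum[OF Y] hi_less lo_less d sum_product
        del: index_mult_mat_vec)
  finally show "(tensor2 n d X Y *\<^sub>v two_copy n d v w) $ x = two_copy n d (X *\<^sub>v v) (Y *\<^sub>v w) $ x"
    using x by (simp add: two_copy_index)
qed (simp add: two_copy_def)

lemma hi_1: "d > 0 \<Longrightarrow> r < d ^ 2 \<Longrightarrow> hi 1 d r = r div d"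
  by (simp add: hi_def digit_def)

lemma lo_1: "d > 0 \<Longrightarrow> r < d ^ 2 \<Longrightarrow> lo 1 d r = r mod d"
  by (simp add: lo_def digit_def)

lemma tensor2_one: "d > 0 \<Longrightarrow> tensor2 n d (1\<^sub>m (d ^ n)) (1\<^sub>m (d ^ n)) = 1\<^sub>m ((d ^ 2) ^ n)"
proof (rule eq_matI)
  fix x y assume d: "d > 0" and "x < dim_row (1\<^sub>m ((d ^ 2) ^ n) :: complex mat)" "y < dim_col (1\<^sub>m ((d ^ 2) ^ n) :: complex mat)"
  then have xy: "x < (d ^ 2) ^ n" "y < (d ^ 2) ^ n" by auto
  have "x = y \<longleftrightarrow> hi n d x = hi n d y \<and> lo n d x = lo n d y"
    using interleave_hi_lo[OF d xy(1)] interleave_hi_lo[OF d xy(2)] by metis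
  then show "tensor2 n d (1\<^sub>m (d ^ n)) (1\<^sub>m (d ^ n)) $$ (x, y) = (1\<^sub>m ((d ^ 2) ^ n) :: complex mat) $$ (x, y)"
    using xy by (auto simp: tensor2_index hi_less lo_less d)
qed auto

text \<open>\<open>tensor2 1 d\<close> is the Kronecker product of two single-party operators.\<close>

lemma tensor2_ltensor:
  assumes d: "d > 0"
  shows "tensor2 n d (ltensor n d A) (ltensor n d B) = ltensor n (d ^ 2) (\<lambda>i. tensor2 1 d (A i) (B i))"
proof (rule eq_matI)
  fix x y assume "x < dim_row (ltensor n (d ^ 2) (\<lambda>i. tensor2 1 d (A i) (B i)))"
    "y < dim_col (ltensor n (d ^ 2) (\<lambda>i. tensor2 1 d (A i) (B i)))"
  then have xy: "x < (d ^ 2) ^ n" "y < (d ^ 2) ^ n" by auto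
  have D: "digit (d ^ 2) i z < d ^ 2" for i z using d by (simp add: digit_less)
  have *: "tensor2 1 d X Y $$ (r, c) = X $$ (r div d, c div d) * Y $$ (r mod d, c mod d)"
    if "r < d ^ 2" "c < d ^ 2" for r c X Y
    using that tensor2_index[of r d 1 c X Y] by (simp only: power_one_right hi_1[OF d] lo_1[OF d])
  show "tensor2 n d (ltensor n d A) (ltensor n d B) $$ (x, y)
      = ltensor n (d ^ 2) (\<lambda>i. tensor2 1 d (A i) (B i)) $$ (x, y)"
    unfolding tensor2_index[OF xy]
    using xy by (simp add: ltensor_index hi_less lo_less d * D digit_hi digit_lo prod.distrib
        del: One_nat_def)
qed auto

lemma tensor2_local_invertible:
  assumes d: "d > 0" and A: "local_invertible n d A" and B: "local_invertible n d B"
  shows "local_invertible n (d ^ 2) (\<lambda>i. tensor2 1 d (A i) (B i))"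
proof -
  have "invertible_mat (tensor2 1 d (A i) (B i))" if i: "i < n" for i
  proof -
    have inv: "\<exists>Z. Z \<in> carrier_mat d d \<and> X * Z = 1\<^sub>m d \<and> Z * X = 1\<^sub>m d"
      if "X \<in> carrier_mat d d" "invertible_mat X" for X :: "complex mat"
      using that unfolding invertible_mat_def inverts_mat_def
      by (metis carrier_matD carrier_matI index_mult_mat(2,3) index_one_mat(2,3))
    obtain X Y where X: "X \<in> carrier_mat d d" "A i * X = 1\<^sub>m d" "X * A i = 1\<^sub>m d"
      and Y: "Y \<in> carrier_mat d d" "B i * Y = 1\<^sub>m d" "Y * B i = 1\<^sub>m d"
      using inv[of "A i"] inv[of "B i"] A B i unfolding local_invertible_def by blast
    have c: "A i \<in> carrier_mat (d ^ 1) (d ^ 1)" "B i \<in> carrier_mat (d ^ 1) (d ^ 1)"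
      "X \<in> carrier_mat (d ^ 1) (d ^ 1)" "Y \<in> carrier_mat (d ^ 1) (d ^ 1)"
      using A B i X(1) Y(1) unfolding local_invertible_def by auto
    have "tensor2 1 d (A i) (B i) * tensor2 1 d X Y = 1\<^sub>m ((d ^ 2) ^ 1)"
      "tensor2 1 d X Y * tensor2 1 d (A i) (B i) = 1\<^sub>m ((d ^ 2) ^ 1)"
      unfolding tensor2_mult[OF d c(1,3,2,4)] tensor2_mult[OF d c(3,1,4,2)]
      using tensor2_one[OF d, of 1] X Y by simp_all
    then show ?thesis unfolding invertible_mat_def inverts_mat_def by fastforce
  qed
  moreover have "tensor2 1 d X Y \<in> carrier_mat (d ^ 2) (d ^ 2)" for X Y
    using tensor2_carrier[of 1 d X Y] by simp
  ultimately show ?thesis unfolding local_invertible_def by blast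
qed

section \<open>The swap as an involutive permutation of basis indices\<close>

definition swap_index :: "nat \<Rightarrow> nat \<Rightarrow> nat \<Rightarrow> nat" where
  "swap_index n d x = interleave n d (lo n d x) (hi n d x)"

lemma swap_index_less: "d > 0 \<Longrightarrow> swap_index n d x < (d ^ 2) ^ n"
  by (simp add: swap_index_def interleave_less)

lemma hi_swap_index: "d > 0 \<Longrightarrow> hi n d (swap_index n d x) = lo n d x"
  by (simp add: swap_index_def hi_interleave lo_less)

lemma lo_swap_index: "d > 0 \<Longrightarrow> lo n d (swap_index n d x) = hi n d x"
  by (simp add: swap_index_def lo_interleave hi_less)

lemma swap_index_swap_index: "d > 0 \<Longrightarrow> x < (d ^ 2) ^ n \<Longrightarrow> swap_index n d (swap_index n d x) = x"
  by (simp add: swap_index_def[of n d "swap_index n d x"] hi_swap_index lo_swap_index interleave_hi_lo)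

lemma SWAP_all_carrier [simp]: "SWAP_all n d \<in> carrier_mat ((d ^ 2) ^ n) ((d ^ 2) ^ n)"
  by (simp add: SWAP_all_def)

lemma SWAP_all_dim [simp]: "dim_row (SWAP_all n d) = (d ^ 2) ^ n" "dim_col (SWAP_all n d) = (d ^ 2) ^ n"
  by (simp_all add: SWAP_all_def)

text \<open>Every local factor is a 0/1 indicator, so their product indicates that all digits match,
  and an index is determined by its digits.\<close>

lemma SWAP_all_index:
  assumes d: "d > 0" and xy: "x < (d ^ 2) ^ n" "y < (d ^ 2) ^ n"
  shows "SWAP_all n d $$ (x, y) = (if y = swap_index n d x then 1 else 0)"
proof -
  have D: "digit (d ^ 2) i z < d ^ 2" for i z using d by (simp add: digit_less)
  have "digit (d ^ 2) i x = (digit (d ^ 2) i y mod d) * d + digit (d ^ 2) i y div d \<longleftrightarrow>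
        digit (d ^ 2) i y = digit (d ^ 2) i (swap_index n d x)" if i: "i < n" for i
  proof -
    have s: "digit (d ^ 2) i (swap_index n d x) = (digit (d ^ 2) i x mod d) * d + digit (d ^ 2) i x div d"
      using i d by (simp add: swap_index_def digit_interleave digit_lo digit_hi)
    have "(r mod d) * d + r div d = c \<longleftrightarrow> r = (c mod d) * d + c div d" if "r < d ^ 2" "c < d ^ 2" for r c
      using that d digit_square_div[OF d, of 0 r] digit_square_div[OF d, of 0 c]
      by (auto simp: digit_def)
    then show ?thesis using D s by metis
  qed
  then have eq: "(\<forall>i<n. digit (d ^ 2) i x = (digit (d ^ 2) i y mod d) * d + digit (d ^ 2) i y div d)
      \<longleftrightarrow> y = swap_index n d x"
    using digit_eqI[OF xy(2) swap_index_less[OF d, of n x]] by auto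
  have "SWAP_all n d $$ (x, y)
      = (\<Prod>i<n. if digit (d ^ 2) i x = (digit (d ^ 2) i y mod d) * d + digit (d ^ 2) i y div d then 1 else 0)"
    unfolding SWAP_all_def ltensor_index[OF xy] swap_loc_def using D by (intro prod.cong refl) simp
  also have "\<dots> = (if y = swap_index n d x then 1 else 0)"
    unfolding eq[symmetric] by (auto intro!: prod.neutral)
  finally show ?thesis .
qed

lemma SWAP_all_mult_index:
  assumes d: "d > 0" and M: "M \<in> carrier_mat ((d ^ 2) ^ n) ((d ^ 2) ^ n)"
    and xy: "x < (d ^ 2) ^ n" "y < (d ^ 2) ^ n"
  shows "(SWAP_all n d * M) $$ (x, y) = M $$ (swap_index n d x, y)"
proof -
  have "(SWAP_all n d * M) $$ (x, y) = (\<Sum>t<(d ^ 2) ^ n. if t = swap_index n d x then M $$ (t, y) else 0)"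
    unfolding index_mult_mat_sum[OF SWAP_all_carrier M xy]
    by (intro sum.cong refl) (simp add: SWAP_all_index d xy)
  then show ?thesis using swap_index_less[OF d] by simp
qed

lemma mult_SWAP_all_index:
  assumes d: "d > 0" and M: "M \<in> carrier_mat ((d ^ 2) ^ n) ((d ^ 2) ^ n)"
    and xy: "x < (d ^ 2) ^ n" "y < (d ^ 2) ^ n"
  shows "(M * SWAP_all n d) $$ (x, y) = M $$ (x, swap_index n d y)"
proof -
  have "y = swap_index n d t \<longleftrightarrow> t = swap_index n d y" if "t < (d ^ 2) ^ n" for t
    using swap_index_swap_index[OF d] that xy(2) by metis
  then have "(M * SWAP_all n d) $$ (x, y) = (\<Sum>t<(d ^ 2) ^ n. if t = swap_index n d y then M $$ (x, t) else 0)"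
    unfolding index_mult_mat_sum[OF M SWAP_all_carrier xy]
    by (intro sum.cong refl) (simp add: SWAP_all_index d xy)
  then show ?thesis using swap_index_less[OF d] by simp
qed

lemma SWAP_all_involution:
  assumes d: "d > 0"
  shows "SWAP_all n d * SWAP_all n d = 1\<^sub>m ((d ^ 2) ^ n)"
  by (rule eq_matI)
     (auto simp: SWAP_all_mult_index[OF d SWAP_all_carrier] SWAP_all_index[OF d] swap_index_less[OF d]
       swap_index_swap_index[OF d] simp del: index_mult_mat(1))

lemma SWAP_all_adjoint:
  assumes d: "d > 0"
  shows "mat_adjoint (SWAP_all n d) = SWAP_all n d"
proof (rule eq_matI)
  fix x y assume "x < dim_row (SWAP_all n d)" "y < dim_col (SWAP_all n d)"
  then have xy: "x < (d ^ 2) ^ n" "y < (d ^ 2) ^ n" by auto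
  have "x = swap_index n d y \<longleftrightarrow> y = swap_index n d x"
    using swap_index_swap_index[OF d] xy by metis
  then show "mat_adjoint (SWAP_all n d) $$ (x, y) = SWAP_all n d $$ (x, y)"
    using xy by (simp add: mat_adjoint_index[OF SWAP_all_carrier] SWAP_all_index[OF d])
qed (simp_all add: carrier_matD[OF mat_adjoint_carrier[OF SWAP_all_carrier]])

lemma SWAP_all_tensor2:
  assumes d: "d > 0"
  shows "SWAP_all n d * tensor2 n d X Y = tensor2 n d Y X * SWAP_all n d"
  by (rule eq_matI)
     (simp_all add: SWAP_all_mult_index[OF d tensor2_carrier] mult_SWAP_all_index[OF d tensor2_carrier]
       tensor2_index swap_index_less[OF d] hi_swap_index[OF d] lo_swap_index[OF d] mult.commute
       del: index_mult_mat(1))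

section \<open>Consequences of full entanglement\<close>

text \<open>Written with the same subtraction and addition as the shifted index in
  \<open>rdm\<close>, so that entries of \<open>rdm\<close> unfold to it. For
  \<open>x < D ^ n\<close> and \<open>i < n\<close> the natural subtraction is exact, the subtrahend
  being a summand of the digit expansion of \<open>x\<close>.\<close>

definition set_digit :: "nat \<Rightarrow> nat \<Rightarrow> nat \<Rightarrow> nat \<Rightarrow> nat" where
  "set_digit D i x a = x - digit D i x * D ^ i + a * D ^ i"

lemma set_digit_props:
  assumes x: "x < D ^ n" and i: "i < n" and a: "a < D"
  shows set_digit_less: "set_digit D i x a < D ^ n"
    and digit_set_digit: "j < n \<Longrightarrow> digit D j (set_digit D i x a) = (if j = i then a else digit D j x)"
proof -
  have D: "D > 0" using a by simp
  let ?c = "\<lambda>j. if j = i then a else digit D j x"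
  have "x = digit D i x * D ^ i + (\<Sum>j\<in>{..<n} - {i}. digit D j x * D ^ j)"
    using digit_expand[OF x] i by (simp add: sum.remove[of "{..<n}" i])
  then have "set_digit D i x a = (\<Sum>j\<in>{..<n} - {i}. digit D j x * D ^ j) + a * D ^ i"
    unfolding set_digit_def by (metis add_diff_cancel_left')
  also have "\<dots> = (\<Sum>j<n. ?c j * D ^ j)"
    using i by (simp add: sum.remove[of "{..<n}" i])
  finally have e: "set_digit D i x a = (\<Sum>j<n. ?c j * D ^ j)" .
  have c: "?c j < D" for j using a D by (simp add: digit_less)
  show "set_digit D i x a < D ^ n" unfolding e using c by (intro encode_less) 
  show "j < n \<Longrightarrow> digit D j (set_digit D i x a) = ?c j" unfolding e by (rule digit_encode) (use c in auto)
qed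

lemma set_digit_set_digit:
  assumes "x < D ^ n" "i < n" "a < D" "b < D"
  shows "set_digit D i (set_digit D i x a) b = set_digit D i x b"
  using assms by - (rule digit_eqI[of _ D n], simp_all add: set_digit_less digit_set_digit[of _ D n])

lemma set_digit_same: "x < D ^ n \<Longrightarrow> i < n \<Longrightarrow> set_digit D i x (digit D i x) = x"
  using digit_expand[of x D n] sum.remove[of "{..<n}" i "\<lambda>i. digit D i x * D ^ i"]
  by (simp add: set_digit_def)

section \<open>Invertible and singular square matrices\<close>

lemma invertible_matE:
  assumes "A \<in> carrier_mat m m" "invertible_mat A"
  obtains B where "B \<in> carrier_mat m m" "A * B = 1\<^sub>m m" "B * A = 1\<^sub>m m"
proof -
  obtain B where B: "A * B = 1\<^sub>m m" "B * A = 1\<^sub>m (dim_row B)"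
    using assms unfolding invertible_mat_def inverts_mat_def by auto
  have "dim_col (A * B) = dim_col (1\<^sub>m m :: 'a mat)" "dim_col (B * A) = dim_col (1\<^sub>m (dim_row B) :: 'a mat)"
    using B by simp_all
  then have "B \<in> carrier_mat m m" using assms(1) by auto
  then show thesis using that B by auto
qed

lemma invertible_matI:
  assumes "A \<in> carrier_mat m m" "B \<in> carrier_mat m m" "A * B = 1\<^sub>m m" "B * A = 1\<^sub>m m"
  shows "invertible_mat A"
  using assms unfolding invertible_mat_def inverts_mat_def by auto

lemma invertible_mat_of_det:
  fixes A :: "complex mat"
  assumes A: "A \<in> carrier_mat m m" and "det A \<noteq> 0"
  shows "invertible_mat A"
proof -
  have "A \<in> Units (ring_mat TYPE(complex) m ())" using assms by (rule det_non_zero_imp_unit)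
  then show ?thesis
    unfolding Units_def ring_mat_simps by (auto intro: invertible_matI[OF A])
qed

text \<open>A singular matrix has a left null vector, found as a null vector \<open>u\<close> of the
  transpose. \<open>B\<close> repeats \<open>u\<close> in every row, so that the annihilator is
  square and can serve as an operator of one party.\<close>

lemma singular_left_annihilator:
  fixes A :: "complex mat"
  assumes A: "A \<in> carrier_mat m m" and ninv: "\<not> invertible_mat A"
  obtains B where "B \<in> carrier_mat m m" "B \<noteq> 0\<^sub>m m m" "B * A = 0\<^sub>m m m"
proof -
  have "det A = 0" using invertible_mat_of_det[OF A] ninv by blast
  then have "det (transpose_mat A) = 0" using det_transpose[OF A] by simp
  then obtain u where u: "u \<in> carrier_vec m" "u \<noteq> 0\<^sub>v m" "transpose_mat A *\<^sub>v u = 0\<^sub>v m"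
    using det_0_iff_vec_prod_zero_field[of "transpose_mat A" m] A by auto
  define B where "B = mat m m (\<lambda>(i, j). u $ j)"
  have B: "B \<in> carrier_mat m m" by (simp add: B_def)
  obtain k where k: "k < m" "u $ k \<noteq> 0" using u(1,2) by (auto simp: vec_eq_iff)
  then have "B $$ (k, k) \<noteq> 0" by (simp add: B_def)
  then have "B \<noteq> 0\<^sub>m m m" using k by auto
  moreover have "B * A = 0\<^sub>m m m"
  proof (rule eq_matI)
    fix i j assume "i < dim_row (0\<^sub>m m m :: complex mat)" "j < dim_col (0\<^sub>m m m :: complex mat)"
    then have ij: "i < m" "j < m" by auto
    have "(B * A) $$ (i, j) = (transpose_mat A *\<^sub>v u) $ j"
      unfolding index_mult_mat_sum[OF B A ij] index_mult_mat_vec_sum[OF transpose_carrier_mat[THEN iffD2, OF A] u(1) ij(2)]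
      using ij A by (intro sum.cong refl) (simp add: B_def mult.commute)
    then show "(B * A) $$ (i, j) = (0\<^sub>m m m :: complex mat) $$ (i, j)" using u(3) ij by simp
  qed (use A B in auto)
  ultimately show thesis using that B by blast
qed

text \<open>Hypothesis \<open>z\<close> says that contracting index \<open>i\<close> of
  \<open>v\<close> with \<open>u\<close> gives zero. Then \<open>u\<close> is a left null vector of
  the reduced density matrix, which full entanglement makes invertible.\<close>

lemma fully_entangled_annihilator:
  assumes fe: "fully_entangled n d v" and i: "i < n"
    and z: "\<And>x. x < d ^ n \<Longrightarrow> (\<Sum>a<d. u a * v $ set_digit d i x a) = 0"
    and c: "c < d"
  shows "u c = 0"
proof -
  let ?R = "rdm n d i v"
  have d: "d > 0" using c by simp
  have R: "?R \<in> carrier_mat d d" by (simp add: rdm_def)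
  have "vec_space.rank d ?R = d" using fe i unfolding fully_entangled_def by blast
  then have "det ?R \<noteq> 0" using vec_space.det_rank_iff[OF R] by simp
  then obtain B where B: "B \<in> carrier_mat d d" "?R * B = 1\<^sub>m d"
    using invertible_matE[OF R invertible_mat_of_det[OF R]] by blast
  \<comment> \<open>Fixing digit \<open>i\<close> at 0 leaves one representative for each
    configuration of the other parties.\<close>
  let ?Y = "{y. y < d ^ n \<and> digit d i y = 0}"
  have uR: "(\<Sum>a<d. u a * ?R $$ (a, b)) = 0" if b: "b < d" for b
  proof -
    have R_ab: "?R $$ (a, b) = (\<Sum>y\<in>?Y. v $ set_digit d i y a * cnj (v $ set_digit d i y b))" if a: "a < d" for a
    proof -
      have "?R $$ (a, b) = (\<Sum>x | x < d ^ n \<and> digit d i x = a. v $ x * cnj (v $ set_digit d i x b))"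
        using a b unfolding rdm_def set_digit_def by (simp cong: sum.cong_simp)
      also have "\<dots> = (\<Sum>y\<in>?Y. v $ set_digit d i y a * cnj (v $ set_digit d i y b))"
        by (rule sum.reindex_bij_witness[of _ "\<lambda>y. set_digit d i y a" "\<lambda>x. set_digit d i x 0"])
           (use a b i d in \<open>auto simp: set_digit_less digit_set_digit[of _ d n] set_digit_set_digit[of _ d n i]
              set_digit_same, metis set_digit_same\<close>)
      finally show ?thesis .
    qed
    have "(\<Sum>a<d. u a * ?R $$ (a, b))
        = (\<Sum>a<d. \<Sum>y\<in>?Y. u a * v $ set_digit d i y a * cnj (v $ set_digit d i y b))"
      using R_ab by (simp add: sum_distrib_left mult.assoc)
    also have "\<dots> = (\<Sum>y\<in>?Y. (\<Sum>a<d. u a * v $ set_digit d i y a) * cnj (v $ set_digit d i y b))"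
      by (subst sum.swap) (simp add: sum_distrib_right)
    also have "\<dots> = 0" using z by simp
    finally show ?thesis .
  qed
  have "u c = (\<Sum>a<d. u a * (?R * B) $$ (a, c))"
    using c by (simp add: B(2) if_distrib cong: if_cong)
  also have "\<dots> = (\<Sum>a<d. \<Sum>b<d. u a * ?R $$ (a, b) * B $$ (b, c))"
    using c by (simp add: index_mult_mat_sum[OF R B(1)] sum_distrib_left mult.assoc del: index_mult_mat)
  also have "\<dots> = (\<Sum>b<d. (\<Sum>a<d. u a * ?R $$ (a, b)) * B $$ (b, c))"
    by (subst sum.swap) (simp add: sum_distrib_right)
  also have "\<dots> = 0" using uR by simp
  finally show ?thesis .
qed

section \<open>Operators acting on a single party\<close>

lemma lift_carrier [simp]: "lift n D i K \<in> carrier_mat (D ^ n) (D ^ n)"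
  by (simp add: lift_def)

lemma lift_index:
  assumes xy: "x < D ^ n" "y < D ^ n" and i: "i < n"
  shows "lift n D i K $$ (x, y)
    = (if \<forall>j<n. j \<noteq> i \<longrightarrow> digit D j y = digit D j x then K $$ (digit D i x, digit D i y) else 0)"
proof -
  have D: "D > 0" using xy(1) i by (cases "D = 0") (auto simp: power_0_left)
  have "lift n D i K $$ (x, y) = K $$ (digit D i x, digit D i y)
      * (\<Prod>j\<in>{..<n} - {i}. if digit D j y = digit D j x then 1 else 0)"
  proof -
    have "(\<Prod>j\<in>{..<n} - {i}. (if j = i then K else 1\<^sub>m D) $$ (digit D j x, digit D j y))
        = (\<Prod>j\<in>{..<n} - {i}. if digit D j y = digit D j x then 1 else 0)"
      by (rule prod.cong[OF refl]) (auto simp: digit_less D)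
    then show ?thesis
      unfolding lift_def ltensor_index[OF xy] using i by (subst prod.remove[of "{..<n}" i]) auto
  qed
  also have "(\<Prod>j\<in>{..<n} - {i}. if digit D j y = digit D j x then 1 else (0 :: complex))
      = (if \<forall>j<n. j \<noteq> i \<longrightarrow> digit D j y = digit D j x then 1 else 0)"
    by (auto intro!: prod.neutral)
  finally show ?thesis by auto
qed

text \<open>Only the indices agreeing with \<open>x\<close> at all parties other than
  \<open>i\<close> contribute, and these are labelled by their digit \<open>c\<close> at party
  \<open>i\<close>.\<close>

lemma lift_mult_vec_index:
  assumes x: "x < D ^ n" and i: "i < n" and v: "v \<in> carrier_vec (D ^ n)"
  shows "(lift n D i K *\<^sub>v v) $ x = (\<Sum>c<D. K $$ (digit D i x, c) * v $ set_digit D i x c)"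
proof -
  have D: "D > 0" using x i by (cases "D = 0") (auto simp: power_0_left)
  let ?Y = "{y \<in> {..<D ^ n}. \<forall>j<n. j \<noteq> i \<longrightarrow> digit D j y = digit D j x}"
  have "(lift n D i K *\<^sub>v v) $ x
      = (\<Sum>y<D ^ n. if \<forall>j<n. j \<noteq> i \<longrightarrow> digit D j y = digit D j x
           then K $$ (digit D i x, digit D i y) * v $ y else 0)"
    unfolding index_mult_mat_vec_sum[OF lift_carrier v x]
    by (intro sum.cong refl) (auto simp: lift_index x i)
  also have "\<dots> = (\<Sum>y\<in>?Y. K $$ (digit D i x, digit D i y) * v $ y)"
    by (rule sum.inter_filter[symmetric]) simp
  also have "\<dots> = (\<Sum>c<D. K $$ (digit D i x, c) * v $ set_digit D i x c)"
  proof (rule sum.reindex_bij_witness[of _ "\<lambda>c. set_digit D i x c" "\<lambda>y. digit D i y"])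
    fix y assume "y \<in> ?Y"
    then have y: "y < D ^ n" "\<And>j. j < n \<Longrightarrow> j \<noteq> i \<Longrightarrow> digit D j y = digit D j x" by auto
    show *: "set_digit D i x (digit D i y) = y"
      by (rule digit_eqI[of _ D n]) (use x i D y in \<open>auto simp: set_digit_less digit_set_digit[of _ D n] digit_less\<close>)
    show "digit D i y \<in> {..<D}" using D by (simp add: digit_less)
    show "K $$ (digit D i x, digit D i y) * v $ set_digit D i x (digit D i y)
        = K $$ (digit D i x, digit D i y) * v $ y" unfolding * ..
  qed (use x i D in \<open>auto simp: set_digit_less digit_set_digit[of _ D n]\<close>)
  finally show ?thesis .
qed

lemma hi_set_digit:
  assumes "x < (d ^ 2) ^ n" "i < n" "c < d ^ 2"
  shows "hi n d (set_digit (d ^ 2) i x c) = set_digit d i (hi n d x) (c div d)"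
proof -
  have d: "d > 0" using assms(3) by (cases "d = 0") auto
  have c: "c div d < d" using assms(3) by (simp add: power2_eq_square less_mult_imp_div_less)
  show ?thesis
    by (rule digit_eqI[of _ d n]) (use assms d c in \<open>auto simp: hi_less set_digit_less digit_hi digit_set_digit[of _ _ n]\<close>)
qed

lemma lo_set_digit:
  assumes "x < (d ^ 2) ^ n" "i < n" "c < d ^ 2"
  shows "lo n d (set_digit (d ^ 2) i x c) = set_digit d i (lo n d x) (c mod d)"
proof -
  have d: "d > 0" using assms(3) by (cases "d = 0") auto
  show ?thesis
    by (rule digit_eqI[of _ d n]) (use assms d in \<open>auto simp: lo_less set_digit_less digit_lo digit_set_digit[of _ _ n]\<close>)
qed

text \<open>A row of \<open>K\<close> is a \<open>d\<close> by \<open>d\<close> array whose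
  contraction with \<open>v\<close> in both copies vanishes. Full entanglement of the single copy is
  used twice, stripping first the index of the first copy and then that of the second.\<close>

lemma lift_two_copy_eq_0:
  assumes fe: "fully_entangled n d v" and i: "i < n"
    and K: "K \<in> carrier_mat (d ^ 2) (d ^ 2)"
    and z: "lift n (d ^ 2) i K *\<^sub>v two_copy n d v v = 0\<^sub>v ((d ^ 2) ^ n)"
  shows "K = 0\<^sub>m (d ^ 2) (d ^ 2)"
proof (rule eq_matI)
  fix r s assume "r < dim_row (0\<^sub>m (d ^ 2) (d ^ 2) :: complex mat)" "s < dim_col (0\<^sub>m (d ^ 2) (d ^ 2) :: complex mat)"
  then have r: "r < d ^ 2" and s: "s < d ^ 2" by auto
  have d: "d > 0" using r by (cases "d = 0") auto
  have s': "s div d < d" "s mod d < d" using s d by (auto simp: power2_eq_square less_mult_imp_div_less)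
  have main: "(\<Sum>a<d. (\<Sum>b<d. K $$ (r, a * d + b) * v $ set_digit d i y b) * v $ set_digit d i x a) = 0"
    if x: "x < d ^ n" and y: "y < d ^ n" for x y
  proof -
    \<comment> \<open>Digit \<open>r\<close> at party \<open>i\<close> selects row \<open>r\<close>
      of \<open>K\<close>, while \<open>x\<close> and \<open>y\<close> prescribe the other parties
      independently in the two copies.\<close>
    define w where "w = set_digit (d ^ 2) i (interleave n d x y) r"
    have w: "w < (d ^ 2) ^ n" unfolding w_def by (rule set_digit_less) (use d i r in \<open>auto simp: interleave_less\<close>)
    have "0 = (lift n (d ^ 2) i K *\<^sub>v two_copy n d v v) $ w" unfolding z using w by simp
    also have "\<dots> = (\<Sum>c<d ^ 2. K $$ (r, c) * (v $ set_digit d i x (c div d) * v $ set_digit d i y (c mod d)))"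
      unfolding lift_mult_vec_index[OF w i two_copy_carrier]
    proof (rule sum.cong[OF refl])
      fix c assume "c \<in> {..<d ^ 2}"
      then have c: "c < d ^ 2" by simp
      have sd: "set_digit (d ^ 2) i w c = set_digit (d ^ 2) i (interleave n d x y) c"
        unfolding w_def by (rule set_digit_set_digit) (use d i r c in \<open>auto simp: interleave_less\<close>)
      have "digit (d ^ 2) i w = r"
        unfolding w_def using digit_set_digit[of _ "d ^ 2" n i r i] d i r by (simp add: interleave_less)
      moreover have "two_copy n d v v $ set_digit (d ^ 2) i w c
          = v $ set_digit d i x (c div d) * v $ set_digit d i y (c mod d)"
        unfolding sd
        by (simp add: two_copy_index set_digit_less interleave_less d i c hi_set_digit lo_set_digit
            hi_interleave lo_interleave x y)
      ultimately show "K $$ (digit (d ^ 2) i w, c) * two_copy n d v v $ set_digit (d ^ 2) i w c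
          = K $$ (r, c) * (v $ set_digit d i x (c div d) * v $ set_digit d i y (c mod d))"
        by simp
    qed
    \<comment> \<open>For one party \<open>hi\<close> and \<open>lo\<close> are \<open>div d\<close>
      and \<open>mod d\<close>, so the one-party case of \<open>sum_hi_lo\<close> splits this
      sum.\<close>
    also have "\<dots> = (\<Sum>c<(d ^ 2) ^ 1. (\<lambda>a b. K $$ (r, a * d + b) * (v $ set_digit d i x a * v $ set_digit d i y b))
        (hi 1 d c) (lo 1 d c))"
      unfolding power_one_right by (intro sum.cong refl) (simp add: hi_1 lo_1 d del: One_nat_def)
    also have "\<dots> = (\<Sum>a<d ^ 1. \<Sum>b<d ^ 1. K $$ (r, a * d + b) * (v $ set_digit d i x a * v $ set_digit d i y b))"
      by (rule sum_hi_lo[OF d])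
    finally show ?thesis by (simp add: sum_distrib_left sum_distrib_right mult_ac)
  qed
  have "(\<Sum>b<d. K $$ (r, s div d * d + b) * v $ set_digit d i y b) = 0" if y: "y < d ^ n" for y
    by (rule fully_entangled_annihilator[OF fe i main[OF _ y] s'(1)])
  then have "K $$ (r, s div d * d + s mod d) = 0"
    by (rule fully_entangled_annihilator[OF fe i _ s'(2)])
  then show "K $$ (r, s) = 0\<^sub>m (d ^ 2) (d ^ 2) $$ (r, s)" using r s by simp
qed (use K in auto)

lemma local_invertible_inverse:
  assumes D: "D > 0" and A: "local_invertible n D A"
  obtains B where "local_invertible n D B"
    "\<And>i. i < n \<Longrightarrow> A i * B i = 1\<^sub>m D" "\<And>i. i < n \<Longrightarrow> B i * A i = 1\<^sub>m D"
    "ltensor n D A * ltensor n D B = 1\<^sub>m (D ^ n)" "ltensor n D B * ltensor n D A = 1\<^sub>m (D ^ n)"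
proof -
  have "\<exists>B. B \<in> carrier_mat D D \<and> A i * B = 1\<^sub>m D \<and> B * A i = 1\<^sub>m D" if "i < n" for i
    by (rule invertible_matE[of "A i" D]) (use A that in \<open>auto simp: local_invertible_def\<close>)
  then obtain B where B: "\<And>i. i < n \<Longrightarrow> B i \<in> carrier_mat D D \<and> A i * B i = 1\<^sub>m D \<and> B i * A i = 1\<^sub>m D"
    by metis
  have Ac: "\<And>i. i < n \<Longrightarrow> A i \<in> carrier_mat D D" using A unfolding local_invertible_def by blast
  have "local_invertible n D B" using B Ac invertible_matI[of _ D] unfolding local_invertible_def by blast
  moreover have "ltensor n D A * ltensor n D B = 1\<^sub>m (D ^ n)" "ltensor n D B * ltensor n D A = 1\<^sub>m (D ^ n)"
    using B Ac by (simp_all add: ltensor_mult[OF D] ltensor_one[OF D, symmetric] cong: ltensor_cong)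
  ultimately show thesis using that B by blast
qed

lemma local_invertible_carrier: "local_invertible n D A \<Longrightarrow> i < n \<Longrightarrow> A i \<in> carrier_mat D D"
  unfolding local_invertible_def by blast

lemma invertible_mat_mult:
  fixes A B :: "complex mat"
  assumes A: "A \<in> carrier_mat m m" "invertible_mat A" and B: "B \<in> carrier_mat m m" "invertible_mat B"
  shows "invertible_mat (A * B)"
proof -
  obtain A' where A': "A' \<in> carrier_mat m m" "A * A' = 1\<^sub>m m" "A' * A = 1\<^sub>m m" by (rule invertible_matE[OF A])
  obtain B' where B': "B' \<in> carrier_mat m m" "B * B' = 1\<^sub>m m" "B' * B = 1\<^sub>m m" by (rule invertible_matE[OF B])
  have "(A * B) * (B' * A') = A * (B * B') * A'" "(B' * A') * (A * B) = B' * (A' * A) * B"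
    using A(1) B(1) A'(1) B'(1) by (simp_all add: assoc_mult_mat[of _ m m _ m _ m])
  then show ?thesis
    using A A' B B' by (intro invertible_matI[of _ m "B' * A'"]) auto
qed

lemma local_invertible_mult:
  assumes "local_invertible n D A" "local_invertible n D B"
  shows "local_invertible n D (\<lambda>i. A i * B i)"
  using assms by (auto simp: local_invertible_def intro!: invertible_mat_mult)

lemma lift_mult_ltensor:
  assumes D: "D > 0" and i: "i < n" and K: "K \<in> carrier_mat D D"
    and A: "\<And>j. j < n \<Longrightarrow> A j \<in> carrier_mat D D"
  shows "lift n D i K * ltensor n D A = ltensor n D (A(i := K * A i))"
  unfolding lift_def using K A
  by (subst ltensor_mult[OF D]) (auto intro!: ltensor_cong left_mult_one_mat)

section \<open>Local protocols\<close>

lemma smult_smult_mat: "a \<cdot>\<^sub>m (b \<cdot>\<^sub>m A) = (a * b) \<cdot>\<^sub>m (A :: complex mat)"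
  by (rule eq_matI) auto

lemma one_smult_mat: "1 \<cdot>\<^sub>m A = (A :: complex mat)"
  by (rule eq_matI) auto

lemma mult_mat_zero_vec: "A \<in> carrier_mat m k \<Longrightarrow> A *\<^sub>v 0\<^sub>v k = (0\<^sub>v m :: complex vec)"
  by (auto simp: vec_eq_iff scalar_prod_def)

lemma smult_mat_mult_vec:
  fixes A :: "complex mat"
  assumes "A \<in> carrier_mat m k" "v \<in> carrier_vec k"
  shows "(c \<cdot>\<^sub>m A) *\<^sub>v v = c \<cdot>\<^sub>v (A *\<^sub>v v)"
proof (rule eq_vecI)
  fix i assume "i < dim_vec (c \<cdot>\<^sub>v (A *\<^sub>v v))"
  then have i: "i < m" using assms by simp
  have "c \<cdot>\<^sub>m A \<in> carrier_mat m k" using assms by simp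
  from index_mult_mat_vec_sum[OF this assms(2) i] show "((c \<cdot>\<^sub>m A) *\<^sub>v v) $ i = (c \<cdot>\<^sub>v (A *\<^sub>v v)) $ i"
    using i assms by (simp add: index_mult_mat_vec_sum[OF assms i] sum_distrib_left mult.assoc del: index_mult_mat_vec)
qed (use assms in auto)

section \<open>Sums of lists of square matrices\<close>

abbreviation msum :: "nat \<Rightarrow> complex mat list \<Rightarrow> complex mat" where
  "msum N Ms \<equiv> foldr (+) Ms (0\<^sub>m N N)"

lemma msum_carrier: "set Ms \<subseteq> carrier_mat N N \<Longrightarrow> msum N Ms \<in> carrier_mat N N"
  by (induction Ms) auto

lemma msum_index:
  "set Ms \<subseteq> carrier_mat N N \<Longrightarrow> a < N \<Longrightarrow> b < N \<Longrightarrow>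
   msum N Ms $$ (a, b) = (\<Sum>M\<leftarrow>Ms. M $$ (a, b))"
proof (induction Ms)
  case (Cons M Ms)
  then show ?case using msum_carrier[of Ms N] by auto
qed simp

lemma msum_append:
  "set Ms \<subseteq> carrier_mat N N \<Longrightarrow> set Ms' \<subseteq> carrier_mat N N \<Longrightarrow> msum N (Ms @ Ms') = msum N Ms + msum N Ms'"
proof (induction Ms)
  case Nil
  then show ?case using msum_carrier[of Ms' N] by simp
next
  case (Cons M Ms)
  then show ?case using msum_carrier[of Ms' N] msum_carrier[of Ms N]
    by (auto simp: assoc_add_mat[of M N N "msum N Ms" "msum N Ms'"])
qed

lemma msum_concat:
  "(\<And>Ms. Ms \<in> set Mss \<Longrightarrow> set Ms \<subseteq> carrier_mat N N) \<Longrightarrow>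
   msum N (concat Mss) = msum N (map (msum N) Mss)"
proof (induction Mss)
  case (Cons Ms Mss)
  have "set (concat Mss) \<subseteq> carrier_mat N N" using Cons.prems by fastforce
  then have "msum N (Ms @ concat Mss) = msum N Ms + msum N (concat Mss)"
    using Cons.prems by (intro msum_append) auto
  then show ?case using Cons by simp
qed simp

lemma msum_sandwich:
  assumes A: "A \<in> carrier_mat N N" and B: "B \<in> carrier_mat N N"
  shows "set Ms \<subseteq> carrier_mat N N \<Longrightarrow> A * msum N Ms * B = msum N (map (\<lambda>M. A * M * B) Ms)"
proof (induction Ms)
  case Nil
  then show ?case using A B by simp
next
  case (Cons M Ms)
  have c: "M \<in> carrier_mat N N" "msum N Ms \<in> carrier_mat N N" using Cons.prems msum_carrier[of Ms N] by auto
  have "A * (M + msum N Ms) * B = A * M * B + A * msum N Ms * B"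
    using A B c by (simp add: mult_add_distrib_mat[OF A c] add_mult_distrib_mat[of _ N N])
  then show ?case using Cons by simp
qed

lemma msum_mult_vec_eq_0:
  assumes u: "u \<in> carrier_vec N"
  shows "set Ms \<subseteq> carrier_mat N N \<Longrightarrow> (\<And>M. M \<in> set Ms \<Longrightarrow> M *\<^sub>v u = 0\<^sub>v N) \<Longrightarrow> msum N Ms *\<^sub>v u = 0\<^sub>v N"
proof (induction Ms)
  case Nil
  then show ?case using u by (auto simp: vec_eq_iff)
next
  case (Cons M Ms)
  then show ?case
    using add_mult_distrib_mat_vec[of M N N "msum N Ms" u] msum_carrier[of Ms N] u by auto
qed

section \<open>Lifted measurements and the Kraus operators of a protocol\<close>

lemma lift_adjoint_mult:
  assumes D: "D > 0" and K: "K \<in> carrier_mat D D"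
  shows "mat_adjoint (lift n D i K) * lift n D i K = lift n D i (mat_adjoint K * K)"
proof -
  have one: "mat_adjoint (1\<^sub>m D) = (1\<^sub>m D :: complex mat)"
    by (rule eq_matI) (auto simp: mat_adjoint_index[of _ D D] carrier_matD[OF mat_adjoint_carrier[of _ D D]])
  show ?thesis
    unfolding lift_def using K
    by (subst ltensor_adjoint[OF D], simp, subst ltensor_mult[OF D])
       (auto simp: one intro!: ltensor_cong)
qed

lemma lift_add:
  assumes i: "i < n" and D: "D > 0" and K: "K \<in> carrier_mat D D" "L \<in> carrier_mat D D"
  shows "lift n D i (K + L) = lift n D i K + lift n D i L"
  by (rule eq_matI) (use K D in \<open>auto simp: lift_index[OF _ _ i] digit_less carrier_matD[OF lift_carrier]\<close>)

lemma lift_zero: "i < n \<Longrightarrow> D > 0 \<Longrightarrow> lift n D i (0\<^sub>m D D) = 0\<^sub>m (D ^ n) (D ^ n)"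
  unfolding lift_def by (rule ltensor_zero_factor[of i]) auto

lemma lift_one: "D > 0 \<Longrightarrow> lift n D i (1\<^sub>m D) = 1\<^sub>m (D ^ n)"
  by (simp add: lift_def ltensor_one)

lemma msum_lift:
  assumes i: "i < n" and D: "D > 0"
  shows "set Ks \<subseteq> carrier_mat D D \<Longrightarrow> msum (D ^ n) (map (lift n D i) Ks) = lift n D i (msum D Ks)"
proof (induction Ks)
  case Nil
  then show ?case using i D by (simp add: lift_zero)
next
  case (Cons K Ks)
  then show ?case using lift_add[OF i D, of K "msum D Ks"] msum_carrier[of Ks D] by auto
qed

text \<open>Unlike in \<open>local_invertible\<close>, singular factors are allowed: this is the
  class that contains every Kraus operator of a protocol.\<close>

definition local_op :: "nat \<Rightarrow> nat \<Rightarrow> complex mat \<Rightarrow> bool" where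
  "local_op n D M \<longleftrightarrow> (\<exists>A. (\<forall>i<n. A i \<in> carrier_mat D D) \<and> M = ltensor n D A)"

lemma local_op_carrier: "local_op n D M \<Longrightarrow> M \<in> carrier_mat (D ^ n) (D ^ n)"
  unfolding local_op_def by auto

lemma local_op_ltensor: "(\<And>i. i < n \<Longrightarrow> A i \<in> carrier_mat D D) \<Longrightarrow> local_op n D (ltensor n D A)"
  unfolding local_op_def by blast

lemma local_op_mult:
  assumes D: "D > 0" and L: "local_op n D L" and M: "local_op n D M"
  shows "local_op n D (L * M)"
proof -
  obtain A B where A: "\<And>i. i < n \<Longrightarrow> A i \<in> carrier_mat D D" "L = ltensor n D A"
    and B: "\<And>i. i < n \<Longrightarrow> B i \<in> carrier_mat D D" "M = ltensor n D B"
    using L M unfolding local_op_def by blast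
  have "L * M = ltensor n D (\<lambda>i. A i * B i)" unfolding A(2) B(2) by (rule ltensor_mult[OF D A(1) B(1)])
  moreover have "A i * B i \<in> carrier_mat D D" if "i < n" for i using A(1)[OF that] B(1)[OF that] by simp
  ultimately show ?thesis by (simp add: local_op_ltensor)
qed

lemma local_op_lift: "K \<in> carrier_mat D D \<Longrightarrow> local_op n D (lift n D i K)"
  unfolding lift_def by (rule local_op_ltensor) auto

lemma kraus_local_op:
  assumes "wf_proto n D P" "D > 0" "K \<in> set (kraus n D P)"
  shows "local_op n D K"
  using assms
proof (induction arbitrary: K)
  case 1
  then show ?case using local_op_ltensor[of n "\<lambda>_. 1\<^sub>m D" D] by (simp add: ltensor_one)
next
  case (2 i ks)
  then obtain K' p L where "(K', p) \<in> set ks" "L \<in> set (kraus n D p)" "K = L * lift n D i K'" by auto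
  moreover have "local_op n D L" "K' \<in> carrier_mat D D" using 2 calculation by auto
  ultimately show ?case using \<open>D > 0\<close> by (simp add: local_op_mult local_op_lift)
qed

text \<open>Completeness of a subtree, sandwiched between the lifted \<open>K\<close> and its
  adjoint, collapses to the lift of \<open>mat_adjoint K * K\<close>. Summing over outcomes leaves
  the completeness relation of the measurement at the root.\<close>

lemma kraus_complete:
  assumes "wf_proto n D P" "D > 0"
  shows "msum (D ^ n) (map (\<lambda>K. mat_adjoint K * K) (kraus n D P)) = 1\<^sub>m (D ^ n)"
  using assms
proof (induction)
  case 1
  have "mat_adjoint (1\<^sub>m N) = (1\<^sub>m N :: complex mat)" for N
    by (rule eq_matI) (auto simp: mat_adjoint_index[of _ N N] carrier_matD[OF mat_adjoint_carrier[of _ N N]])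
  then show ?case by simp
next
  case (2 i ks)
  let ?N = "D ^ n"
  let ?sq = "\<lambda>K. mat_adjoint K * K :: complex mat"
  have inner: "msum ?N (map (\<lambda>L. ?sq (L * lift n D i K)) (kraus n D p)) = lift n D i (?sq K)"
    if Kp: "(K, p) \<in> set ks" for K p
  proof -
    have K: "K \<in> carrier_mat D D" and p: "wf_proto n D p" using 2 Kp by auto
    have Lc: "L \<in> carrier_mat ?N ?N" if "L \<in> set (kraus n D p)" for L
      using kraus_local_op[OF p \<open>D > 0\<close> that] by (rule local_op_carrier)
    have "?sq (L * lift n D i K) = mat_adjoint (lift n D i K) * ?sq L * lift n D i K"
      if "L \<in> set (kraus n D p)" for L
      using Lc[OF that] mat_adjoint_carrier[OF Lc[OF that]] mat_adjoint_carrier[OF lift_carrier, of n D i K]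
      by (simp add: mat_adjoint_mult[OF Lc[OF that] lift_carrier] assoc_mult_mat[of _ ?N ?N _ ?N _ ?N]
          mult_carrier_mat[of _ ?N ?N])
    then have "msum ?N (map (\<lambda>L. ?sq (L * lift n D i K)) (kraus n D p))
        = msum ?N (map (\<lambda>M. mat_adjoint (lift n D i K) * M * lift n D i K) (map ?sq (kraus n D p)))"
      by (simp cong: map_cong)
    also have "\<dots> = mat_adjoint (lift n D i K) * 1\<^sub>m ?N * lift n D i K"
      using 2 Kp Lc by (subst msum_sandwich[symmetric]) (auto intro!: mult_carrier_mat[of _ "D ^ n" "D ^ n"])
    also have "\<dots> = lift n D i (?sq K)"
      unfolding right_mult_one_mat[OF mat_adjoint_carrier[OF lift_carrier]]
      by (rule lift_adjoint_mult[OF \<open>D > 0\<close> K])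
    finally show ?thesis .
  qed
  have car: "?sq (L * lift n D i K) \<in> carrier_mat ?N ?N" if "(K, p) \<in> set ks" "L \<in> set (kraus n D p)" for K p L
  proof -
    have p: "wf_proto n D p" using 2 that(1) by auto
    have L: "L \<in> carrier_mat ?N ?N" by (rule local_op_carrier[OF kraus_local_op[OF p \<open>D > 0\<close> that(2)]])
    have "L * lift n D i K \<in> carrier_mat ?N ?N" using mult_carrier_mat[OF L lift_carrier] .
    from mult_carrier_mat[OF mat_adjoint_carrier[OF this] this] show ?thesis .
  qed
  let ?row = "\<lambda>kp. map (\<lambda>L. ?sq (L * lift n D i (fst kp))) (kraus n D (snd kp))"
  have "msum ?N (map ?sq (kraus n D (Meas i ks))) = msum ?N (concat (map ?row ks))"
    by (simp add: map_concat o_def)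
  also have "\<dots> = msum ?N (map (msum ?N) (map ?row ks))"
    using car by (intro msum_concat) auto
  also have "map (msum ?N) (map ?row ks) = map (lift n D i) (map (\<lambda>kp. ?sq (fst kp)) ks)"
    using inner by auto
  also have "msum ?N \<dots> = lift n D i (msum D (map (\<lambda>kp. ?sq (fst kp)) ks))"
    using 2 by (intro msum_lift) (auto intro!: mult_carrier_mat[of _ D D])
  finally show ?case using 2 by (simp add: lift_one case_prod_beta')
qed

lemma kraus_carrier:
  "wf_proto n D P \<Longrightarrow> D > 0 \<Longrightarrow> K \<in> set (kraus n D P) \<Longrightarrow> K \<in> carrier_mat (D ^ n) (D ^ n)"
  by (rule local_op_carrier[OF kraus_local_op])

text \<open>The output is the mixture of the unnormalized branch states, so statements about the
  channel become statements about the vectors \<open>K *\<^sub>v u\<close>.\<close>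

lemma channel_proj_index:
  assumes P: "wf_proto n D P" "D > 0" and u: "u \<in> carrier_vec (D ^ n)" and ab: "a < D ^ n" "b < D ^ n"
  shows "channel n D P (proj u) $$ (a, b) = (\<Sum>K\<leftarrow>kraus n D P. (K *\<^sub>v u) $ a * cnj ((K *\<^sub>v u) $ b))"
proof -
  let ?N = "D ^ n"
  have pu: "proj u \<in> carrier_mat ?N ?N" using u by (simp add: proj_def)
  have e: "(K * proj u * mat_adjoint K) $$ (a, b) = (K *\<^sub>v u) $ a * cnj ((K *\<^sub>v u) $ b)"
    if K: "K \<in> carrier_mat ?N ?N" for K
  proof -
    have Kp: "K * proj u \<in> carrier_mat ?N ?N" using K pu by simp
    have "(K * proj u) $$ (a, t) = (K *\<^sub>v u) $ a * cnj (u $ t)" if t: "t < ?N" for t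
      unfolding index_mult_mat_sum[OF K pu ab(1) t] index_mult_mat_vec_sum[OF K u ab(1)] sum_distrib_right
      using t u by (intro sum.cong refl) (simp add: proj_def)
    then show ?thesis
      unfolding index_mult_mat_sum[OF Kp mat_adjoint_carrier[OF K] ab] index_mult_mat_vec_sum[OF K u ab(2)]
        cnj_sum sum_distrib_left
      by (intro sum.cong refl) (simp add: mat_adjoint_index[OF K _ ab(2)])
  qed
  have "channel n D P (proj u) $$ (a, b)
      = (\<Sum>M\<leftarrow>map (\<lambda>K. K * proj u * mat_adjoint K) (kraus n D P). M $$ (a, b))"
    unfolding channel_def
  proof (rule msum_index[OF _ ab], safe)
    fix M assume "M \<in> set (map (\<lambda>K. K * proj u * mat_adjoint K) (kraus n D P))"
    then show "M \<in> carrier_mat ?N ?N"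
      using kraus_carrier[OF P] pu by (auto intro!: mult_carrier_mat[of _ ?N ?N])
  qed
  also have "\<dots> = (\<Sum>K\<leftarrow>kraus n D P. (K *\<^sub>v u) $ a * cnj ((K *\<^sub>v u) $ b))"
    using kraus_carrier[OF P] e by (auto simp: o_def intro!: arg_cong[of _ _ sum_list] map_cong)
  finally show ?thesis .
qed

section \<open>Rigidity of local operators on the two-copy state\<close>

locale two_copy_state =
  fixes n d :: nat and v :: "complex vec"
  assumes d_pos: "d > 0" and n_pos: "n > 0"
    and v: "v \<in> carrier_vec (d ^ n)"
    and fe: "fully_entangled n d v"
    and stab: "stabilizer n (d ^ 2) (two_copy n d v v) = {1\<^sub>m ((d ^ 2) ^ n), SWAP_all n d}"
begin

abbreviation "D \<equiv> d ^ 2"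
abbreviation "N \<equiv> (d ^ 2) ^ n"
abbreviation "Psi \<equiv> two_copy n d v v"
abbreviation "S \<equiv> SWAP_all n d"
abbreviation "loc \<equiv> ltensor n (d ^ 2)"

lemma D_pos: "D > 0" using d_pos by simp

lemma loc_Psi_carrier [simp]: "loc A *\<^sub>v Psi \<in> carrier_vec N"
  by (rule mult_mat_vec_carrier[OF ltensor_carrier two_copy_carrier])

text \<open>Full entanglement is inherited by every invertible local image of \<open>Psi\<close>:
  undoing the factors of the other parties reduces the claim to \<open>Psi\<close> itself.\<close>

lemma lift_annihilates:
  assumes B: "local_invertible n D B" and i: "i < n" and K: "K \<in> carrier_mat D D"
    and z: "lift n D i K *\<^sub>v (loc B *\<^sub>v Psi) = 0\<^sub>v N"
  shows "K = 0\<^sub>m D D"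
proof -
  obtain C where C: "local_invertible n D C" "\<And>i. i < n \<Longrightarrow> B i * C i = 1\<^sub>m D" "\<And>i. i < n \<Longrightarrow> C i * B i = 1\<^sub>m D"
    by (rule local_invertible_inverse[OF D_pos B]) (rule that; assumption)
  have Bc: "\<And>i. i < n \<Longrightarrow> B i \<in> carrier_mat D D" and Cc: "\<And>i. i < n \<Longrightarrow> C i \<in> carrier_mat D D"
    using B C(1) by (auto simp: local_invertible_def)
  have KB: "K * B i \<in> carrier_mat D D" using K Bc[OF i] by simp
  \<comment> \<open>No inverse is applied at party \<open>i\<close>: there \<open>B i\<close> stands
    to the right of \<open>K\<close> and is cancelled only at the end, once \<open>K * B i\<close>
    is known to vanish.\<close>
  have "loc (C(i := 1\<^sub>m D)) * (lift n D i K * loc B) = loc (\<lambda>j. (C(i := 1\<^sub>m D)) j * (B(i := K * B i)) j)"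
  proof -
    have "lift n D i K * loc B = loc (B(i := K * B i))" by (rule lift_mult_ltensor[OF D_pos i K Bc])
    moreover have "loc (C(i := 1\<^sub>m D)) * loc (B(i := K * B i))
        = loc (\<lambda>j. (C(i := 1\<^sub>m D)) j * (B(i := K * B i)) j)"
      by (rule ltensor_mult[OF D_pos]) (use KB Cc Bc in auto)
    ultimately show ?thesis by simp
  qed
  also have "\<dots> = lift n D i (K * B i)"
    unfolding lift_def by (rule ltensor_cong) (use KB C(3) in auto)
  finally have e: "loc (C(i := 1\<^sub>m D)) * (lift n D i K * loc B) = lift n D i (K * B i)" .
  have "lift n D i (K * B i) *\<^sub>v Psi = loc (C(i := 1\<^sub>m D)) *\<^sub>v (lift n D i K *\<^sub>v (loc B *\<^sub>v Psi))"
    unfolding e[symmetric]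
    by (simp add: assoc_mult_mat_vec[of _ N N _ N] mult_carrier_mat[of _ N N])
  also have "\<dots> = 0\<^sub>v N" unfolding z by (auto simp: vec_eq_iff)
  finally have "K * B i = 0\<^sub>m D D" by (rule lift_two_copy_eq_0[OF fe i KB])
  then have "K * B i * C i = 0\<^sub>m D D" using Cc[OF i] by simp
  then show ?thesis using C(2)[OF i] Cc[OF i] Bc[OF i] K by (simp add: assoc_mult_mat[of _ D D _ D _ D])
qed

text \<open>If the vector were zero, even the identity of party 0 would annihilate it and would have
  to vanish.\<close>

lemma loc_Psi_nonzero:
  assumes B: "local_invertible n D B"
  shows "loc B *\<^sub>v Psi \<noteq> 0\<^sub>v N"
proof
  assume z: "loc B *\<^sub>v Psi = 0\<^sub>v N"
  have "lift n D 0 (1\<^sub>m D) *\<^sub>v (loc B *\<^sub>v Psi) = 0\<^sub>v N"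
    unfolding z by (auto simp: vec_eq_iff carrier_matD[OF lift_carrier])
  then have "1\<^sub>m D = (0\<^sub>m D D :: complex mat)" by (rule lift_annihilates[OF B n_pos one_carrier_mat])
  then have "(1\<^sub>m D :: complex mat) $$ (0, 0) = (0\<^sub>m D D) $$ (0, 0)" by simp
  then show False using d_pos by simp
qed

text \<open>A singular factor has a nonzero left annihilator. Lifted to its party, that annihilator
  kills the reached vector and hence the target, contradicting
  \<open>lift_annihilates\<close>.\<close>

lemma reaching_factors_invertible:
  assumes A: "\<And>i. i < n \<Longrightarrow> A i \<in> carrier_mat D D" and B: "local_invertible n D B"
    and e: "loc A *\<^sub>v Psi = c \<cdot>\<^sub>v (loc B *\<^sub>v Psi)" and c: "c \<noteq> 0"
  shows "local_invertible n D A"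
  unfolding local_invertible_def
proof (intro allI impI conjI A)
  fix i assume i: "i < n"
  show "invertible_mat (A i)"
  proof (rule ccontr)
    assume "\<not> invertible_mat (A i)"
    then obtain K where K: "K \<in> carrier_mat D D" "K \<noteq> 0\<^sub>m D D" "K * A i = 0\<^sub>m D D"
      using singular_left_annihilator[OF A[OF i]] by blast
    have "lift n D i K * loc A = loc (A(i := K * A i))"
      by (rule lift_mult_ltensor[OF D_pos i K(1) A])
    also have "\<dots> = 0\<^sub>m N N"
      by (rule ltensor_zero_factor[OF i _ D_pos]) (simp add: K(3))
    finally have "lift n D i K * loc A = 0\<^sub>m N N" .
    then have "lift n D i K *\<^sub>v (loc A *\<^sub>v Psi) = 0\<^sub>v N"
      by (subst assoc_mult_mat_vec[symmetric, of _ N N _ N]) (auto simp: vec_eq_iff two_copy_def)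
    then have "c \<cdot>\<^sub>v (lift n D i K *\<^sub>v (loc B *\<^sub>v Psi)) = 0\<^sub>v N"
      unfolding e by (simp add: mult_mat_vec[OF lift_carrier loc_Psi_carrier])
    then have "lift n D i K *\<^sub>v (loc B *\<^sub>v Psi) = 0\<^sub>v N"
      using c by (auto simp: vec_eq_iff)
    then show False using lift_annihilates[OF B i K(1)] K(2) by blast
  qed
qed

text \<open>All factors of \<open>L\<close> are invertible because the multiple \<open>c\<close> is
  nonzero. Undoing \<open>loc B\<close> and dividing by \<open>c\<close> thus gives an element of
  the stabilizer, of which there are only two.\<close>

lemma local_stabilizer_cases:
  assumes L: "local_op n D L" and B: "local_invertible n D B"
    and e: "L *\<^sub>v Psi = c \<cdot>\<^sub>v (loc B *\<^sub>v Psi)" and c: "c \<noteq> 0"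
  shows "L = c \<cdot>\<^sub>m loc B \<or> L = c \<cdot>\<^sub>m (loc B * S)"
proof -
  obtain A where A: "\<And>i. i < n \<Longrightarrow> A i \<in> carrier_mat D D" and LA: "L = loc A"
    using L unfolding local_op_def by blast
  have invA: "local_invertible n D A"
    by (rule reaching_factors_invertible[OF A B e[unfolded LA] c])
  obtain C where C: "local_invertible n D C" "loc B * loc C = 1\<^sub>m N" "loc C * loc B = 1\<^sub>m N"
    by (rule local_invertible_inverse[OF D_pos B]) (rule that; assumption)
  define E where "E i = C i * A i" for i
  have E: "local_invertible n D E" unfolding E_def by (rule local_invertible_mult[OF C(1) invA])
  have E0: "E 0 \<in> carrier_mat D D" "invertible_mat (E 0)" using E n_pos by (auto simp: local_invertible_def)
  have locE: "loc E = loc C * loc A"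
    unfolding E_def using C(1) A by (subst ltensor_mult[OF D_pos]) (auto simp: local_invertible_def)
  \<comment> \<open>The scalar \<open>1 / c\<close> goes into the factor of party 0, so that
    \<open>F\<close> is again a family of local operators.\<close>
  define F where "F = E(0 := (1 / c) \<cdot>\<^sub>m E 0)"
  have "invertible_mat ((1 / c) \<cdot>\<^sub>m E 0)"
  proof -
    obtain Z where Z: "Z \<in> carrier_mat D D" "E 0 * Z = 1\<^sub>m D" "Z * E 0 = 1\<^sub>m D" by (rule invertible_matE[OF E0])
    show ?thesis
      by (rule invertible_matI[of _ D "c \<cdot>\<^sub>m Z"])
         (use E0 Z c in \<open>auto simp: mult_smult_distrib[of _ D D _ D] mult_smult_assoc_mat[of _ D D _ D] smult_smult_mat\<close>)
  qed
  then have F: "local_invertible n D F" using E E0 by (auto simp: F_def local_invertible_def)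
  have locF: "loc F = (1 / c) \<cdot>\<^sub>m (loc C * loc A)"
    unfolding F_def locE[symmetric] using ltensor_update_smult[of 0 n E D "1 / c"] n_pos E0(1) D_pos by blast
  have "loc F *\<^sub>v Psi = (1 / c) \<cdot>\<^sub>v (loc C *\<^sub>v (loc A *\<^sub>v Psi))"
    unfolding locF
    by (simp add: smult_mat_mult_vec[of _ N N] assoc_mult_mat_vec[of _ N N _ N] mult_carrier_mat[of _ N N])
  also have "\<dots> = (1 / c) \<cdot>\<^sub>v (c \<cdot>\<^sub>v (loc C *\<^sub>v (loc B *\<^sub>v Psi)))"
    using e unfolding LA by (simp add: mult_mat_vec[OF ltensor_carrier loc_Psi_carrier])
  also have "loc C *\<^sub>v (loc B *\<^sub>v Psi) = Psi"
    using C(3) by (simp add: assoc_mult_mat_vec[symmetric, of _ N N _ N])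
  finally have "loc F *\<^sub>v Psi = Psi" using c by (simp add: smult_smult_assoc)
  then have "loc F \<in> {1\<^sub>m N, S}"
    unfolding stab[symmetric] stabilizer_def using F by blast
  moreover have "L = c \<cdot>\<^sub>m (loc B * loc F)"
  proof -
    have "loc B * (loc C * loc A) = loc A"
      using C(2) by (simp add: assoc_mult_mat[symmetric, of _ N N _ N _ N])
    then show ?thesis
      unfolding locF LA using c
      by (simp add: mult_smult_distrib[OF ltensor_carrier mult_carrier_mat[OF ltensor_carrier ltensor_carrier]]
          smult_smult_mat one_smult_mat)
  qed
  ultimately show ?thesis by (auto simp: right_mult_one_mat[OF ltensor_carrier])
qed

text \<open>Induction along the tree, with \<open>B\<close> accumulating the outcomes so far. While
  the accumulated operator is invertible, the claim passes to the subtree. Once it is singular, no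
  continuation can reach a nonzero multiple of the target, so all of them annihilate the state; by
  completeness the state is already zero, and the last measurement operator must vanish.\<close>

lemma kraus_eq_0:
  assumes P: "wf_proto n D P" and B: "local_invertible n D B" and C: "local_invertible n D C"
    and reach: "\<And>K. K \<in> set (kraus n D P) \<Longrightarrow> \<exists>c. K *\<^sub>v (loc B *\<^sub>v Psi) = c \<cdot>\<^sub>v (loc C *\<^sub>v Psi)"
    and K: "K \<in> set (kraus n D P)" and z: "K *\<^sub>v (loc B *\<^sub>v Psi) = 0\<^sub>v N"
  shows "K = 0\<^sub>m N N"
  using P B reach K z
proof (induction arbitrary: B K)
  case 1
  then have "loc B *\<^sub>v Psi = 0\<^sub>v N" by simp
  then show ?case using loc_Psi_nonzero 1 by blast
next
  case (2 i ks)
  obtain M p L where M: "(M, p) \<in> set ks" and L: "L \<in> set (kraus n D p)" and K: "K = L * lift n D i M"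
    using "2.prems"(3) by auto
  have p: "wf_proto n D p" and Mc: "M \<in> carrier_mat D D" using 2 M by auto
  have i: "i < n" by fact
  have B: "local_invertible n D B" by fact
  have Bc: "\<And>j. j < n \<Longrightarrow> B j \<in> carrier_mat D D" using B by (auto simp: local_invertible_def)
  \<comment> \<open>The accumulated local operator after outcome \<open>M\<close>; the subtree
    starts from \<open>loc ?B *\<^sub>v Psi\<close>.\<close>
  let ?B = "B(i := M * B i)"
  have lB: "lift n D i M * loc B = loc ?B" by (rule lift_mult_ltensor[OF D_pos i Mc Bc])
  have Bc': "\<And>j. j < n \<Longrightarrow> ?B j \<in> carrier_mat D D" using Bc Mc by auto
  have step: "(L' * lift n D i M) *\<^sub>v (loc B *\<^sub>v Psi) = L' *\<^sub>v (loc ?B *\<^sub>v Psi)" if "L' \<in> set (kraus n D p)" for L'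
    using kraus_carrier[OF p D_pos that] unfolding lB[symmetric]
    by (simp add: assoc_mult_mat_vec[of _ N N _ N] mult_carrier_mat[of _ N N])
  have reach': "\<exists>c. L' *\<^sub>v (loc ?B *\<^sub>v Psi) = c \<cdot>\<^sub>v (loc C *\<^sub>v Psi)" if "L' \<in> set (kraus n D p)" for L'
  proof -
    have "L' * lift n D i M \<in> set (kraus n D (Meas i ks))" using that M by force
    then show ?thesis using "2.prems"(2) step[OF that] by metis
  qed
  show ?case
  proof (cases "local_invertible n D ?B")
    case True
    have "L = 0\<^sub>m N N"
    proof -
      have "L *\<^sub>v (loc ?B *\<^sub>v Psi) = 0\<^sub>v N" using "2.prems"(4) step[OF L] unfolding K by simp
      then show ?thesis using 2 M True reach' L by blast
    qed
    then show ?thesis unfolding K using left_mult_zero_mat[OF lift_carrier[of n D i M]] by simp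
  next
    case False
    \<comment> \<open>A nonzero branch would reach the target through factors
      \<open>A j * ?B j\<close>, which must then all be invertible, and so would every
      \<open>?B j\<close>.\<close>
    have "L' *\<^sub>v (loc ?B *\<^sub>v Psi) = 0\<^sub>v N" if L': "L' \<in> set (kraus n D p)" for L'
    proof (rule ccontr)
      assume nz: "L' *\<^sub>v (loc ?B *\<^sub>v Psi) \<noteq> 0\<^sub>v N"
      obtain c where c: "L' *\<^sub>v (loc ?B *\<^sub>v Psi) = c \<cdot>\<^sub>v (loc C *\<^sub>v Psi)" using reach'[OF L'] by blast
      have c0: "c \<noteq> 0"
      proof
        assume "c = 0"
        then show False using nz c by (auto simp: vec_eq_iff two_copy_def)
      qed
      obtain A where A: "\<And>j. j < n \<Longrightarrow> A j \<in> carrier_mat D D" and LA: "L' = loc A"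
        using kraus_local_op[OF p D_pos L'] unfolding local_op_def by blast
      have prod: "loc (\<lambda>j. A j * ?B j) *\<^sub>v Psi = c \<cdot>\<^sub>v (loc C *\<^sub>v Psi)"
      proof -
        have "loc (\<lambda>j. A j * ?B j) = loc A * loc ?B" by (rule ltensor_mult[OF D_pos A Bc', symmetric])
        then show ?thesis
          using c unfolding LA by (simp add: assoc_mult_mat_vec[of _ N N _ N])
      qed
      have AB: "A j * ?B j \<in> carrier_mat D D" if "j < n" for j
        using mult_carrier_mat[OF A[OF that] Bc'[OF that]] .
      have inv: "local_invertible n D (\<lambda>j. A j * ?B j)"
        by (rule reaching_factors_invertible[OF AB C prod c0])
      have "invertible_mat (?B j)" if j: "j < n" for j
      proof -
        have "det (A j * ?B j) \<noteq> 0"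
        proof -
          obtain Z where "Z \<in> carrier_mat D D" "A j * ?B j * Z = 1\<^sub>m D"
            using invertible_matE[OF AB[OF j]] inv j unfolding local_invertible_def by blast
          then have "det (A j * ?B j) * det Z = 1"
            using det_mult[OF AB[OF j], of Z] by simp
          then show ?thesis by auto
        qed
        then have "det (?B j) \<noteq> 0" using det_mult[OF A[OF j] Bc'[OF j]] by auto
        then show ?thesis by (rule invertible_mat_of_det[OF Bc'[OF j]])
      qed
      then show False using False Bc' by (auto simp: local_invertible_def)
    qed
    \<comment> \<open>Every summand \<open>mat_adjoint L * L\<close> annihilates the vector, yet
      their sum is the identity.\<close>
    then have "msum N (map (\<lambda>L. mat_adjoint L * L) (kraus n D p)) *\<^sub>v (loc ?B *\<^sub>v Psi) = 0\<^sub>v N"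
    proof (intro msum_mult_vec_eq_0)
      fix Q assume z: "\<And>L'. L' \<in> set (kraus n D p) \<Longrightarrow> L' *\<^sub>v (loc ?B *\<^sub>v Psi) = 0\<^sub>v N"
        and "Q \<in> set (map (\<lambda>L. mat_adjoint L * L) (kraus n D p))"
      then obtain L' where L': "L' \<in> set (kraus n D p)" and Q: "Q = mat_adjoint L' * L'" by auto
      note c = kraus_carrier[OF p D_pos L']
      show "Q *\<^sub>v (loc ?B *\<^sub>v Psi) = 0\<^sub>v N"
        unfolding Q assoc_mult_mat_vec[OF mat_adjoint_carrier[OF c] c loc_Psi_carrier] z[OF L']
        by (rule mult_mat_zero_vec[OF mat_adjoint_carrier[OF c]])
    qed (use kraus_carrier[OF p D_pos] in \<open>auto intro!: mult_carrier_mat[of _ N N]\<close>)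
    then have "loc ?B *\<^sub>v Psi = 0\<^sub>v N" unfolding kraus_complete[OF p D_pos] by simp
    then have "lift n D i M *\<^sub>v (loc B *\<^sub>v Psi) = 0\<^sub>v N"
      unfolding lB[symmetric] by (simp add: assoc_mult_mat_vec[of _ N N _ N])
    then have "M = 0\<^sub>m D D" by (rule lift_annihilates[OF B i Mc])
    then show ?thesis
      unfolding K using lift_zero[OF i D_pos] kraus_carrier[OF p D_pos L] by simp
  qed
qed

end

section \<open>Finitely many rounds\<close>

text \<open>Real positive corner entries force the a priori complex factor \<open>c\<close> to be a
  positive real.\<close>

lemma prop_posI:
  assumes G: "G \<in> carrier_mat m m" and A: "A \<in> carrier_mat m m" and m: "m > 0"
    and e: "\<And>i j. i < m \<Longrightarrow> j < m \<Longrightarrow> G $$ (i, j) = c * A $$ (i, j)"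
    and pG: "G $$ (0, 0) = complex_of_real r" "r > 0" and pA: "A $$ (0, 0) = complex_of_real s" "s > 0"
  shows "prop_pos G A"
proof -
  have "c = complex_of_real (r / s)"
    using e[OF m m] pG pA by (simp add: field_simps)
  then have "G = complex_of_real (r / s) \<cdot>\<^sub>m A" using e G A by (intro eq_matI) auto
  then show ?thesis unfolding prop_pos_def using pG pA by (intro exI[of _ "r / s"]) auto
qed

lemma prop_pos_of_product:
  assumes G: "G1 \<in> carrier_mat m m" "G2 \<in> carrier_mat m m"
    and H: "H1 \<in> carrier_mat m m" "H2 \<in> carrier_mat m m" and m: "m > 0"
    and pos: "\<And>M. M \<in> {G1, G2, H1, H2} \<Longrightarrow> \<exists>r>0. M $$ (0, 0) = complex_of_real r"
    and e: "\<And>i j k l. i < m \<Longrightarrow> j < m \<Longrightarrow> k < m \<Longrightarrow> l < m \<Longrightarrow>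
      G1 $$ (i, j) * G2 $$ (k, l) = p * (H1 $$ (i, j) * H2 $$ (k, l))"
  shows "prop_pos G1 H1 \<and> prop_pos G2 H2"
proof -
  obtain r1 r2 s1 s2 where r: "r1 > 0" "G1 $$ (0, 0) = complex_of_real r1" "r2 > 0" "G2 $$ (0, 0) = complex_of_real r2"
    "s1 > 0" "H1 $$ (0, 0) = complex_of_real s1" "s2 > 0" "H2 $$ (0, 0) = complex_of_real s2"
    using pos by (metis insert_iff)
  \<comment> \<open>The other copy is frozen at the corner \<open>(0, 0)\<close>, where
    \<open>pos\<close> rules out a vanishing entry.\<close>
  have e1: "G1 $$ (i, j) = (p * H2 $$ (0, 0) / G2 $$ (0, 0)) * H1 $$ (i, j)" if "i < m" "j < m" for i j
    using e[OF that m m] r by (simp add: field_simps)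
  have "prop_pos G1 H1" by (rule prop_posI[OF G(1) H(1) m e1 r(2,1) r(6,5)])
  moreover have e2: "G2 $$ (i, j) = (p * H1 $$ (0, 0) / G1 $$ (0, 0)) * H2 $$ (i, j)" if "i < m" "j < m" for i j
    using e[OF m m that] r by (simp add: field_simps)
  have "prop_pos G2 H2" by (rule prop_posI[OF G(2) H(2) m e2 r(4,3) r(8,7)])
  ultimately show ?thesis ..
qed

text \<open>The left-hand side has operator-Schmidt rank one across the two copies; for linearly
  independent \<open>H1\<close>, \<open>H2\<close> the corresponding minor of the right-hand side is \<open>- p q\<close> times a
  nonzero square, so \<open>p\<close> or \<open>q\<close> vanishes.\<close>

lemma tensor2_mixture_imp_prop_pos:
  fixes G1 G2 H1 H2 :: "complex mat"
  assumes d: "d > 0" and G: "G1 \<in> carrier_mat (d ^ n) (d ^ n)" "G2 \<in> carrier_mat (d ^ n) (d ^ n)"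
    and H: "H1 \<in> carrier_mat (d ^ n) (d ^ n)" "H2 \<in> carrier_mat (d ^ n) (d ^ n)"
    and pos: "\<And>M. M \<in> {G1, G2, H1, H2} \<Longrightarrow> \<exists>r>0. M $$ (0, 0) = complex_of_real r"
    and mix: "tensor2 n d G1 G2 = p \<cdot>\<^sub>m tensor2 n d H1 H2 + q \<cdot>\<^sub>m tensor2 n d H2 H1"
  shows "(prop_pos G1 H1 \<and> prop_pos G2 H2) \<or> (prop_pos G1 H2 \<and> prop_pos G2 H1)"
proof -
  let ?m = "d ^ n"
  have m: "?m > 0" using d by simp
  have e: "G1 $$ (i, j) * G2 $$ (k, l) = p * (H1 $$ (i, j) * H2 $$ (k, l)) + q * (H2 $$ (i, j) * H1 $$ (k, l))"
    if "i < ?m" "j < ?m" "k < ?m" "l < ?m" for i j k l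
  proof -
    let ?x = "interleave n d i k" and ?y = "interleave n d j l"
    have xy: "?x < (d ^ 2) ^ n" "?y < (d ^ 2) ^ n" using d by (auto intro: interleave_less)
    have "tensor2 n d G1 G2 $$ (?x, ?y)
        = p * tensor2 n d H1 H2 $$ (?x, ?y) + q * tensor2 n d H2 H1 $$ (?x, ?y)"
      unfolding mix using xy by simp
    then show ?thesis using that d by (simp add: tensor2_index[OF xy] hi_interleave lo_interleave)
  qed
  show ?thesis
  \<comment> \<open>The condition expresses linear dependence of \<open>H1\<close> and
    \<open>H2\<close>; the two terms of the mixture then coincide up to their weights.\<close>
  proof (cases "\<forall>i<?m. \<forall>j<?m. \<forall>k<?m. \<forall>l<?m. H1 $$ (i, j) * H2 $$ (k, l) = H2 $$ (i, j) * H1 $$ (k, l)")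
    case True
    have e': "G1 $$ (i, j) * G2 $$ (k, l) = (p + q) * (H1 $$ (i, j) * H2 $$ (k, l))"
      if "i < ?m" "j < ?m" "k < ?m" "l < ?m" for i j k l
      using e[OF that] True[rule_format, OF that] by (simp add: distrib_right)
    have "prop_pos G1 H1 \<and> prop_pos G2 H2"
      by (rule prop_pos_of_product[OF G H m pos e'])
    then show ?thesis ..
  next
    case False
    then obtain i j k l where ijkl: "i < ?m" "j < ?m" "k < ?m" "l < ?m"
      and ne: "H1 $$ (i, j) * H2 $$ (k, l) - H2 $$ (i, j) * H1 $$ (k, l) \<noteq> 0" by auto
    \<comment> \<open>The 2 by 2 minor with rows \<open>(i, j)\<close>, \<open>(k, l)\<close> in the
      first copy and columns \<open>(i, j)\<close>, \<open>(k, l)\<close> in the second. The letters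
      \<open>a\<close>, \<open>b\<close> stand for the entries of \<open>H1\<close>,
      \<open>H2\<close> at \<open>(i, j)\<close>, and \<open>a'\<close>, \<open>b'\<close> for those
      at \<open>(k, l)\<close>.\<close>
    have minor: "p * q * (a * b' - b * a') ^ 2 = 0"
      if "(p * (a * b) + q * (b * a)) * (p * (a' * b') + q * (b' * a'))
        = (p * (a * b') + q * (b * a')) * (p * (a' * b) + q * (b' * a))" for a b a' b' :: complex
    proof -
      have "p * q * (a * b' - b * a') ^ 2
        = (p * (a * b') + q * (b * a')) * (p * (a' * b) + q * (b' * a))
          - (p * (a * b) + q * (b * a)) * (p * (a' * b') + q * (b' * a'))"
        by (simp add: power2_eq_square algebra_simps)
      then show ?thesis using that by simp
    qed
    have "(G1 $$ (i, j) * G2 $$ (i, j)) * (G1 $$ (k, l) * G2 $$ (k, l))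
        = (G1 $$ (i, j) * G2 $$ (k, l)) * (G1 $$ (k, l) * G2 $$ (i, j))" by simp
    then have "p * q * (H1 $$ (i, j) * H2 $$ (k, l) - H2 $$ (i, j) * H1 $$ (k, l)) ^ 2 = 0"
      unfolding e[OF ijkl(1,2,1,2)] e[OF ijkl(3,4,3,4)] e[OF ijkl] e[OF ijkl(3,4,1,2)] by (rule minor)
    then have "p = 0 \<or> q = 0" using ne by simp
    then show ?thesis
    proof
      assume "q = 0"
      then have e': "G1 $$ (i, j) * G2 $$ (k, l) = p * (H1 $$ (i, j) * H2 $$ (k, l))"
        if "i < ?m" "j < ?m" "k < ?m" "l < ?m" for i j k l
        using e[OF that] by simp
      have "prop_pos G1 H1 \<and> prop_pos G2 H2"
        by (rule prop_pos_of_product[OF G H m pos e'])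
      then show ?thesis ..
    next
      assume "p = 0"
      then have e': "G1 $$ (i, j) * G2 $$ (k, l) = q * (H2 $$ (i, j) * H1 $$ (k, l))"
        if "i < ?m" "j < ?m" "k < ?m" "l < ?m" for i j k l
        using e[OF that] by simp
      have "prop_pos G1 H2 \<and> prop_pos G2 H1"
        by (rule prop_pos_of_product[OF G H(2,1) m _ e']) (use pos in blast)
      then show ?thesis ..
    qed
  qed
qed

section \<open>Inner products, conserved norms and the defect from a target line\<close>

definition cip :: "complex vec \<Rightarrow> complex vec \<Rightarrow> complex" where
  "cip u v = (\<Sum>a<dim_vec v. cnj (u $ a) * v $ a)"

definition sqn :: "complex vec \<Rightarrow> real" where
  "sqn v = (\<Sum>a<dim_vec v. (cmod (v $ a))\<^sup>2)"

lemma sqn_cip: "complex_of_real (sqn v) = cip v v"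
  unfolding sqn_def cip_def of_real_sum
  by (intro sum.cong refl) (metis complex_norm_square mult.commute)

lemma sqn_nonneg: "sqn v \<ge> 0"
  by (simp add: sqn_def sum_nonneg)

lemma sqn_eq_0_iff: "v \<in> carrier_vec m \<Longrightarrow> sqn v = 0 \<longleftrightarrow> v = 0\<^sub>v m"
  by (auto simp: sqn_def sum_nonneg_eq_0_iff vec_eq_iff)

lemma sqn_smult: "sqn (c \<cdot>\<^sub>v v) = (cmod c)\<^sup>2 * sqn v"
  by (simp add: sqn_def norm_mult power_mult_distrib sum_distrib_left)

lemma vnorm_sqn: "vnorm v = sqrt (sqn v)"
  by (simp add: vnorm_def sqn_def)

lemma cip_adjoint:
  assumes A: "A \<in> carrier_mat m k" and u: "u \<in> carrier_vec k" and v: "v \<in> carrier_vec m"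
  shows "cip (A *\<^sub>v u) v = cip u (mat_adjoint A *\<^sub>v v)"
proof -
  have dims: "dim_vec v = m" "dim_vec (mat_adjoint A *\<^sub>v v) = k"
    using v mat_adjoint_carrier[OF A] by auto
  have "cip (A *\<^sub>v u) v = (\<Sum>a<m. \<Sum>b<k. cnj (A $$ (a, b)) * cnj (u $ b) * v $ a)"
    unfolding cip_def dims
    by (intro sum.cong refl) (simp add: index_mult_mat_vec_sum[OF A u] sum_distrib_right del: index_mult_mat_vec)
  also have "\<dots> = (\<Sum>b<k. \<Sum>a<m. cnj (u $ b) * (cnj (A $$ (a, b)) * v $ a))"
    by (subst sum.swap) (simp add: mult_ac)
  also have "\<dots> = cip u (mat_adjoint A *\<^sub>v v)"
    unfolding cip_def dims
    by (intro sum.cong refl)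
       (simp add: index_mult_mat_vec_sum[OF mat_adjoint_carrier[OF A] v] sum_distrib_left mat_adjoint_index[OF A]
         del: index_mult_mat_vec)
  finally show ?thesis .
qed

lemma cip_add_right: "u \<in> carrier_vec m \<Longrightarrow> v \<in> carrier_vec m \<Longrightarrow> w \<in> carrier_vec m \<Longrightarrow>
  cip u (v + w) = cip u v + cip u w"
  by (simp add: cip_def sum.distrib distrib_left)

lemma sqn_mult:
  assumes A: "A \<in> carrier_mat m k" and u: "u \<in> carrier_vec k"
  shows "complex_of_real (sqn (A *\<^sub>v u)) = cip u ((mat_adjoint A * A) *\<^sub>v u)"
  unfolding sqn_cip cip_adjoint[OF A u mult_mat_vec_carrier[OF A u]]
    assoc_mult_mat_vec[OF mat_adjoint_carrier[OF A] A u] ..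

text \<open>Trace preservation in vector form: each summand is the expectation value of
  \<open>mat_adjoint K * K\<close> in \<open>u\<close>, and these operators sum to the
  identity.\<close>

lemma sum_sqn_kraus:
  assumes P: "wf_proto n D P" "D > 0" and u: "u \<in> carrier_vec (D ^ n)"
  shows "(\<Sum>K\<leftarrow>kraus n D P. sqn (K *\<^sub>v u)) = sqn u"
proof -
  let ?N = "D ^ n"
  have "complex_of_real (\<Sum>K\<leftarrow>Ks. sqn (K *\<^sub>v u)) = cip u (msum ?N (map (\<lambda>K. mat_adjoint K * K) Ks) *\<^sub>v u)"
    if "set Ks \<subseteq> carrier_mat ?N ?N" for Ks
    using that
  proof (induction Ks)
    case Nil
    then show ?case using u by (simp add: cip_def scalar_prod_def)
  next
    case (Cons K Ks)
    have K: "K \<in> carrier_mat ?N ?N" using Cons.prems by simp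
    note sq = mult_carrier_mat[OF mat_adjoint_carrier[OF K] K]
    have rest: "msum ?N (map (\<lambda>K. mat_adjoint K * K) Ks) \<in> carrier_mat ?N ?N"
      using Cons.prems by (intro msum_carrier) (auto intro!: mult_carrier_mat[of _ ?N ?N])
    show ?case
      using Cons
      by (simp add: sqn_mult[OF K u] add_mult_distrib_mat_vec[OF sq rest u]
          cip_add_right[OF u mult_mat_vec_carrier[OF sq u] mult_mat_vec_carrier[OF rest u]])
  qed
  from this[of "kraus n D P"] have "complex_of_real (\<Sum>K\<leftarrow>kraus n D P. sqn (K *\<^sub>v u)) = cip u (1\<^sub>m ?N *\<^sub>v u)"
    unfolding kraus_complete[OF P] using kraus_carrier[OF P] by blast
  then have "complex_of_real (\<Sum>K\<leftarrow>kraus n D P. sqn (K *\<^sub>v u)) = complex_of_real (sqn u)"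
    using u by (simp add: sqn_cip)
  then show ?thesis by (simp only: of_real_eq_iff)
qed

text \<open>\<open>defect y w\<close> vanishes iff \<open>y\<close> is a multiple of \<open>w \<noteq> 0\<close>; being linear in \<open>proj y\<close>, its sum
  over all branches of a protocol depends only on the output state of the channel.\<close>

definition defect :: "complex vec \<Rightarrow> complex vec \<Rightarrow> real" where
  "defect y w = (\<Sum>a<dim_vec w. \<Sum>b<dim_vec w. (cmod (y $ a * w $ b - y $ b * w $ a))\<^sup>2)"

text \<open>The expansion of the squared moduli in \<open>defect\<close>, with
  \<open>y $ a * cnj (y $ b)\<close> replaced by an arbitrary \<open>\<rho> a b\<close>. Being
  additive and continuous in \<open>\<rho>\<close>, it can be summed over branches and passed to
  limits.\<close>

definition defect_form :: "(nat \<Rightarrow> nat \<Rightarrow> complex) \<Rightarrow> complex vec \<Rightarrow> real" where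
  "defect_form \<rho> w = (\<Sum>a<dim_vec w. \<Sum>b<dim_vec w. Re (\<rho> a a * (w $ b * cnj (w $ b)) - \<rho> a b * (w $ b * cnj (w $ a))
     - \<rho> b a * (w $ a * cnj (w $ b)) + \<rho> b b * (w $ a * cnj (w $ a))))"

lemma defect_nonneg: "defect y w \<ge> 0"
  by (simp add: defect_def sum_nonneg)

text \<open>The summands of \<open>defect\<close> are squared 2 by 2 minors of the pair
  \<open>y\<close>, \<open>w\<close>; a nonzero entry of \<open>w\<close> supplies the
  factor.\<close>

lemma defect_eq_0D:
  assumes y: "y \<in> carrier_vec m" and w: "w \<in> carrier_vec m" "w \<noteq> 0\<^sub>v m" and z: "defect y w = 0"
  shows "\<exists>c. y = c \<cdot>\<^sub>v w"
proof -
  obtain b where b: "b < m" "w $ b \<noteq> 0" using w by (auto simp: vec_eq_iff)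
  have "y $ a * w $ b = y $ b * w $ a" if "a < m" for a
    using z that b(1) w(1) by (simp add: defect_def sum_nonneg_eq_0_iff sum_nonneg)
  then have "y = (y $ b / w $ b) \<cdot>\<^sub>v w" using y w(1) b by (intro eq_vecI) (auto simp: field_simps)
  then show ?thesis ..
qed

lemma defect_smult_left:
  assumes "y \<in> carrier_vec m" "w \<in> carrier_vec m"
  shows "defect (c \<cdot>\<^sub>v y) w = (cmod c)\<^sup>2 * defect y w"
proof -
  have "(cmod ((c \<cdot>\<^sub>v y) $ a * w $ b - (c \<cdot>\<^sub>v y) $ b * w $ a))\<^sup>2 = (cmod c)\<^sup>2 * (cmod (y $ a * w $ b - y $ b * w $ a))\<^sup>2"
    if "a < m" "b < m" for a b
  proof -
    have "(c \<cdot>\<^sub>v y) $ a * w $ b - (c \<cdot>\<^sub>v y) $ b * w $ a = c * (y $ a * w $ b - y $ b * w $ a)"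
      using assms that by (simp add: algebra_simps)
    then show ?thesis by (simp add: norm_mult power_mult_distrib)
  qed
  then show ?thesis using assms by (simp add: defect_def sum_distrib_left)
qed

lemma defect_eq_form: "defect y w = defect_form (\<lambda>a b. y $ a * cnj (y $ b)) w"
  unfolding defect_def defect_form_def
proof (intro sum.cong refl)
  fix a b
  have "complex_of_real ((cmod (y $ a * w $ b - y $ b * w $ a))\<^sup>2)
      = y $ a * cnj (y $ a) * (w $ b * cnj (w $ b)) - y $ a * cnj (y $ b) * (w $ b * cnj (w $ a))
      - y $ b * cnj (y $ a) * (w $ a * cnj (w $ b)) + y $ b * cnj (y $ b) * (w $ a * cnj (w $ a))"
    unfolding complex_norm_square by (simp add: algebra_simps)
  then show "(cmod (y $ a * w $ b - y $ b * w $ a))\<^sup>2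
      = Re (y $ a * cnj (y $ a) * (w $ b * cnj (w $ b)) - y $ a * cnj (y $ b) * (w $ b * cnj (w $ a))
      - y $ b * cnj (y $ a) * (w $ a * cnj (w $ b)) + y $ b * cnj (y $ b) * (w $ a * cnj (w $ a)))"
    by (metis Re_complex_of_real)
qed

lemma defect_form_add: "defect_form (\<lambda>a b. \<rho> a b + \<sigma> a b) w = defect_form \<rho> w + defect_form \<sigma> w"
  unfolding defect_form_def sum.distrib[symmetric]
  by (intro sum.cong refl) (simp add: algebra_simps)

lemma sum_list_defect:
  "(\<Sum>y\<leftarrow>ys. defect y w) = defect_form (\<lambda>a b. \<Sum>y\<leftarrow>ys. y $ a * cnj (y $ b)) w"
proof (induction ys)
  case Nil
  then show ?case by (simp add: defect_form_def)
next
  case (Cons y ys)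
  then show ?case by (simp add: defect_form_add defect_eq_form[of y])
qed

lemma defect_form_cong:
  assumes "w \<in> carrier_vec m" "\<And>a b. a < m \<Longrightarrow> b < m \<Longrightarrow> \<rho> a b = \<sigma> a b"
  shows "defect_form \<rho> w = defect_form \<sigma> w"
  unfolding defect_form_def using assms by (intro sum.cong refl) auto

text \<open>Trades the individual branches for the channel output, the only thing about which a
  transformation makes an assumption.\<close>

lemma sum_defect_kraus:
  assumes P: "wf_proto n D P" "D > 0" and u: "u \<in> carrier_vec (D ^ n)" and w: "w \<in> carrier_vec (D ^ n)"
  shows "(\<Sum>K\<leftarrow>kraus n D P. defect (K *\<^sub>v u) w) = defect_form (\<lambda>a b. channel n D P (proj u) $$ (a, b)) w"
proof -
  have "(\<Sum>K\<leftarrow>kraus n D P. defect (K *\<^sub>v u) w) = (\<Sum>y\<leftarrow>map (\<lambda>K. K *\<^sub>v u) (kraus n D P). defect y w)"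
    by (simp add: o_def)
  also have "\<dots> = defect_form (\<lambda>a b. \<Sum>y\<leftarrow>map (\<lambda>K. K *\<^sub>v u) (kraus n D P). y $ a * cnj (y $ b)) w"
    by (rule sum_list_defect)
  also have "\<dots> = defect_form (\<lambda>a b. channel n D P (proj u) $$ (a, b)) w"
    by (rule defect_form_cong[OF w]) (simp add: channel_proj_index[OF P u] o_def)
  finally show ?thesis .
qed

lemma defect_form_proj:
  assumes w: "w \<in> carrier_vec m"
  shows "defect_form (\<lambda>a b. proj (c \<cdot>\<^sub>v w) $$ (a, b)) w = 0"
proof -
  have "defect_form (\<lambda>a b. proj (c \<cdot>\<^sub>v w) $$ (a, b)) w = defect_form (\<lambda>a b. (c \<cdot>\<^sub>v w) $ a * cnj ((c \<cdot>\<^sub>v w) $ b)) w"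
    by (rule defect_form_cong[OF w]) (use w in \<open>simp add: proj_def\<close>)
  also have "\<dots> = (cmod c)\<^sup>2 * defect w w"
    unfolding defect_eq_form[symmetric] by (rule defect_smult_left[OF w w])
  also have "defect w w = 0" by (simp add: defect_def mult.commute)
  finally show ?thesis by simp
qed

lemma msum_mixture:
  assumes X: "X \<in> carrier_mat N N" and Y: "Y \<in> carrier_mat N N"
    and "\<And>M. M \<in> set Ms \<Longrightarrow> \<exists>p q. M = p \<cdot>\<^sub>m X + q \<cdot>\<^sub>m Y"
  shows "\<exists>p q. msum N Ms = p \<cdot>\<^sub>m X + q \<cdot>\<^sub>m Y"
  using assms(3)
proof (induction Ms)
  case Nil
  have "0\<^sub>m N N = 0 \<cdot>\<^sub>m X + 0 \<cdot>\<^sub>m Y" using X Y by (intro eq_matI) auto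
  then show ?case by auto
next
  case (Cons M Ms)
  then obtain p q p' q' where "M = p \<cdot>\<^sub>m X + q \<cdot>\<^sub>m Y" "msum N Ms = p' \<cdot>\<^sub>m X + q' \<cdot>\<^sub>m Y"
    by (metis list.set_intros)
  then have "msum N (M # Ms) = (p + p') \<cdot>\<^sub>m X + (q + q') \<cdot>\<^sub>m Y"
    using X Y by (intro eq_matI) (auto simp: algebra_simps)
  then show ?case by blast
qed

lemma mat_adjoint_smult:
  fixes A :: "complex mat"
  assumes A: "A \<in> carrier_mat m k"
  shows "mat_adjoint (c \<cdot>\<^sub>m A) = cnj c \<cdot>\<^sub>m mat_adjoint A"
proof -
  have cA: "c \<cdot>\<^sub>m A \<in> carrier_mat m k" using A by simp
  show ?thesis
    using carrier_matD[OF mat_adjoint_carrier[OF cA]] carrier_matD[OF mat_adjoint_carrier[OF A]] A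
    by (intro eq_matI) (simp_all add: mat_adjoint_index[OF A] mat_adjoint_index[OF cA])
qed

lemma gram_smult:
  fixes A :: "complex mat"
  assumes A: "A \<in> carrier_mat m k"
  shows "mat_adjoint (c \<cdot>\<^sub>m A) * (c \<cdot>\<^sub>m A) = (cnj c * c) \<cdot>\<^sub>m (mat_adjoint A * A)"
  unfolding mat_adjoint_smult[OF A] using A mat_adjoint_carrier[OF A]
  by (simp add: mult_smult_distrib[of _ k m _ k] mult_smult_assoc_mat[of _ k m _ k] smult_smult_mat mult.commute)

text \<open>The corner entry of a Gram matrix is the squared norm of the first column, which is
  nonzero for an invertible matrix.\<close>

lemma gram_corner_pos:
  assumes d: "d > 0" and A: "local_invertible n d A"
  shows "\<exists>r>0. (mat_adjoint (ltensor n d A) * ltensor n d A) $$ (0, 0) = complex_of_real r"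
proof -
  let ?L = "ltensor n d A" and ?m = "d ^ n"
  obtain C where C: "ltensor n d C * ?L = 1\<^sub>m ?m"
    by (rule local_invertible_inverse[OF d A]) (rule that; assumption)
  have m: "0 < ?m" using d by simp
  define r where "r = (\<Sum>t<?m. (cmod (?L $$ (t, 0)))\<^sup>2)"
  have "(mat_adjoint ?L * ?L) $$ (0, 0) = (\<Sum>t<?m. cnj (?L $$ (t, 0)) * ?L $$ (t, 0))"
    unfolding index_mult_mat_sum[OF mat_adjoint_carrier[OF ltensor_carrier] ltensor_carrier m m]
    by (intro sum.cong refl) (simp add: mat_adjoint_index[OF ltensor_carrier m])
  also have "\<dots> = complex_of_real r"
    unfolding r_def of_real_sum
    by (intro sum.cong refl) (metis complex_norm_square mult.commute)
  finally have e: "(mat_adjoint ?L * ?L) $$ (0, 0) = complex_of_real r" .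
  have "r \<noteq> 0"
  proof
    assume "r = 0"
    then have z: "?L $$ (t, 0) = 0" if "t < ?m" for t
      using that by (auto simp: r_def sum_nonneg_eq_0_iff)
    have "(1 :: complex) = (ltensor n d C * ?L) $$ (0, 0)" unfolding C using m by simp
    also have "\<dots> = 0" unfolding index_mult_mat_sum[OF ltensor_carrier ltensor_carrier m m] using z by simp
    finally show False by simp
  qed
  moreover have "r \<ge> 0" by (simp add: r_def sum_nonneg)
  ultimately show ?thesis using e by (intro exI[of _ r]) auto
qed

lemma gram_tensor2:
  assumes d: "d > 0" and X: "X \<in> carrier_mat (d ^ n) (d ^ n)" and Y: "Y \<in> carrier_mat (d ^ n) (d ^ n)"
  shows "mat_adjoint (tensor2 n d X Y) * tensor2 n d X Y
    = tensor2 n d (mat_adjoint X * X) (mat_adjoint Y * Y)"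
  unfolding tensor2_adjoint[OF d X Y]
  by (rule tensor2_mult[OF d mat_adjoint_carrier[OF X] X mat_adjoint_carrier[OF Y] Y])

text \<open>Conjugation by the swap exchanges the copies: moving one swap through the tensor product
  brings it next to the other, and they cancel. This is the source of the reversed term in the
  mixture.\<close>

lemma gram_mult_SWAP_all:
  assumes d: "d > 0" and X: "X \<in> carrier_mat (d ^ n) (d ^ n)" and Y: "Y \<in> carrier_mat (d ^ n) (d ^ n)"
  shows "mat_adjoint (tensor2 n d X Y * SWAP_all n d) * (tensor2 n d X Y * SWAP_all n d)
    = tensor2 n d (mat_adjoint Y * Y) (mat_adjoint X * X)"
proof -
  let ?T = "tensor2 n d X Y" and ?S = "SWAP_all n d" and ?N = "(d ^ 2) ^ n"
  have T: "mat_adjoint ?T * ?T \<in> carrier_mat ?N ?N"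
    by (rule mult_carrier_mat[OF mat_adjoint_carrier[OF tensor2_carrier] tensor2_carrier])
  have "mat_adjoint (?T * ?S) * (?T * ?S) = ?S * (mat_adjoint ?T * ?T) * ?S"
    unfolding mat_adjoint_mult[OF tensor2_carrier SWAP_all_carrier] SWAP_all_adjoint[OF d]
    using mat_adjoint_carrier[OF tensor2_carrier[of n d X Y]]
    by (simp add: assoc_mult_mat[of _ ?N ?N _ ?N _ ?N] mult_carrier_mat[of _ ?N ?N])
  also have "\<dots> = tensor2 n d (mat_adjoint Y * Y) (mat_adjoint X * X) * (?S * ?S)"
    unfolding gram_tensor2[OF d X Y] SWAP_all_tensor2[OF d]
    by (rule assoc_mult_mat[OF tensor2_carrier SWAP_all_carrier SWAP_all_carrier])
  also have "\<dots> = tensor2 n d (mat_adjoint Y * Y) (mat_adjoint X * X)"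
    unfolding SWAP_all_involution[OF d] by (rule right_mult_one_mat[OF tensor2_carrier])
  finally show ?thesis .
qed

section \<open>Branches of a finite protocol and the Gram identity\<close>

context two_copy_state
begin

lemma loc_tensor2: "loc (\<lambda>i. tensor2 1 d (A i) (B i)) = tensor2 n d (ltensor n d A) (ltensor n d B)"
  by (rule tensor2_ltensor[OF d_pos, symmetric])

lemma two_copy_loc:
  "two_copy n d (ltensor n d A *\<^sub>v v) (ltensor n d B *\<^sub>v v) = loc (\<lambda>i. tensor2 1 d (A i) (B i)) *\<^sub>v Psi"
  unfolding loc_tensor2 by (rule tensor2_mult_two_copy[OF d_pos ltensor_carrier v ltensor_carrier v, symmetric])

lemma normalize_smult:
  assumes "local_invertible n D B"
  obtains c where "c > 0" "normalize (loc B *\<^sub>v Psi) = complex_of_real c \<cdot>\<^sub>v (loc B *\<^sub>v Psi)"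
proof
  show "normalize (loc B *\<^sub>v Psi) = complex_of_real (1 / vnorm (loc B *\<^sub>v Psi)) \<cdot>\<^sub>v (loc B *\<^sub>v Psi)"
    by (simp add: normalize_def)
  have "sqn (loc B *\<^sub>v Psi) \<noteq> 0"
    using loc_Psi_nonzero[OF assms] sqn_eq_0_iff[OF loc_Psi_carrier] by blast
  then show "1 / vnorm (loc B *\<^sub>v Psi) > 0"
    using sqn_nonneg[of "loc B *\<^sub>v Psi"] by (simp add: vnorm_sqn)
qed

text \<open>The branch defects are nonnegative and sum to the value of \<open>defect_form\<close> at
  the output, which is zero for the projector onto the target. So each branch vector lies on the
  target line, possibly at zero.\<close>

lemma LOCCN_branches:
  assumes P: "wf_proto n D P" and B: "local_invertible n D B" and C: "local_invertible n D C"
    and ch: "channel n D P (proj (normalize (loc B *\<^sub>v Psi))) = proj (normalize (loc C *\<^sub>v Psi))"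
    and K: "K \<in> set (kraus n D P)"
  shows "\<exists>c. K *\<^sub>v (loc B *\<^sub>v Psi) = c \<cdot>\<^sub>v (loc C *\<^sub>v Psi)"
proof -
  let ?u = "loc B *\<^sub>v Psi" and ?w = "loc C *\<^sub>v Psi"
  obtain \<alpha> where \<alpha>: "\<alpha> > 0" "normalize ?u = complex_of_real \<alpha> \<cdot>\<^sub>v ?u" by (rule normalize_smult[OF B])
  obtain \<beta> where \<beta>: "normalize ?w = complex_of_real \<beta> \<cdot>\<^sub>v ?w" by (rule normalize_smult[OF C])
  have u': "complex_of_real \<alpha> \<cdot>\<^sub>v ?u \<in> carrier_vec N" by simp
  have "(\<Sum>K\<leftarrow>kraus n D P. defect (K *\<^sub>v (complex_of_real \<alpha> \<cdot>\<^sub>v ?u)) ?w) = 0"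
    unfolding sum_defect_kraus[OF P D_pos u' loc_Psi_carrier] ch[unfolded \<alpha>(2) \<beta>]
    by (rule defect_form_proj[OF loc_Psi_carrier])
  then have "defect (K *\<^sub>v (complex_of_real \<alpha> \<cdot>\<^sub>v ?u)) ?w = 0"
    using K by (subst (asm) sum_list_nonneg_eq_0_iff) (auto simp: defect_nonneg)
  then have "\<exists>c. K *\<^sub>v (complex_of_real \<alpha> \<cdot>\<^sub>v ?u) = c \<cdot>\<^sub>v ?w"
    by (intro defect_eq_0D[OF _ loc_Psi_carrier loc_Psi_nonzero[OF C]])
       (rule mult_mat_vec_carrier[OF kraus_carrier[OF P D_pos K] u'])
  then obtain c where "complex_of_real \<alpha> \<cdot>\<^sub>v (K *\<^sub>v ?u) = c \<cdot>\<^sub>v ?w"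
    using mult_mat_vec[OF kraus_carrier[OF P D_pos K] loc_Psi_carrier] by metis
  then have "(complex_of_real (1 / \<alpha>)) \<cdot>\<^sub>v (complex_of_real \<alpha> \<cdot>\<^sub>v (K *\<^sub>v ?u)) = (complex_of_real (1 / \<alpha>) * c) \<cdot>\<^sub>v ?w"
    by (simp add: smult_smult_assoc)
  then have "K *\<^sub>v ?u = (complex_of_real (1 / \<alpha>) * c) \<cdot>\<^sub>v ?w"
    unfolding smult_smult_assoc of_real_mult[symmetric] using \<alpha>(1) by simp
  then show ?thesis ..
qed

lemma LOCCN_imp_prop_pos:
  assumes g1: "local_invertible n d g1" and g2: "local_invertible n d g2"
    and h1: "local_invertible n d h1" and h2: "local_invertible n d h2"
    and trans: "LOCCN_trans n D (two_copy n d (ltensor n d g1 *\<^sub>v v) (ltensor n d g2 *\<^sub>v v))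
      (two_copy n d (ltensor n d h1 *\<^sub>v v) (ltensor n d h2 *\<^sub>v v))"
  defines "G1 \<equiv> mat_adjoint (ltensor n d g1) * ltensor n d g1"
    and "G2 \<equiv> mat_adjoint (ltensor n d g2) * ltensor n d g2"
    and "H1 \<equiv> mat_adjoint (ltensor n d h1) * ltensor n d h1"
    and "H2 \<equiv> mat_adjoint (ltensor n d h2) * ltensor n d h2"
  shows "(prop_pos G1 H1 \<and> prop_pos G2 H2) \<or> (prop_pos G1 H2 \<and> prop_pos G2 H1)"
proof -
  define g where "g i = tensor2 1 d (g1 i) (g2 i)" for i
  define h where "h i = tensor2 1 d (h1 i) (h2 i)" for i
  have g: "local_invertible n D g" unfolding g_def by (rule tensor2_local_invertible[OF d_pos g1 g2])
  have h: "local_invertible n D h" unfolding h_def by (rule tensor2_local_invertible[OF d_pos h1 h2])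
  have lg: "loc g = tensor2 n d (ltensor n d g1) (ltensor n d g2)" unfolding g_def by (rule loc_tensor2)
  have lh: "loc h = tensor2 n d (ltensor n d h1) (ltensor n d h2)" unfolding h_def by (rule loc_tensor2)
  obtain P where P: "wf_proto n D P"
    and ch: "channel n D P (proj (normalize (loc g *\<^sub>v Psi))) = proj (normalize (loc h *\<^sub>v Psi))"
    using trans unfolding LOCCN_trans_def two_copy_loc g_def h_def by blast
  note branch = LOCCN_branches[OF P g h ch]
  have gl: "local_op n D (loc g)" using local_op_ltensor local_invertible_carrier[OF g] by blast
  let ?X = "tensor2 n d H1 H2" and ?Y = "tensor2 n d H2 H1"
  have gram: "\<exists>p q. mat_adjoint (K * loc g) * (K * loc g) = p \<cdot>\<^sub>m ?X + q \<cdot>\<^sub>m ?Y"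
    if K: "K \<in> set (kraus n D P)" for K
  proof -
    note Kc = kraus_carrier[OF P D_pos K]
    obtain c where c: "K *\<^sub>v (loc g *\<^sub>v Psi) = c \<cdot>\<^sub>v (loc h *\<^sub>v Psi)" using branch[OF K] by blast
    have smults: "a \<cdot>\<^sub>m ?X = a \<cdot>\<^sub>m ?X + 0 \<cdot>\<^sub>m ?Y" "a \<cdot>\<^sub>m ?Y = 0 \<cdot>\<^sub>m ?X + a \<cdot>\<^sub>m ?Y" for a
      by (rule eq_matI; simp)+
    show ?thesis
    proof (cases "c = 0")
      case True
      have z: "K *\<^sub>v (loc g *\<^sub>v Psi) = 0\<^sub>v N" unfolding c True by (auto simp: vec_eq_iff)
      \<comment> \<open>\<open>z\<close> concerns one vector only, whereas the sum of Gram operators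
        needs the whole operator to vanish.\<close>
      have "K = 0\<^sub>m N N" by (rule kraus_eq_0[OF P g h branch K z])
      then have "K * loc g = 0\<^sub>m N N" using left_mult_zero_mat[OF ltensor_carrier] by simp
      then have "mat_adjoint (K * loc g) * (K * loc g) = 0\<^sub>m N N"
        using right_mult_zero_mat[OF mat_adjoint_carrier[OF zero_carrier_mat[of N N]]] by simp
      also have "\<dots> = 0 \<cdot>\<^sub>m ?X + 0 \<cdot>\<^sub>m ?Y" by (rule eq_matI) simp_all
      finally show ?thesis by blast
    next
      case False
      have "(K * loc g) *\<^sub>v Psi = c \<cdot>\<^sub>v (loc h *\<^sub>v Psi)"
        using c assoc_mult_mat_vec[OF Kc ltensor_carrier two_copy_carrier] by simp
      then consider "K * loc g = c \<cdot>\<^sub>m loc h" | "K * loc g = c \<cdot>\<^sub>m (loc h * S)"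
        using local_stabilizer_cases[OF local_op_mult[OF D_pos kraus_local_op[OF P D_pos K] gl] h _ False] by blast
      then show ?thesis
      proof cases
        case 1
        have "mat_adjoint (K * loc g) * (K * loc g) = (cnj c * c) \<cdot>\<^sub>m ?X"
          unfolding 1 lh gram_smult[OF tensor2_carrier] gram_tensor2[OF d_pos ltensor_carrier ltensor_carrier] H1_def H2_def ..
        then show ?thesis using smults by metis
      next
        case 2
        have "mat_adjoint (K * loc g) * (K * loc g) = (cnj c * c) \<cdot>\<^sub>m ?Y"
          unfolding 2 lh gram_smult[OF mult_carrier_mat[OF tensor2_carrier SWAP_all_carrier]]
            gram_mult_SWAP_all[OF d_pos ltensor_carrier ltensor_carrier] H1_def H2_def ..
        then show ?thesis using smults by metis
      qed
    qed
  qed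
  have gadj: "mat_adjoint (loc g) \<in> carrier_mat N N" by (rule mat_adjoint_carrier[OF ltensor_carrier])
  \<comment> \<open>Completeness, sandwiched between \<open>loc g\<close> and its adjoint, writes
    the Gram operator of \<open>g\<close> as the sum of the Gram operators of the branches.\<close>
  have "mat_adjoint (loc g) * loc g
      = mat_adjoint (loc g) * msum N (map (\<lambda>K. mat_adjoint K * K) (kraus n D P)) * loc g"
    unfolding kraus_complete[OF P D_pos] right_mult_one_mat[OF gadj] ..
  also have "\<dots> = msum N (map (\<lambda>M. mat_adjoint (loc g) * M * loc g) (map (\<lambda>K. mat_adjoint K * K) (kraus n D P)))"
    by (rule msum_sandwich[OF gadj ltensor_carrier])
       (use kraus_carrier[OF P D_pos] in \<open>auto intro!: mult_carrier_mat[of _ N N]\<close>)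
  also have "map (\<lambda>M. mat_adjoint (loc g) * M * loc g) (map (\<lambda>K. mat_adjoint K * K) (kraus n D P))
      = map (\<lambda>K. mat_adjoint (K * loc g) * (K * loc g)) (kraus n D P)"
  proof -
    have "mat_adjoint (loc g) * (mat_adjoint K * K) * loc g = mat_adjoint (K * loc g) * (K * loc g)"
      if K: "K \<in> set (kraus n D P)" for K
    proof -
      note Kc = kraus_carrier[OF P D_pos K]
      show ?thesis
        unfolding mat_adjoint_mult[OF Kc ltensor_carrier]
        using Kc mat_adjoint_carrier[OF Kc] gadj
        by (simp add: assoc_mult_mat[of _ N N _ N _ N] mult_carrier_mat[of _ N N])
    qed
    then show ?thesis by simp
  qed
  finally have "mat_adjoint (loc g) * loc g = msum N (map (\<lambda>K. mat_adjoint (K * loc g) * (K * loc g)) (kraus n D P))" .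
  moreover have "\<exists>p q. msum N (map (\<lambda>K. mat_adjoint (K * loc g) * (K * loc g)) (kraus n D P)) = p \<cdot>\<^sub>m ?X + q \<cdot>\<^sub>m ?Y"
    by (rule msum_mixture[OF tensor2_carrier tensor2_carrier]) (use gram in auto)
  ultimately obtain p q where "tensor2 n d G1 G2 = p \<cdot>\<^sub>m ?X + q \<cdot>\<^sub>m ?Y"
    unfolding lg gram_tensor2[OF d_pos ltensor_carrier ltensor_carrier] G1_def G2_def by auto
  then show ?thesis
  proof (rule tensor2_mixture_imp_prop_pos[OF d_pos, rotated -1])
    show "G1 \<in> carrier_mat (d ^ n) (d ^ n)" "G2 \<in> carrier_mat (d ^ n) (d ^ n)"
      "H1 \<in> carrier_mat (d ^ n) (d ^ n)" "H2 \<in> carrier_mat (d ^ n) (d ^ n)"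
      unfolding G1_def G2_def H1_def H2_def
      by (rule mult_carrier_mat[OF mat_adjoint_carrier[OF ltensor_carrier] ltensor_carrier])+
    show "\<exists>r>0. M $$ (0, 0) = complex_of_real r" if "M \<in> {G1, G2, H1, H2}" for M
      using that gram_corner_pos[OF d_pos] g1 g2 h1 h2 unfolding G1_def G2_def H1_def H2_def by blast
  qed
qed

end

section \<open>Arbitrary LOCC\<close>

lemma bounded_complex_subseq:
  fixes f :: "nat \<Rightarrow> complex"
  assumes "\<And>k. cmod (f k) \<le> 1"
  obtains r L where "strict_mono r" "(\<lambda>k. f (r k)) \<longlonglongrightarrow> L"
proof -
  obtain r1 where r1: "strict_mono r1" "monoseq (\<lambda>k. Re (f (r1 k)))"
    using seq_monosub[of "\<lambda>k. Re (f k)"] by blast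
  have "Bseq (\<lambda>k. Re (f (r1 k)))"
    by (rule BseqI'[of _ 1]) (use assms abs_Re_le_cmod order_trans in \<open>auto, blast\<close>)
  then obtain a where a: "(\<lambda>k. Re (f (r1 k))) \<longlonglongrightarrow> a"
    using Bseq_monoseq_convergent r1(2) convergent_def by blast
  obtain r2 where r2: "strict_mono r2" "monoseq (\<lambda>k. Im (f (r1 (r2 k))))"
    using seq_monosub[of "\<lambda>k. Im (f (r1 k))"] by blast
  have "Bseq (\<lambda>k. Im (f (r1 (r2 k))))"
    by (rule BseqI'[of _ 1]) (use assms abs_Im_le_cmod order_trans in \<open>auto, blast\<close>)
  then obtain b where b: "(\<lambda>k. Im (f (r1 (r2 k)))) \<longlonglongrightarrow> b"
    using Bseq_monoseq_convergent r2(2) convergent_def by blast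
  have "(\<lambda>k. Re (f (r1 (r2 k)))) \<longlonglongrightarrow> a"
    using LIMSEQ_subseq_LIMSEQ[OF a r2(1)] by (simp add: o_def)
  with b have "(\<lambda>k. Complex (Re (f (r1 (r2 k)))) (Im (f (r1 (r2 k))))) \<longlonglongrightarrow> Complex a b"
    by (intro tendsto_Complex)
  then show thesis
    using that[of "r1 \<circ> r2" "Complex a b"] strict_mono_o[OF r1(1) r2(1)] by simp
qed

text \<open>Successive refinement: a further subsequence for the new coordinate keeps the limits
  already found.\<close>

lemma bounded_family_subseq:
  fixes f :: "nat \<Rightarrow> 'i \<Rightarrow> complex"
  assumes "finite I" "\<And>k i. i \<in> I \<Longrightarrow> cmod (f k i) \<le> 1"
  shows "\<exists>r L. strict_mono r \<and> (\<forall>i\<in>I. (\<lambda>k. f (r k) i) \<longlonglongrightarrow> L i)"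
  using assms
proof (induction I rule: finite_induct)
  case empty
  then show ?case using strict_mono_id by blast
next
  case (insert j I)
  have "\<exists>r L. strict_mono r \<and> (\<forall>i\<in>I. (\<lambda>k. f (r k) i) \<longlonglongrightarrow> L i)"
    using insert.IH insert.prems by simp
  then obtain r L where r: "strict_mono r" "\<And>i. i \<in> I \<Longrightarrow> (\<lambda>k. f (r k) i) \<longlonglongrightarrow> L i" by blast
  obtain s l where s: "strict_mono s" "(\<lambda>k. f (r (s k)) j) \<longlonglongrightarrow> l"
    using bounded_complex_subseq[of "\<lambda>k. f (r k) j"] insert.prems by auto
  have "(\<lambda>k. f ((r \<circ> s) k) i) \<longlonglongrightarrow> (L(j := l)) i" if "i \<in> insert j I" for i
  proof (cases "i = j")
    case False
    then have "i \<in> I" using that by simp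
    from LIMSEQ_subseq_LIMSEQ[OF r(2)[OF this] s(1)] False show ?thesis by (simp add: o_def)
  qed (use s in simp)
  then show ?case using strict_mono_o[OF r(1) s(1)] by blast
qed

text \<open>The squared Frobenius norm. Without the root it is additive over columns and, like
  \<open>sqn\<close>, conserved by a protocol.\<close>

definition frob :: "complex mat \<Rightarrow> real" where
  "frob M = (\<Sum>b<dim_col M. \<Sum>a<dim_row M. (cmod (M $$ (a, b)))\<^sup>2)"

lemma frob_nonneg: "frob M \<ge> 0"
  by (simp add: frob_def sum_nonneg)

lemma frob_eq_0_iff: "M \<in> carrier_mat m k \<Longrightarrow> frob M = 0 \<longleftrightarrow> M = 0\<^sub>m m k"
  by (auto simp: frob_def sum_nonneg_eq_0_iff sum_nonneg intro!: eq_matI)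

lemma frob_smult: "frob (c \<cdot>\<^sub>m M) = (cmod c)\<^sup>2 * frob M"
  by (simp add: frob_def norm_mult power_mult_distrib sum_distrib_left)

lemma cmod_index_le_frob:
  assumes "M \<in> carrier_mat m k" "a < m" "b < k"
  shows "(cmod (M $$ (a, b)))\<^sup>2 \<le> frob M"
proof -
  have "(cmod (M $$ (a, b)))\<^sup>2 \<le> (\<Sum>a<m. (cmod (M $$ (a, b)))\<^sup>2)"
    using assms by (intro member_le_sum) auto
  also have "\<dots> \<le> frob M"
    unfolding frob_def carrier_matD[OF assms(1)] using assms(3)
    by (intro member_le_sum[of b "{..<k}" "\<lambda>b. \<Sum>a<m. (cmod (M $$ (a, b)))\<^sup>2"]) (auto intro: sum_nonneg)
  finally show ?thesis .
qed

lemma frob_columns: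
  assumes "M \<in> carrier_mat m k"
  shows "frob M = (\<Sum>b<k. sqn (M *\<^sub>v unit_vec k b))"
proof -
  have "(M *\<^sub>v unit_vec k b) $ a = M $$ (a, b)" if "a < m" "b < k" for a b
    using that assms by (simp add: index_mult_mat_vec_sum[OF assms _ that(1)] unit_vec_def if_distrib
        del: index_mult_mat_vec cong: if_cong)
  then show ?thesis using assms by (simp add: frob_def sqn_def)
qed

lemma sum_list_sum_swap: "(\<Sum>x\<leftarrow>xs. \<Sum>b\<in>B. f x b) = (\<Sum>b\<in>B. \<Sum>x\<leftarrow>xs. f x b :: real)"
  by (induction xs) (simp_all add: sum.distrib)

text \<open>Conservation of squared norms, applied to each column of \<open>M\<close>.\<close>

lemma sum_frob_kraus:
  assumes P: "wf_proto n D P" "D > 0" and M: "M \<in> carrier_mat (D ^ n) (D ^ n)"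
  shows "(\<Sum>K\<leftarrow>kraus n D P. frob (K * M)) = frob M"
proof -
  let ?N = "D ^ n"
  have "(\<Sum>K\<leftarrow>kraus n D P. frob (K * M)) = (\<Sum>K\<leftarrow>kraus n D P. \<Sum>b<?N. sqn (K *\<^sub>v (M *\<^sub>v unit_vec ?N b)))"
  proof (intro arg_cong[of _ _ sum_list] map_cong refl)
    fix K assume K: "K \<in> set (kraus n D P)"
    note Kc = kraus_carrier[OF P K]
    show "frob (K * M) = (\<Sum>b<?N. sqn (K *\<^sub>v (M *\<^sub>v unit_vec ?N b)))"
      unfolding frob_columns[OF mult_carrier_mat[OF Kc M]]
      by (simp add: assoc_mult_mat_vec[OF Kc M])
  qed
  also have "\<dots> = (\<Sum>b<?N. sqn (M *\<^sub>v unit_vec ?N b))"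
    unfolding sum_list_sum_swap
    by (intro sum.cong refl sum_sqn_kraus[OF P] mult_mat_vec_carrier[OF M]) simp
  finally show ?thesis unfolding frob_columns[OF M] .
qed

section \<open>Entrywise limits of the quadratic quantities\<close>

lemma frob_tendsto:
  assumes M: "\<And>k. M k \<in> carrier_mat m m'" "L \<in> carrier_mat m m'"
    and lim: "\<And>a b. a < m \<Longrightarrow> b < m' \<Longrightarrow> (\<lambda>k. M k $$ (a, b)) \<longlonglongrightarrow> L $$ (a, b)"
  shows "(\<lambda>k. frob (M k)) \<longlonglongrightarrow> frob L"
proof -
  have e: "frob X = (\<Sum>b<m'. \<Sum>a<m. (cmod (X $$ (a, b)))\<^sup>2)" if "X \<in> carrier_mat m m'" for X
    using that by (simp add: frob_def)
  show ?thesis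
    unfolding e[OF M(1)] e[OF M(2)]
    by (intro tendsto_sum tendsto_power tendsto_norm lim) auto
qed

lemma mult_mat_vec_tendsto:
  fixes M :: "nat \<Rightarrow> complex mat"
  assumes M: "\<And>k. M k \<in> carrier_mat m m'" "L \<in> carrier_mat m m'" and x: "x \<in> carrier_vec m'"
    and lim: "\<And>a b. a < m \<Longrightarrow> b < m' \<Longrightarrow> (\<lambda>k. M k $$ (a, b)) \<longlonglongrightarrow> L $$ (a, b)" and a: "a < m"
  shows "(\<lambda>k. (M k *\<^sub>v x) $ a) \<longlonglongrightarrow> (L *\<^sub>v x) $ a"
  unfolding index_mult_mat_vec_sum[OF M(1) x a] index_mult_mat_vec_sum[OF M(2) x a]
  by (intro tendsto_sum tendsto_mult tendsto_const lim a) auto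

lemma sqn_tendsto:
  assumes y: "\<And>k. y k \<in> carrier_vec m" "z \<in> carrier_vec m"
    and lim: "\<And>a. a < m \<Longrightarrow> (\<lambda>k. y k $ a) \<longlonglongrightarrow> z $ a"
  shows "(\<lambda>k. sqn (y k)) \<longlonglongrightarrow> sqn z"
proof -
  have e: "sqn x = (\<Sum>a<m. (cmod (x $ a))\<^sup>2)" if "x \<in> carrier_vec m" for x
    using that by (simp add: sqn_def)
  show ?thesis
    unfolding e[OF y(1)] e[OF y(2)] by (intro tendsto_sum tendsto_power tendsto_norm lim) auto
qed

lemma defect_tendsto:
  assumes w: "w \<in> carrier_vec m" and lim: "\<And>a. a < m \<Longrightarrow> (\<lambda>k. y k $ a) \<longlonglongrightarrow> z $ a"
  shows "(\<lambda>k. defect (y k) w) \<longlonglongrightarrow> defect z w"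
  unfolding defect_def
  using w by (intro tendsto_sum tendsto_power tendsto_norm tendsto_diff tendsto_mult tendsto_const lim) auto

lemma defect_form_tendsto:
  assumes w: "w \<in> carrier_vec m" and lim: "\<And>a b. a < m \<Longrightarrow> b < m \<Longrightarrow> (\<lambda>k. \<rho> k a b) \<longlonglongrightarrow> \<sigma> a b"
  shows "(\<lambda>k. defect_form (\<rho> k) w) \<longlonglongrightarrow> defect_form \<sigma> w"
  unfolding defect_form_def
  using w by (intro tendsto_sum tendsto_Re tendsto_add tendsto_diff tendsto_mult tendsto_const lim) auto

text \<open>Normalizing each factor, and not just the product, bounds all factor entries by 1 and
  keeps every factor away from zero in a limit.\<close>

lemma normalized_local_op:
  assumes L: "local_op n D L" and nz: "L \<noteq> 0\<^sub>m (D ^ n) (D ^ n)" and D: "D > 0"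
  shows "\<exists>A c. (\<forall>i<n. A i \<in> carrier_mat D D \<and> frob (A i) = 1) \<and> c \<noteq> 0 \<and> ltensor n D A = c \<cdot>\<^sub>m L"
proof -
  obtain B where B: "\<And>i. i < n \<Longrightarrow> B i \<in> carrier_mat D D" "L = ltensor n D B"
    using L unfolding local_op_def by blast
  have pos: "frob (B i) > 0" if i: "i < n" for i
  proof -
    have "B i \<noteq> 0\<^sub>m D D" using nz ltensor_zero_factor[OF i _ D] B(2) by blast
    then show ?thesis using frob_eq_0_iff[OF B(1)[OF i]] frob_nonneg[of "B i"] by linarith
  qed
  define c where "c i = complex_of_real (1 / sqrt (frob (B i)))" for i
  have "frob (c i \<cdot>\<^sub>m B i) = 1" if "i < n" for i
    using pos[OF that] by (simp add: frob_smult c_def power_divide norm_divide)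
  moreover have "ltensor n D (\<lambda>i. c i \<cdot>\<^sub>m B i) = (\<Prod>i<n. c i) \<cdot>\<^sub>m L"
    unfolding B(2) by (rule ltensor_smult[OF B(1) D])
  moreover have "(\<Prod>i<n. c i) \<noteq> 0" using pos by (simp add: c_def) (metis less_irrefl lessThan_iff)
  ultimately show ?thesis using B(1) by (intro exI[of _ "\<lambda>i. c i \<cdot>\<^sub>m B i"] exI[of _ "\<Prod>i<n. c i"]) auto
qed

lemma sqn_add_smult:
  assumes u: "u \<in> carrier_vec m" and v: "v \<in> carrier_vec m"
  shows "sqn (u + complex_of_real t \<cdot>\<^sub>v v) = sqn u + 2 * t * Re (cip v u) + t\<^sup>2 * sqn v"
proof -
  have "(cmod (x + complex_of_real t * y))\<^sup>2 = (cmod x)\<^sup>2 + 2 * t * Re (cnj y * x) + t\<^sup>2 * (cmod y)\<^sup>2" for x y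
    unfolding cmod_power2 by (simp add: power2_eq_square algebra_simps)
  then show ?thesis
    using u v by (simp add: sqn_def cip_def sum.distrib sum_distrib_left distrib_left)
qed

lemma cip_diff_smult_right:
  "u \<in> carrier_vec m \<Longrightarrow> v \<in> carrier_vec m \<Longrightarrow> cip w u - c * cip w v = cip w (u - c \<cdot>\<^sub>v v)"
  by (simp add: cip_def sum_distrib_left sum_subtractf[symmetric] algebra_simps)

text \<open>The quadratic form \<open>sqn (A *\<^sub>v x) - r * sqn (B *\<^sub>v x)\<close> is
  nonnegative and vanishes at \<open>y\<close>. So \<open>y\<close> is a minimum, and the equation
  says that the gradient vanishes there.\<close>

lemma gram_eq_of_minimum:
  assumes A: "A \<in> carrier_mat m m" and B: "B \<in> carrier_mat m m" and y: "y \<in> carrier_vec m"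
    and le: "\<And>x. x \<in> carrier_vec m \<Longrightarrow> r * sqn (B *\<^sub>v x) \<le> sqn (A *\<^sub>v x)"
    and eq: "r * sqn (B *\<^sub>v y) = sqn (A *\<^sub>v y)"
  shows "(mat_adjoint A * A) *\<^sub>v y = complex_of_real r \<cdot>\<^sub>v ((mat_adjoint B * B) *\<^sub>v y)"
proof -
  have c: "(mat_adjoint A * A) *\<^sub>v y \<in> carrier_vec m" "(mat_adjoint B * B) *\<^sub>v y \<in> carrier_vec m"
    using A B y by (auto intro!: mult_mat_vec_carrier[of _ m m] mult_carrier_mat[of _ m m])
  \<comment> \<open>The gradient at \<open>y\<close> up to a factor; it is shown to vanish by
    varying \<open>y\<close> along \<open>z\<close> itself.\<close>
  define z where "z = (mat_adjoint A * A) *\<^sub>v y - complex_of_real r \<cdot>\<^sub>v ((mat_adjoint B * B) *\<^sub>v y)"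
  have z: "z \<in> carrier_vec m" using c by (simp add: z_def)
  have AB: "A *\<^sub>v z \<in> carrier_vec m" "B *\<^sub>v z \<in> carrier_vec m" "A *\<^sub>v y \<in> carrier_vec m" "B *\<^sub>v y \<in> carrier_vec m"
    using A B y z by (auto intro: mult_mat_vec_carrier)
  have cipz: "Re (cip (A *\<^sub>v z) (A *\<^sub>v y)) - r * Re (cip (B *\<^sub>v z) (B *\<^sub>v y)) = sqn z"
  proof -
    have "cip (A *\<^sub>v z) (A *\<^sub>v y) = cip z ((mat_adjoint A * A) *\<^sub>v y)"
      unfolding cip_adjoint[OF A z AB(3)] assoc_mult_mat_vec[OF mat_adjoint_carrier[OF A] A y] ..
    moreover have "cip (B *\<^sub>v z) (B *\<^sub>v y) = cip z ((mat_adjoint B * B) *\<^sub>v y)"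
      unfolding cip_adjoint[OF B z AB(4)] assoc_mult_mat_vec[OF mat_adjoint_carrier[OF B] B y] ..
    moreover have "cip z ((mat_adjoint A * A) *\<^sub>v y) - r * cip z ((mat_adjoint B * B) *\<^sub>v y) = cip z z"
      using cip_diff_smult_right[OF c] unfolding z_def by simp
    ultimately have "cip (A *\<^sub>v z) (A *\<^sub>v y) - r * cip (B *\<^sub>v z) (B *\<^sub>v y) = complex_of_real (sqn z)"
      by (simp add: sqn_cip)
    from arg_cong[OF this, of Re] show ?thesis by simp
  qed
  define k where "k = sqn (A *\<^sub>v z) - r * sqn (B *\<^sub>v z)"
  have k: "k \<ge> 0" using le[OF z] by (simp add: k_def)
  have quad: "2 * t * sqn z + t\<^sup>2 * k \<ge> 0" for t
  proof -
    let ?x = "y + complex_of_real t \<cdot>\<^sub>v z"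
    have x: "?x \<in> carrier_vec m" using y z by simp
    have "M *\<^sub>v ?x = M *\<^sub>v y + complex_of_real t \<cdot>\<^sub>v (M *\<^sub>v z)" if M: "M \<in> carrier_mat m m" for M
      using mult_add_distrib_mat_vec[OF M y, of "complex_of_real t \<cdot>\<^sub>v z"] mult_mat_vec[OF M z] z by simp
    then have "0 \<le> sqn (A *\<^sub>v y + complex_of_real t \<cdot>\<^sub>v (A *\<^sub>v z)) - r * sqn (B *\<^sub>v y + complex_of_real t \<cdot>\<^sub>v (B *\<^sub>v z))"
      using le[OF x] A B by simp
    also have "\<dots> = 2 * t * sqn z + t\<^sup>2 * k"
      unfolding sqn_add_smult[OF AB(3,1)] sqn_add_smult[OF AB(4,2)] cipz[symmetric] k_def eq[symmetric]
      by (simp add: algebra_simps)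
    finally show ?thesis .
  qed
  have "sqn z = 0"
  proof (rule ccontr)
    assume "sqn z \<noteq> 0"
    then have s: "sqn z > 0" using sqn_nonneg[of z] by simp
    \<comment> \<open>A step against the gradient. With this value the form becomes
      \<open>- (sqn z)\<^sup>2 * (k + 2) / (k + 1)\<^sup>2\<close>; the added 1 keeps the
      denominator positive when \<open>k = 0\<close>.\<close>
    define t where "t = - sqn z / (k + 1)"
    have t: "t * (k + 1) = - sqn z" using k by (simp add: t_def)
    have "(k + 1)\<^sup>2 * (2 * t * sqn z + t\<^sup>2 * k) = 2 * (t * (k + 1)) * ((k + 1) * sqn z) + (t * (k + 1))\<^sup>2 * k"
      by (simp add: power2_eq_square algebra_simps)
    also have "\<dots> = - ((sqn z)\<^sup>2 * (k + 2))"
      unfolding t by (simp add: power2_eq_square algebra_simps)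
    also have "\<dots> < 0" using s k by simp
    finally show False using mult_nonneg_nonneg[OF zero_le_power2 quad[of t], of "k + 1"] by linarith
  qed
  then have "z = 0\<^sub>v m" using sqn_eq_0_iff[OF z] by simp
  moreover have "p = q" if "p - q = 0\<^sub>v m" "p \<in> carrier_vec m" "q \<in> carrier_vec m" for p q :: "complex vec"
    using that by (auto simp: vec_eq_iff)
  ultimately show ?thesis using c unfolding z_def by (meson smult_carrier_vec)
qed

lemma sqn_SWAP_all:
  assumes d: "d > 0" and x: "x \<in> carrier_vec ((d ^ 2) ^ n)"
  shows "sqn (SWAP_all n d *\<^sub>v x) = sqn x"
proof -
  have Sx: "SWAP_all n d *\<^sub>v x \<in> carrier_vec ((d ^ 2) ^ n)" by (rule mult_mat_vec_carrier[OF SWAP_all_carrier x])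
  have "complex_of_real (sqn (SWAP_all n d *\<^sub>v x)) = complex_of_real (sqn x)"
    unfolding sqn_mult[OF SWAP_all_carrier x] SWAP_all_adjoint[OF d] SWAP_all_involution[OF d]
    using x by (simp add: sqn_cip)
  then show ?thesis by (simp only: of_real_eq_iff)
qed

lemma mat_eqI_mult_vec:
  fixes A B :: "complex mat"
  assumes A: "A \<in> carrier_mat m k" and B: "B \<in> carrier_mat m k"
    and e: "\<And>x. x \<in> carrier_vec k \<Longrightarrow> A *\<^sub>v x = B *\<^sub>v x"
  shows "A = B"
proof (rule eq_matI)
  fix i j assume "i < dim_row B" "j < dim_col B"
  then have ij: "i < m" "j < k" using B by auto
  have "(M *\<^sub>v unit_vec k j) $ i = M $$ (i, j)" if "M \<in> carrier_mat m k" for M :: "complex mat"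
    unfolding index_mult_mat_vec_sum[OF that unit_vec_carrier ij(1)]
    using ij by (simp add: unit_vec_def if_distrib cong: if_cong)
  from this[OF A] this[OF B] e[OF unit_vec_carrier] show "A $$ (i, j) = B $$ (i, j)" by metis
qed (use A B in auto)

lemma mat_adjoint_local_invertible:
  assumes A: "local_invertible n D A"
  shows "local_invertible n D (\<lambda>i. mat_adjoint (A i))"
proof -
  have "invertible_mat (mat_adjoint (A i))" if i: "i < n" for i
  proof -
    have Ai: "A i \<in> carrier_mat D D" "invertible_mat (A i)" using A i by (auto simp: local_invertible_def)
    obtain B where B: "B \<in> carrier_mat D D" "A i * B = 1\<^sub>m D" "B * A i = 1\<^sub>m D" by (rule invertible_matE[OF Ai])
    have one: "mat_adjoint (1\<^sub>m D) = (1\<^sub>m D :: complex mat)"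
      by (rule eq_matI) (auto simp: mat_adjoint_index[of _ D D] carrier_matD[OF mat_adjoint_carrier[of _ D D]])
    show ?thesis
      by (rule invertible_matI[of _ D "mat_adjoint B"])
         (use Ai B in \<open>simp_all add: mat_adjoint_mult[symmetric, of _ D D _ D] one\<close>)
  qed
  then show ?thesis using A by (auto simp: local_invertible_def)
qed

section \<open>The perturbed estimate and its limit\<close>

context two_copy_state
begin

lemma sqn_loc_Psi_pos:
  assumes "local_invertible n D B"
  shows "sqn (loc B *\<^sub>v Psi) > 0"
  using loc_Psi_nonzero[OF assms] sqn_eq_0_iff[OF loc_Psi_carrier] sqn_nonneg[of "loc B *\<^sub>v Psi"] by fastforce

text \<open>For \<open>L\<close> mapping \<open>Psi\<close> exactly to a multiple of \<open>loc B Psi\<close> the error terms are not needed.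
  Compactness of the normalized local operators gives the perturbed version; the term
  \<open>\<delta> * frob L\<close> takes care of local operators that annihilate \<open>Psi\<close>.\<close>

lemma local_op_estimate:
  assumes B: "local_invertible n D B" and sym: "loc B * S = S * loc B"
    and x: "x \<in> carrier_vec N" and \<delta>: "\<delta> > 0"
  defines "w \<equiv> loc B *\<^sub>v Psi"
  defines "\<kappa> \<equiv> sqn (loc B *\<^sub>v x) / sqn w"
  shows "\<exists>C. \<forall>L. local_op n D L \<longrightarrow>
    \<kappa> * sqn (L *\<^sub>v Psi) \<le> sqn (L *\<^sub>v x) + \<delta> * frob L + C * defect (L *\<^sub>v Psi) w"
proof (rule ccontr)
  assume contr: "\<not> ?thesis"
  have w: "w \<in> carrier_vec N" "w \<noteq> 0\<^sub>v N" "sqn w > 0"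
    unfolding w_def using loc_Psi_nonzero[OF B] sqn_loc_Psi_pos[OF B] by auto
  define gap where "gap C L = \<kappa> * sqn (L *\<^sub>v Psi) - sqn (L *\<^sub>v x) - \<delta> * frob L - C * defect (L *\<^sub>v Psi) w" for C L
  have gap_smult: "gap C (c \<cdot>\<^sub>m L) = (cmod c)\<^sup>2 * gap C L" if L: "L \<in> carrier_mat N N" for C c L
    unfolding gap_def smult_mat_mult_vec[OF L two_copy_carrier] smult_mat_mult_vec[OF L x] sqn_smult frob_smult
      defect_smult_left[OF mult_mat_vec_carrier[OF L two_copy_carrier] w(1)]
    by (simp add: algebra_simps)
  \<comment> \<open>If no constant works, every \<open>Suc k\<close> has a violating operator. As
    \<open>gap\<close> scales by the squared modulus of a scalar, the violator may be replaced by
    one with normalized factors.\<close>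
  have "\<exists>A. (\<forall>i<n. A i \<in> carrier_mat D D \<and> frob (A i) = 1) \<and> gap (real (Suc k)) (loc A) > 0" for k
  proof -
    have "\<exists>L. local_op n D L \<and> gap (real (Suc k)) L > 0"
    proof (rule ccontr)
      assume no: "\<not> ?thesis"
      have "\<kappa> * sqn (L *\<^sub>v Psi) \<le> sqn (L *\<^sub>v x) + \<delta> * frob L + real (Suc k) * defect (L *\<^sub>v Psi) w"
        if "local_op n D L" for L
      proof -
        have "\<not> gap (real (Suc k)) L > 0" using no that by blast
        then show ?thesis unfolding gap_def by linarith
      qed
      then show False using contr by blast
    qed
    then obtain L where L: "local_op n D L" "gap (real (Suc k)) L > 0" by blast
    note Lc = local_op_carrier[OF L(1)]
    have "L \<noteq> 0\<^sub>m N N"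
    proof
      assume "L = 0\<^sub>m N N"
      then have "L = 0 \<cdot>\<^sub>m L" by (intro eq_matI) auto
      then have "gap (real (Suc k)) L = (cmod 0)\<^sup>2 * gap (real (Suc k)) L" using gap_smult[OF Lc] by metis
      then show False using L(2) by simp
    qed
    then obtain A c where A: "\<forall>i<n. A i \<in> carrier_mat D D \<and> frob (A i) = 1" "c \<noteq> 0" "loc A = c \<cdot>\<^sub>m L"
      using normalized_local_op[OF L(1) _ D_pos] by blast
    then have "gap (real (Suc k)) (loc A) > 0" using L(2) by (simp add: gap_smult[OF Lc])
    then show ?thesis using A(1) by blast
  qed
  then obtain A where A: "\<And>k i. i < n \<Longrightarrow> A k i \<in> carrier_mat D D" "\<And>k i. i < n \<Longrightarrow> frob (A k i) = 1"
    and gap: "\<And>k. gap (real (Suc k)) (loc (A k)) > 0" by metis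
  have "cmod (A k i $$ (a, b)) \<le> 1" if "i < n" "a < D" "b < D" for k i a b
    using cmod_index_le_frob[OF A(1)[OF that(1)] that(2,3), of k] A(2)[OF that(1)]
    by (simp add: abs_square_le_1)
  then have "\<exists>r l. strict_mono r \<and> (\<forall>j\<in>{..<n} \<times> {..<D} \<times> {..<D}.
      (\<lambda>k. (\<lambda>(i, a, b). A (r k) i $$ (a, b)) j) \<longlonglongrightarrow> l j)"
    by (intro bounded_family_subseq[where f="\<lambda>k (i, a, b). A k i $$ (a, b)"]) auto
  then obtain r l where r: "strict_mono r"
    and l: "\<And>i a b. i < n \<Longrightarrow> a < D \<Longrightarrow> b < D \<Longrightarrow> (\<lambda>k. A (r k) i $$ (a, b)) \<longlonglongrightarrow> l (i, a, b)"
    by fastforce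
  define Z where "Z i = mat D D (\<lambda>(a, b). l (i, a, b))" for i :: nat
  have Zc: "Z i \<in> carrier_mat D D" for i by (simp add: Z_def)
  have Zlim: "(\<lambda>k. A (r k) i $$ (a, b)) \<longlonglongrightarrow> Z i $$ (a, b)" if "i < n" "a < D" "b < D" for i a b
    using l[OF that] that by (simp add: Z_def)
  have "Z i \<noteq> 0\<^sub>m D D" if i: "i < n" for i
  proof -
    have "(\<lambda>k. frob (A (r k) i)) \<longlonglongrightarrow> frob (Z i)"
      by (rule frob_tendsto[OF A(1)[OF i] Zc Zlim[OF i]])
    then have "frob (Z i) = 1" using A(2)[OF i] by (simp add: LIMSEQ_const_iff)
    then show ?thesis using frob_eq_0_iff[OF Zc, of i] by simp
  qed
  \<comment> \<open>Taking limits factor by factor keeps \<open>loc Z\<close> a product operator, to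
    which the stabilizer condition applies, and keeps it nonzero.\<close>
  then have "loc Z \<noteq> 0\<^sub>m N N" by (intro ltensor_nonzero Zc)
  then have frobZ: "frob (loc Z) > 0"
    using frob_eq_0_iff[OF ltensor_carrier, of n D Z] frob_nonneg[of "loc Z"] by linarith
  have lim: "(\<lambda>k. loc (A (r k)) $$ (a, b)) \<longlonglongrightarrow> loc Z $$ (a, b)" if "a < N" "b < N" for a b
    unfolding ltensor_index[OF that] by (intro tendsto_prod Zlim) (auto intro: digit_less[OF D_pos])
  have lim_vec: "(\<lambda>k. (loc (A (r k)) *\<^sub>v y) $ a) \<longlonglongrightarrow> (loc Z *\<^sub>v y) $ a" if "y \<in> carrier_vec N" "a < N" for y a
    by (rule mult_mat_vec_tendsto[OF ltensor_carrier ltensor_carrier that(1) lim that(2)])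
  have lim_sqn: "(\<lambda>k. sqn (loc (A (r k)) *\<^sub>v y)) \<longlonglongrightarrow> sqn (loc Z *\<^sub>v y)" if y: "y \<in> carrier_vec N" for y
    by (rule sqn_tendsto[OF mult_mat_vec_carrier[OF ltensor_carrier y] mult_mat_vec_carrier[OF ltensor_carrier y] lim_vec[OF y]])
  have lim_frob: "(\<lambda>k. frob (loc (A (r k)))) \<longlonglongrightarrow> frob (loc Z)"
    by (rule frob_tendsto[OF ltensor_carrier ltensor_carrier lim])
  have lim_defect: "(\<lambda>k. defect (loc (A (r k)) *\<^sub>v Psi) w) \<longlonglongrightarrow> defect (loc Z *\<^sub>v Psi) w"
    by (rule defect_tendsto[OF w(1) lim_vec[OF two_copy_carrier]])
  have \<kappa>: "\<kappa> \<ge> 0" unfolding \<kappa>_def by (simp add: sqn_nonneg)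
  \<comment> \<open>The violation bounds the defect by a convergent quantity divided by the growing
    constant, so the limit operator maps \<open>Psi\<close> exactly onto the target line.\<close>
  have "defect (loc (A (r k)) *\<^sub>v Psi) w \<le> \<kappa> * sqn (loc (A (r k)) *\<^sub>v Psi) * inverse (real (Suc (r k)))" for k
  proof -
    have "real (Suc (r k)) * defect (loc (A (r k)) *\<^sub>v Psi) w
        \<le> \<kappa> * sqn (loc (A (r k)) *\<^sub>v Psi)"
      using gap[of "r k"] sqn_nonneg[of "loc (A (r k)) *\<^sub>v x"] mult_nonneg_nonneg[OF less_imp_le[OF \<delta>] frob_nonneg[of "loc (A (r k))"]]
      unfolding gap_def by linarith
    then show ?thesis by (simp add: field_simps)
  qed
  moreover have "(\<lambda>k. \<kappa> * sqn (loc (A (r k)) *\<^sub>v Psi) * inverse (real (Suc (r k)))) \<longlonglongrightarrow> \<kappa> * sqn (loc Z *\<^sub>v Psi) * 0"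
    using LIMSEQ_subseq_LIMSEQ[OF LIMSEQ_inverse_real_of_nat r]
    by (intro tendsto_mult tendsto_const lim_sqn two_copy_carrier) (simp add: o_def)
  ultimately have "defect (loc Z *\<^sub>v Psi) w \<le> \<kappa> * sqn (loc Z *\<^sub>v Psi) * 0"
    by (intro LIMSEQ_le[OF lim_defect]) auto
  then have "defect (loc Z *\<^sub>v Psi) w = 0" using defect_nonneg[of "loc Z *\<^sub>v Psi" w] by simp
  then obtain c where c: "loc Z *\<^sub>v Psi = c \<cdot>\<^sub>v w"
    using defect_eq_0D[OF loc_Psi_carrier w(1,2)] by blast
  \<comment> \<open>Discarding the nonnegative defect term leaves an inequality that passes to the
    limit, where \<open>\<delta> * frob (loc Z) > 0\<close> makes it strict.\<close>
  have "sqn (loc (A (r k)) *\<^sub>v x) + \<delta> * frob (loc (A (r k))) \<le> \<kappa> * sqn (loc (A (r k)) *\<^sub>v Psi)" for k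
    using gap[of "r k"] mult_nonneg_nonneg[OF of_nat_0_le_iff defect_nonneg[of "loc (A (r k)) *\<^sub>v Psi" w], of "Suc (r k)"]
    unfolding gap_def by linarith
  then have "sqn (loc Z *\<^sub>v x) + \<delta> * frob (loc Z) \<le> \<kappa> * sqn (loc Z *\<^sub>v Psi)"
    by (intro LIMSEQ_le[OF tendsto_add[OF lim_sqn[OF x] tendsto_mult[OF tendsto_const lim_frob]]
          tendsto_mult[OF tendsto_const lim_sqn[OF two_copy_carrier]]]) auto
  moreover have "\<delta> * frob (loc Z) > 0" using \<delta> frobZ by simp
  ultimately have less: "sqn (loc Z *\<^sub>v x) < \<kappa> * sqn (loc Z *\<^sub>v Psi)" by linarith
  have rhs: "\<kappa> * sqn (loc Z *\<^sub>v Psi) = (cmod c)\<^sup>2 * sqn (loc B *\<^sub>v x)"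
    unfolding c sqn_smult \<kappa>_def using w(3) by simp
  \<comment> \<open>Here strictness excludes the limit operators that annihilate
    \<open>Psi\<close>.\<close>
  have "c \<noteq> 0" using less sqn_nonneg[of "loc Z *\<^sub>v x"] unfolding rhs by auto
  then consider "loc Z = c \<cdot>\<^sub>m loc B" | "loc Z = c \<cdot>\<^sub>m (loc B * S)"
    using local_stabilizer_cases[OF local_op_ltensor[OF Zc] B c[unfolded w_def]] by blast
  then have "sqn (loc Z *\<^sub>v x) = (cmod c)\<^sup>2 * sqn (loc B *\<^sub>v x)"
  proof cases
    case 1
    show ?thesis unfolding 1 smult_mat_mult_vec[OF ltensor_carrier x] sqn_smult ..
  next
    case 2
    have BS: "loc B * S \<in> carrier_mat N N" by (rule mult_carrier_mat[OF ltensor_carrier SWAP_all_carrier])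
    \<comment> \<open>By \<open>sym\<close> the swap moves to the left, where it preserves the norm;
      both alternatives thus give exactly the value that \<open>less\<close> forbids.\<close>
    have "sqn ((loc B * S) *\<^sub>v x) = sqn (loc B *\<^sub>v x)"
      unfolding sym assoc_mult_mat_vec[OF SWAP_all_carrier ltensor_carrier x]
      by (rule sqn_SWAP_all[OF d_pos mult_mat_vec_carrier[OF ltensor_carrier x]])
    then show ?thesis unfolding 2 smult_mat_mult_vec[OF BS x] sqn_smult by simp
  qed
  then show False using less unfolding rhs by simp
qed

text \<open>\<open>local_op_estimate\<close> is summed over the branches \<open>K * loc A\<close> of
  each protocol in the sequence. Norms and the Frobenius term are conserved, and the total defect
  tends to zero because the limiting output is the target.\<close>

lemma LOCC_imp_sqn_le:
  assumes A: "local_invertible n D A" and B: "local_invertible n D B" and sym: "loc B * S = S * loc B"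
    and trans: "LOCC_trans n D (loc A *\<^sub>v Psi) (loc B *\<^sub>v Psi)" and x: "x \<in> carrier_vec N"
  shows "sqn (loc A *\<^sub>v Psi) / sqn (loc B *\<^sub>v Psi) * sqn (loc B *\<^sub>v x) \<le> sqn (loc A *\<^sub>v x)"
proof -
  let ?u = "loc A *\<^sub>v Psi" and ?w = "loc B *\<^sub>v Psi"
  let ?\<kappa> = "sqn (loc B *\<^sub>v x) / sqn ?w"
  obtain \<alpha> where \<alpha>: "\<alpha> > 0" "normalize ?u = complex_of_real \<alpha> \<cdot>\<^sub>v ?u" by (rule normalize_smult[OF A])
  obtain \<beta> where \<beta>: "normalize ?w = complex_of_real \<beta> \<cdot>\<^sub>v ?w" by (rule normalize_smult[OF B])
  let ?u' = "complex_of_real \<alpha> \<cdot>\<^sub>v ?u"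
  have u': "?u' \<in> carrier_vec N" by simp
  have pu: "proj ?u' \<in> carrier_mat N N" using u' by (simp add: proj_def)
  obtain \<Lambda> Ps where Ps: "\<And>r. wf_proto n D (Ps r)"
    and lim: "\<And>a b. a < N \<Longrightarrow> b < N \<Longrightarrow> (\<lambda>r. channel n D (Ps r) (proj ?u') $$ (a, b)) \<longlonglongrightarrow> \<Lambda> (proj ?u') $$ (a, b)"
    and out: "\<Lambda> (proj ?u') = proj (complex_of_real \<beta> \<cdot>\<^sub>v ?w)"
    using trans pu unfolding LOCC_trans_def LOCC_channel_def \<alpha>(2) \<beta> by metis
  define total where "total r = (\<Sum>K\<leftarrow>kraus n D (Ps r). defect (K *\<^sub>v ?u) ?w)" for r
  have "\<alpha>\<^sup>2 * total r = defect_form (\<lambda>a b. channel n D (Ps r) (proj ?u') $$ (a, b)) ?w" for r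
  proof -
    have "\<alpha>\<^sup>2 * total r = (\<Sum>K\<leftarrow>kraus n D (Ps r). defect (K *\<^sub>v ?u') ?w)"
      unfolding total_def sum_list_const_mult[symmetric]
    proof (intro arg_cong[of _ _ sum_list] map_cong refl)
      fix K assume K: "K \<in> set (kraus n D (Ps r))"
      note Kc = kraus_carrier[OF Ps D_pos K]
      show "\<alpha>\<^sup>2 * defect (K *\<^sub>v ?u) ?w = defect (K *\<^sub>v ?u') ?w"
        unfolding mult_mat_vec[OF Kc loc_Psi_carrier]
        by (simp add: defect_smult_left[OF mult_mat_vec_carrier[OF Kc loc_Psi_carrier] loc_Psi_carrier])
    qed
    then show ?thesis unfolding sum_defect_kraus[OF Ps D_pos u' loc_Psi_carrier] .
  qed
  moreover have "(\<lambda>r. defect_form (\<lambda>a b. channel n D (Ps r) (proj ?u') $$ (a, b)) ?w) \<longlonglongrightarrow> 0"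
  proof -
    have "(\<lambda>r. defect_form (\<lambda>a b. channel n D (Ps r) (proj ?u') $$ (a, b)) ?w)
        \<longlonglongrightarrow> defect_form (\<lambda>a b. \<Lambda> (proj ?u') $$ (a, b)) ?w"
      by (rule defect_form_tendsto[OF loc_Psi_carrier lim])
    then show ?thesis unfolding out defect_form_proj[OF loc_Psi_carrier] .
  qed
  ultimately have "(\<lambda>r. inverse (\<alpha>\<^sup>2) * (\<alpha>\<^sup>2 * total r)) \<longlonglongrightarrow> inverse (\<alpha>\<^sup>2) * 0"
    by (intro tendsto_mult tendsto_const) simp
  then have total0: "total \<longlonglongrightarrow> 0" using \<alpha>(1) by (simp add: mult.assoc[symmetric])
  have "?\<kappa> * sqn ?u \<le> sqn (loc A *\<^sub>v x) + \<delta> * frob (loc A)" if \<delta>: "\<delta> > 0" for \<delta>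
  proof -
    \<comment> \<open>\<open>C\<close> may depend on \<open>\<delta>\<close> and \<open>x\<close>
      but not on the protocol, so the protocol limit is taken first and \<open>\<delta>\<close> is
      removed afterwards.\<close>
    obtain C where C: "\<And>L. local_op n D L \<Longrightarrow>
        ?\<kappa> * sqn (L *\<^sub>v Psi) \<le> sqn (L *\<^sub>v x) + \<delta> * frob L + C * defect (L *\<^sub>v Psi) ?w"
      using local_op_estimate[OF B sym x \<delta>] by blast
    have "?\<kappa> * sqn ?u \<le> sqn (loc A *\<^sub>v x) + \<delta> * frob (loc A) + C * total r" for r
    proof -
      let ?Ks = "kraus n D (Ps r)"
      have Ax: "loc A *\<^sub>v x \<in> carrier_vec N" by (rule mult_mat_vec_carrier[OF ltensor_carrier x])
      have "?\<kappa> * sqn ?u = (\<Sum>K\<leftarrow>?Ks. ?\<kappa> * sqn (K *\<^sub>v ?u))"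
        unfolding sum_list_const_mult sum_sqn_kraus[OF Ps D_pos loc_Psi_carrier] ..
      also have "\<dots> \<le> (\<Sum>K\<leftarrow>?Ks. sqn (K *\<^sub>v (loc A *\<^sub>v x)) + \<delta> * frob (K * loc A) + C * defect (K *\<^sub>v ?u) ?w)"
      proof (rule sum_list_mono)
        fix K assume K: "K \<in> set ?Ks"
        note Kc = kraus_carrier[OF Ps D_pos K]
        have "local_op n D (K * loc A)"
          by (rule local_op_mult[OF D_pos kraus_local_op[OF Ps D_pos K]])
             (rule local_op_ltensor, rule local_invertible_carrier[OF A])
        from C[OF this] show "?\<kappa> * sqn (K *\<^sub>v ?u)
            \<le> sqn (K *\<^sub>v (loc A *\<^sub>v x)) + \<delta> * frob (K * loc A) + C * defect (K *\<^sub>v ?u) ?w"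
          unfolding assoc_mult_mat_vec[OF Kc ltensor_carrier two_copy_carrier]
            assoc_mult_mat_vec[OF Kc ltensor_carrier x] .
      qed
      also have "\<dots> = sqn (loc A *\<^sub>v x) + \<delta> * frob (loc A) + C * total r"
        unfolding sum_list_addf sum_list_const_mult total_def sum_sqn_kraus[OF Ps D_pos Ax]
          sum_frob_kraus[OF Ps D_pos ltensor_carrier] ..
      finally show ?thesis .
    qed
    moreover have "(\<lambda>r. sqn (loc A *\<^sub>v x) + \<delta> * frob (loc A) + C * total r)
        \<longlonglongrightarrow> sqn (loc A *\<^sub>v x) + \<delta> * frob (loc A) + C * 0"
      by (intro tendsto_add tendsto_mult tendsto_const total0)
    ultimately have "?\<kappa> * sqn ?u \<le> sqn (loc A *\<^sub>v x) + \<delta> * frob (loc A) + C * 0"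
      by (intro LIMSEQ_le_const) auto
    then show ?thesis by simp
  qed
  then have "?\<kappa> * sqn ?u \<le> sqn (loc A *\<^sub>v x) + e" if "e > 0" for e
  proof -
    \<comment> \<open>This is the \<open>\<delta>\<close> used for tolerance \<open>e\<close>; the
      added 1 guards against division by zero.\<close>
    have "e / (frob (loc A) + 1) * frob (loc A) \<le> e"
      using \<open>e > 0\<close> frob_nonneg[of "loc A"] by (simp add: field_simps)
    moreover have "e / (frob (loc A) + 1) > 0" using \<open>e > 0\<close> frob_nonneg[of "loc A"] by simp
    ultimately show ?thesis
      using \<open>\<And>\<delta>. \<delta> > 0 \<Longrightarrow> ?\<kappa> * sqn ?u \<le> sqn (loc A *\<^sub>v x) + \<delta> * frob (loc A)\<close>[of "e / (frob (loc A) + 1)"]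
      by linarith
  qed
  then have "?\<kappa> * sqn ?u \<le> sqn (loc A *\<^sub>v x)" by (rule field_le_epsilon)
  then show ?thesis by (simp add: mult.commute)
qed

text \<open>On a vector with \<open>S *\<^sub>v y = - y\<close> the hypothesis equates
  \<open>sqn (loc A *\<^sub>v y)\<close> with \<open>- r * sqn (loc B *\<^sub>v y)\<close>, so both
  vanish and \<open>y = 0\<close> by invertibility. Without nonzero antisymmetric vectors the swap
  is the identity. The conclusion is an equality and not a contradiction, since for
  \<open>d = 1\<close> the swap really is the identity.\<close>

lemma gram_mult_SWAP_all_imp_eq:
  assumes A: "local_invertible n D A" and B: "local_invertible n D B" and r: "r > 0"
    and e: "mat_adjoint (loc A) * loc A = complex_of_real r \<cdot>\<^sub>m (mat_adjoint (loc B) * loc B * S)"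
  shows "mat_adjoint (loc B) * loc B * S = mat_adjoint (loc B) * loc B"
proof -
  let ?G = "mat_adjoint (loc A) * loc A" and ?H = "mat_adjoint (loc B) * loc B"
  have Hc: "?H \<in> carrier_mat N N"
    by (rule mult_carrier_mat[OF mat_adjoint_carrier[OF ltensor_carrier] ltensor_carrier])
  have antisym: "y = 0\<^sub>v N" if y: "y \<in> carrier_vec N" and Sy: "S *\<^sub>v y = - y" for y
  proof -
    have "?G *\<^sub>v y = complex_of_real (- r) \<cdot>\<^sub>v (?H *\<^sub>v y)"
    proof -
      have "?G *\<^sub>v y = complex_of_real r \<cdot>\<^sub>v (?H *\<^sub>v (S *\<^sub>v y))"
        unfolding e smult_mat_mult_vec[OF mult_carrier_mat[OF Hc SWAP_all_carrier] y]
          assoc_mult_mat_vec[OF Hc SWAP_all_carrier y] ..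
      also have "S *\<^sub>v y = (- 1) \<cdot>\<^sub>v y" unfolding Sy by (auto simp: vec_eq_iff)
      finally show ?thesis
        unfolding mult_mat_vec[OF Hc y] smult_smult_assoc by simp
    qed
    then have "complex_of_real (sqn (loc A *\<^sub>v y)) = complex_of_real (- r) * cip y (?H *\<^sub>v y)"
      unfolding sqn_mult[OF ltensor_carrier y] by (simp add: cip_def sum_distrib_left mult_ac)
    also have "\<dots> = complex_of_real (- r * sqn (loc B *\<^sub>v y))"
      unfolding of_real_mult sqn_mult[OF ltensor_carrier y] ..
    finally have "sqn (loc A *\<^sub>v y) = - r * sqn (loc B *\<^sub>v y)" by (simp only: of_real_eq_iff)
    moreover have "0 \<le> r * sqn (loc B *\<^sub>v y)" using r sqn_nonneg[of "loc B *\<^sub>v y"] by simp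
    ultimately have "r * sqn (loc B *\<^sub>v y) = 0" using sqn_nonneg[of "loc A *\<^sub>v y"] by linarith
    then have "sqn (loc B *\<^sub>v y) = 0" using r by simp
    then have z: "loc B *\<^sub>v y = 0\<^sub>v N" using sqn_eq_0_iff[OF mult_mat_vec_carrier[OF ltensor_carrier y]] by blast
    obtain C where C: "loc C * loc B = 1\<^sub>m N"
      by (rule local_invertible_inverse[OF D_pos B]) (rule that; assumption)
    have "y = loc C *\<^sub>v (loc B *\<^sub>v y)"
      unfolding assoc_mult_mat_vec[OF ltensor_carrier ltensor_carrier y, symmetric] C using y by simp
    then show ?thesis unfolding z mult_mat_zero_vec[OF ltensor_carrier] .
  qed
  have "S *\<^sub>v x = x" if x: "x \<in> carrier_vec N" for x
  proof -
    have Sx: "S *\<^sub>v x \<in> carrier_vec N" by (rule mult_mat_vec_carrier[OF SWAP_all_carrier x])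
    \<comment> \<open>\<open>x - S *\<^sub>v x\<close> is antisymmetric for every \<open>x\<close>,
      hence zero by \<open>antisym\<close>.\<close>
    have "S *\<^sub>v (x - S *\<^sub>v x) = S *\<^sub>v x - S *\<^sub>v (S *\<^sub>v x)"
      by (rule mult_minus_distrib_mat_vec[OF SWAP_all_carrier x Sx])
    also have "S *\<^sub>v (S *\<^sub>v x) = x"
      unfolding assoc_mult_mat_vec[OF SWAP_all_carrier SWAP_all_carrier x, symmetric] SWAP_all_involution[OF d_pos]
      using x by simp
    also have "S *\<^sub>v x - x = - (x - S *\<^sub>v x)" using x Sx by (intro eq_vecI) auto
    finally have "x - S *\<^sub>v x = 0\<^sub>v N" by (intro antisym) (use x Sx in auto)
    then show ?thesis using x Sx by (auto simp: vec_eq_iff)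
  qed
  then show ?thesis
    by (intro mat_eqI_mult_vec[OF mult_carrier_mat[OF Hc SWAP_all_carrier] Hc])
       (simp add: assoc_mult_mat_vec[OF Hc SWAP_all_carrier])
qed

lemma LOCC_imp_prop_pos:
  assumes g1: "local_invertible n d g1" and g2: "local_invertible n d g2"
    and h1: "local_invertible n d h1" and h2: "local_invertible n d h2"
    and h12: "ltensor n d h1 = ltensor n d h2"
    and trans: "LOCC_trans n D (two_copy n d (ltensor n d g1 *\<^sub>v v) (ltensor n d g2 *\<^sub>v v))
      (two_copy n d (ltensor n d h1 *\<^sub>v v) (ltensor n d h2 *\<^sub>v v))"
  defines "G1 \<equiv> mat_adjoint (ltensor n d g1) * ltensor n d g1"
    and "G2 \<equiv> mat_adjoint (ltensor n d g2) * ltensor n d g2"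
    and "H1 \<equiv> mat_adjoint (ltensor n d h1) * ltensor n d h1"
    and "H2 \<equiv> mat_adjoint (ltensor n d h2) * ltensor n d h2"
  shows "(prop_pos G1 H1 \<and> prop_pos G2 H2) \<or> (prop_pos G1 H2 \<and> prop_pos G2 H1)"
proof -
  define g where "g i = tensor2 1 d (g1 i) (g2 i)" for i
  define h where "h i = tensor2 1 d (h1 i) (h2 i)" for i
  have g: "local_invertible n D g" unfolding g_def by (rule tensor2_local_invertible[OF d_pos g1 g2])
  have h: "local_invertible n D h" unfolding h_def by (rule tensor2_local_invertible[OF d_pos h1 h2])
  have lg: "loc g = tensor2 n d (ltensor n d g1) (ltensor n d g2)" unfolding g_def by (rule loc_tensor2)
  have lh: "loc h = tensor2 n d (ltensor n d h1) (ltensor n d h2)" unfolding h_def by (rule loc_tensor2)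
  have sym: "loc h * S = S * loc h"
    unfolding lh h12 by (rule SWAP_all_tensor2[OF d_pos, symmetric])
  have trans': "LOCC_trans n D (loc g *\<^sub>v Psi) (loc h *\<^sub>v Psi)"
    using trans unfolding two_copy_loc g_def h_def .
  let ?G = "mat_adjoint (loc g) * loc g" and ?H = "mat_adjoint (loc h) * loc h"
  \<comment> \<open>With this ratio the inequality of \<open>LOCC_imp_sqn_le\<close> is an equality
    at \<open>x = Psi\<close>, which makes \<open>Psi\<close> a minimum.\<close>
  define r where "r = sqn (loc g *\<^sub>v Psi) / sqn (loc h *\<^sub>v Psi)"
  have r: "r > 0" unfolding r_def using sqn_loc_Psi_pos g h by simp
  have GH: "?G *\<^sub>v Psi = complex_of_real r \<cdot>\<^sub>v (?H *\<^sub>v Psi)"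
    by (rule gram_eq_of_minimum[OF ltensor_carrier ltensor_carrier two_copy_carrier])
       (use LOCC_imp_sqn_le[OF g h sym trans'] sqn_loc_Psi_pos[OF h] in \<open>simp_all add: r_def\<close>)
  define H where "H i = mat_adjoint (h i) * h i" for i
  have H: "local_invertible n D H"
    unfolding H_def by (rule local_invertible_mult[OF mat_adjoint_local_invertible[OF h] h])
  have gram_loc: "mat_adjoint (loc A) * loc A = loc (\<lambda>i. mat_adjoint (A i) * A i)"
    if "local_invertible n D A" for A
  proof -
    note Ac = local_invertible_carrier[OF that]
    have "mat_adjoint (loc A) = loc (\<lambda>i. mat_adjoint (A i))" by (rule ltensor_adjoint[OF D_pos Ac])
    moreover have "loc (\<lambda>i. mat_adjoint (A i)) * loc A = loc (\<lambda>i. mat_adjoint (A i) * A i)"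
      by (rule ltensor_mult[OF D_pos mat_adjoint_carrier[OF Ac] Ac])
    ultimately show ?thesis by simp
  qed
  have lH: "?H = loc H" unfolding H_def by (rule gram_loc[OF h])
  have "local_op n D ?G"
    unfolding gram_loc[OF g]
    using local_invertible_carrier[OF local_invertible_mult[OF mat_adjoint_local_invertible[OF g] g]]
    by (rule local_op_ltensor)
  \<comment> \<open>The stabilizer argument is applied to the Gram operators themselves:
    \<open>?G\<close> is a product operator and sends \<open>Psi\<close> to \<open>r\<close> times
    its image under the invertible \<open>?H\<close>.\<close>
  then consider "?G = complex_of_real r \<cdot>\<^sub>m ?H" | "?G = complex_of_real r \<cdot>\<^sub>m (?H * S)"
    using local_stabilizer_cases[OF _ H, of ?G "complex_of_real r"] GH r unfolding lH by auto
  then have "?G = complex_of_real r \<cdot>\<^sub>m ?H"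
  proof cases
    case 2
    then show ?thesis using gram_mult_SWAP_all_imp_eq[OF g h r 2] by simp
  qed
  then have "tensor2 n d G1 G2 = complex_of_real r \<cdot>\<^sub>m tensor2 n d H1 H2"
    unfolding lg lh gram_tensor2[OF d_pos ltensor_carrier ltensor_carrier] G1_def G2_def H1_def H2_def .
  \<comment> \<open>Padding with weight 0 gives the mixture form of the finite case, so the same
    comparison of tensor factors applies.\<close>
  also have "\<dots> = complex_of_real r \<cdot>\<^sub>m tensor2 n d H1 H2 + 0 \<cdot>\<^sub>m tensor2 n d H2 H1"
    by (rule eq_matI) auto
  finally show ?thesis
  proof (rule tensor2_mixture_imp_prop_pos[OF d_pos, rotated -1])
    show "G1 \<in> carrier_mat (d ^ n) (d ^ n)" "G2 \<in> carrier_mat (d ^ n) (d ^ n)"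
      "H1 \<in> carrier_mat (d ^ n) (d ^ n)" "H2 \<in> carrier_mat (d ^ n) (d ^ n)"
      unfolding G1_def G2_def H1_def H2_def
      by (rule mult_carrier_mat[OF mat_adjoint_carrier[OF ltensor_carrier] ltensor_carrier])+
    show "\<exists>r>0. M $$ (0, 0) = complex_of_real r" if "M \<in> {G1, G2, H1, H2}" for M
      using that gram_corner_pos[OF d_pos] g1 g2 h1 h2 unfolding G1_def G2_def H1_def H2_def by blast
  qed
qed

end

theorem theorem2:
  fixes n d :: nat and psi :: "complex vec" and g1 g2 h1 h2 :: "nat \<Rightarrow> complex mat"
  assumes psi: "psi \<in> carrier_vec (d ^ n)"
    and fe: "fully_entangled n d psi"
    and stab: "stabilizer n (d ^ 2) (two_copy n d psi psi) = {1\<^sub>m ((d ^ 2) ^ n), SWAP_all n d}"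
    and g1: "local_invertible n d g1" and g2: "local_invertible n d g2"
    and h1: "local_invertible n d h1" and h2: "local_invertible n d h2"
  defines "G1 \<equiv> mat_adjoint (ltensor n d g1) * ltensor n d g1"
    and "G2 \<equiv> mat_adjoint (ltensor n d g2) * ltensor n d g2"
    and "H1 \<equiv> mat_adjoint (ltensor n d h1) * ltensor n d h1"
    and "H2 \<equiv> mat_adjoint (ltensor n d h2) * ltensor n d h2"
  shows "(LOCCN_trans n (d ^ 2)
            (two_copy n d (ltensor n d g1 *\<^sub>v psi) (ltensor n d g2 *\<^sub>v psi))
            (two_copy n d (ltensor n d h1 *\<^sub>v psi) (ltensor n d h2 *\<^sub>v psi))
          \<longrightarrow> (prop_pos G1 H1 \<and> prop_pos G2 H2) \<or> (prop_pos G1 H2 \<and> prop_pos G2 H1))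
       \<and> (ltensor n d h1 = ltensor n d h2 \<and>
          LOCC_trans n (d ^ 2)
            (two_copy n d (ltensor n d g1 *\<^sub>v psi) (ltensor n d g2 *\<^sub>v psi))
            (two_copy n d (ltensor n d h1 *\<^sub>v psi) (ltensor n d h2 *\<^sub>v psi))
          \<longrightarrow> (prop_pos G1 H1 \<and> prop_pos G2 H2) \<or> (prop_pos G1 H2 \<and> prop_pos G2 H1))"
proof (cases "n = 0 \<or> d = 0")
  case True
  \<comment> \<open>In the degenerate dimensions \<open>ltensor\<close> does not see its factors:
    the product is empty for \<open>n = 0\<close>, and otherwise \<open>d = 0\<close> leaves no
    entries.\<close>
  have "ltensor n d A = ltensor n d B" for A B
    using True by (intro eq_matI) (auto simp: ltensor_def power_0_left split: if_splits)
  then have "G1 = H1" "G2 = H2" unfolding G1_def G2_def H1_def H2_def by metis+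
  moreover have "prop_pos M M" for M
    unfolding prop_pos_def by (intro exI[of _ 1]) (simp add: one_smult_mat)
  ultimately show ?thesis by simp
next
  case False
  then interpret two_copy_state n d psi
    using psi fe stab by unfold_locales auto
  show ?thesis
    using LOCCN_imp_prop_pos[OF g1 g2 h1 h2] LOCC_imp_prop_pos[OF g1 g2 h1 h2]
    unfolding G1_def G2_def H1_def H2_def by blast
qed

end
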